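(* Let $\gamma\ge1$ and $0<v_+<v_0<1$ be arbitrary. Then: (i) $D_{\rm in}(0)\ne0$; hence the number of unstable roots of $D_{\rm in}$ is even. (ii) $D^0_{\rm in}(0)=0$, and $\lim_{v_0\to0}D^0_{\rm in}(\lambda)=0$ for every $\lambda$ with $\operatorname{Re}\lambda\ge0$. (iii) $(D^0_{\rm in})'(0)\ne0$, $D_{\rm out}'(0)\ne0$ and $(D^0_{\rm out})'(0)\ne0$ (prime denoting $d/d\lambda$); hence the number of nonzero unstable roots of each of $D^0_{\rm in}$, $D_{\rm out}$, $D^0_{\rm out}$ is even. Here unstable roots are zeros in $\{\operatorname{Re}\lambda\ge0\}$, counted with multiplicity.
   Context: Parameters: $\gamma\ge1$, $0<v_+<v_0<1$, $a:=v_+^\gamma\frac{1-v_+}{1-v_+^\gamma}$. The profile $\hat v$ is the (monotone decreasing) solution on $\mathbb{R}$ of $\hat v'=\hat v\big(\hat v-1+a(\hat v^{-\gamma}-1)\big)$ with $\hat v(0)=v_0$; $\hat v(-\infty)=1$, $\hat v(+\infty)=v_+$. Put $f(\hat v)=2\hat v-a(\gamma-1)\hat v^{-\gamma}-(a+1)$, $$A(x,\lambda)=\begin{pmatrix}0&\lambda&\lambda\\0&0&\lambda\\ \hat v&\hat v&f(\hat v)-\lambda\end{pmatrix},\qquad A_\pm(\lambda)=A(\pm\infty,\lambda).$$ For vectors in $\mathbb{C}^3$, $x\cdot y=\sum_ix_i\bar y_i$. $D_{\rm in}$: for $\operatorname{Re}\lambda\ge0$, $\lambda\ne0$, $-A_+(\lambda)^*$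 has exactly one eigenvalue $\tilde\mu_1^+(\lambda)$ of negative real part; it and a nonzero eigenvector $\widetilde V_1^+(\lambda)$ can be chosen analytic in $\bar\lambda$ and extend so (with $\widetilde V_1^+\neq 0$) to a neighborhood of $\lambda=0$. $\widetilde W_1^+$ is the solution of $\widetilde W'=-A^*\widetilde W$ with $\widetilde W_1^+\sim e^{\tilde\mu_1^+x}\widetilde V_1^+$ as $x\to+\infty$ (extended analytically in $\bar\lambda$ to $\lambda=0$), and $D_{\rm in}(\lambda):=(1,0,0)^T\cdot\widetilde W_1^+(0,\lambda)$. $D_{\rm out}$: for $\operatorname{Re}\lambda\ge0$, $A_-(\lambda)$ has exactly one eigenvalue $\mu_1^-(\lambda)$ of positive real part, with analytically chosen nonzero eigenvector $V_1^-(\lambda)$; $W_1^-$ is the solution of $W'=AW$ with $W_1^-\sim e^{\mu_1^-x}V_1^-$ as $x\to-\infty$, and $D_{\rm out}(\lambda):=W_1^-(0,\lambda)\cdot\big(0,-1,-\bar\lambda/(\bar\lambda-\hat v'(0))\big)^T$. (One has $D_{\rm out}(0)=0$.) Limiting objects ($v_+=0$): $\hat v^0$ solves $(\hat v^0)'=\hat v^0(\hat v^0-1)$, $\hat v^0(0)=v_0$; $A^0(x,\lambda)$ is $A$ with $\hat v$ replaced by $\hat v^0$ and $f(\hat v)$ by $2\hat v^0-1$. $\widetilde W_1^{0+}$ is the solution of $\widetilde W'=-(A^0)^*\widetilde W$ tending as $x\to+\infty$ to $(0,-1,\bar\lambda/\bar\mu)^T$, $\mu:=-1-\lambda$, and $D^0_{\rm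 in}(\lambda):=(1,0,0)^T\cdot\widetilde W_1^{0+}(0,\lambda)$. $W_1^{0-}$ is the solution of $W'=A^0W$ with $W_1^{0-}\sim e^{\mu^{0-}x}V_1^{0-}$ as $x\to-\infty$, where $\mu^{0-},V_1^{0-}$ are the eigenvalue of positive real part of $A^0(-\infty,\lambda)$ and an analytically chosen nonzero eigenvector, and $D^0_{\rm out}(\lambda):=W_1^{0-}(0,\lambda)\cdot\big(0,-1,-\bar\lambda/(\bar\lambda-(\hat v^0)'(0))\big)^T$. All of these are analytic on $\operatorname{Re}\lambda\ge0$ (including near $\lambda=0$). *)

theory Defs
  imports "HOL-Complex_Analysis.Complex_Analysis"
begin

definition a_par :: "real \<Rightarrow> real \<Rightarrow> real" where
  "a_par \<gamma> vp = vp powr \<gamma> * ((1 - vp) / (1 - vp powr \<gamma>))"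

definition is_profile :: "real \<Rightarrow> real \<Rightarrow> real \<Rightarrow> (real \<Rightarrow> real) \<Rightarrow> bool" where
  "is_profile \<gamma> vp v0 v \<longleftrightarrow>
     (\<forall>x. (v has_real_derivative v x * (v x - 1 + a_par \<gamma> vp * (v x powr (-\<gamma>) - 1))) (at x)) \<and>
     v 0 = v0 \<and> antimono v \<and> (v \<longlongrightarrow> 1) at_bot \<and> (v \<longlongrightarrow> vp) at_top"

definition is_profile0 :: "real \<Rightarrow> (real \<Rightarrow> real) \<Rightarrow> bool" where
  "is_profile0 v0 v \<longleftrightarrow>
     (\<forall>x. (v has_real_derivative v x * (v x - 1)) (at x)) \<and> v 0 = v0"

definition f_coef :: "real \<Rightarrow> real \<Rightarrow> real \<Rightarrow> real" where
  "f_coef \<gamma> vp v = 2 * v - a_par \<gamma> vp * (\<gamma> - 1) * v powr (-\<gamma>) - (a_par \<gamma> vp + 1)"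

definition f_coef0 :: "real \<Rightarrow> real" where
  "f_coef0 v = 2 * v - 1"

(* The spectral parameter is called z.  A(x,z) depends on x only through the profile value v. Below, f is f_coef \<gamma> vp or f_coef0, and
   the limits A(-\<infinity>,z), A(+\<infinity>,z) are obtained by putting v = 1, respectively v = vp
   (for the limiting profile, v = 1 at -\<infinity> as well). *)
definition A_mat :: "(real \<Rightarrow> real) \<Rightarrow> real \<Rightarrow> complex \<Rightarrow> complex^3^3" where
  "A_mat f v z = vector
     [vector [0, z, z],
      vector [0, 0, z],
      vector [of_real v, of_real v, of_real (f v) - z]]"

definition conj_transpose :: "complex^3^3 \<Rightarrow> complex^3^3" where
  "conj_transpose M = transpose (map_matrix cnj M)"

definition cdot :: "complex^3 \<Rightarrow> complex^3 \<Rightarrow> complex" where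
  "cdot x y = (\<Sum>i\<in>UNIV. x $ i * cnj (y $ i))"

definition is_eigenpair :: "complex^3^3 \<Rightarrow> complex \<Rightarrow> complex^3 \<Rightarrow> bool" where
  "is_eigenpair M \<mu> V \<longleftrightarrow> V \<noteq> 0 \<and> M *v V = \<mu> *s V"

definition unstable_halfplane :: "complex set" where
  "unstable_halfplane = {z. Re z \<ge> 0}"

(* Analyticity on the closed half-plane is always that of analytic_on, i.e. analyticity on an
   open neighbourhood of it; in particular a neighbourhood of 0 is included.  What the functions
   below do outside the half-plane is fixed by analytic continuation from inside. *)
definition vec_analytic_on :: "(complex \<Rightarrow> complex^3) \<Rightarrow> complex set \<Rightarrow> bool" where
  "vec_analytic_on F S \<longleftrightarrow> (\<forall>i. (\<lambda>z. F z $ i) analytic_on S)"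

(* analytic in the variable cnj z, for z \<in> S *)
definition conj_analytic_on :: "(complex \<Rightarrow> complex) \<Rightarrow> complex set \<Rightarrow> bool" where
  "conj_analytic_on F S \<longleftrightarrow> (\<lambda>z. F (cnj z)) analytic_on (cnj ` S)"

definition vec_conj_analytic_on :: "(complex \<Rightarrow> complex^3) \<Rightarrow> complex set \<Rightarrow> bool" where
  "vec_conj_analytic_on F S \<longleftrightarrow> (\<forall>i. conj_analytic_on (\<lambda>z. F z $ i) S)"

definition solves :: "(real \<Rightarrow> complex^3^3) \<Rightarrow> (real \<Rightarrow> complex^3) \<Rightarrow> bool" where
  "solves M W \<longleftrightarrow> (\<forall>x. (W has_vector_derivative (M x *v W x)) (at x))"

(* W(x) ~ exp(\<mu> x) V along the filter F (at_top or at_bot) *)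
definition asymp_exp :: "(real \<Rightarrow> complex^3) \<Rightarrow> complex \<Rightarrow> complex^3 \<Rightarrow> real filter \<Rightarrow> bool" where
  "asymp_exp W \<mu> V F \<longleftrightarrow> ((\<lambda>x. exp (- (\<mu> * of_real x)) *s W x) \<longlongrightarrow> V) F"

(* (mu, V, W) is an admissible choice of the decaying adjoint mode at +\<infinity>.  At z = 0 the eigenvalue
   is no longer of negative real part: there mu, V, W are the analytic extensions (with V 0 \<noteq> 0),
   so the spectral and asymptotic conditions are only imposed for z \<noteq> 0. *)
definition is_adjoint_mode ::
  "(real \<Rightarrow> real) \<Rightarrow> real \<Rightarrow> (real \<Rightarrow> real) \<Rightarrow> (complex \<Rightarrow> complex) \<Rightarrow> (complex \<Rightarrow> complex^3) \<Rightarrow>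
   (real \<Rightarrow> complex \<Rightarrow> complex^3) \<Rightarrow> bool" where
  "is_adjoint_mode f vp v mu V W \<longleftrightarrow>
     conj_analytic_on mu unstable_halfplane \<and>
     vec_conj_analytic_on V unstable_halfplane \<and> V 0 \<noteq> 0 \<and>
     (\<forall>z\<in>unstable_halfplane - {0}.
        Re (mu z) < 0 \<and> is_eigenpair (- conj_transpose (A_mat f vp z)) (mu z) (V z) \<and>
        asymp_exp (\<lambda>x. W x z) (mu z) (V z) at_top) \<and>
     (\<forall>z\<in>unstable_halfplane. solves (\<lambda>x. - conj_transpose (A_mat f (v x) z)) (\<lambda>x. W x z)) \<and>
     (\<forall>x. vec_conj_analytic_on (W x) unstable_halfplane)"

(* (mu, V, W) is an admissible choice of the mode decaying at -\<infinity>, where v = 1. *)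
definition is_growing_mode ::
  "(real \<Rightarrow> real) \<Rightarrow> (real \<Rightarrow> real) \<Rightarrow> (complex \<Rightarrow> complex) \<Rightarrow> (complex \<Rightarrow> complex^3) \<Rightarrow>
   (real \<Rightarrow> complex \<Rightarrow> complex^3) \<Rightarrow> bool" where
  "is_growing_mode f v mu V W \<longleftrightarrow>
     vec_analytic_on V unstable_halfplane \<and>
     (\<forall>z\<in>unstable_halfplane.
        Re (mu z) > 0 \<and> is_eigenpair (A_mat f 1 z) (mu z) (V z) \<and>
        solves (\<lambda>x. A_mat f (v x) z) (\<lambda>x. W x z) \<and>
        asymp_exp (\<lambda>x. W x z) (mu z) (V z) at_bot) \<and>
     (\<forall>x. vec_analytic_on (W x) unstable_halfplane)"

definition is_adjoint_mode0 :: "(real \<Rightarrow> real) \<Rightarrow> (real \<Rightarrow> complex \<Rightarrow> complex^3) \<Rightarrow> bool" where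
  "is_adjoint_mode0 v W \<longleftrightarrow>
     (\<forall>z\<in>unstable_halfplane.
        solves (\<lambda>x. - conj_transpose (A_mat f_coef0 (v x) z)) (\<lambda>x. W x z) \<and>
        ((\<lambda>x. W x z) \<longlongrightarrow> vector [0, -1, cnj z / cnj (-1 - z)]) at_top) \<and>
     (\<forall>x. vec_conj_analytic_on (W x) unstable_halfplane)"

definition D_in :: "(real \<Rightarrow> complex \<Rightarrow> complex^3) \<Rightarrow> complex \<Rightarrow> complex" where
  "D_in W z = cdot (vector [1, 0, 0]) (W 0 z)"

definition D_out :: "(real \<Rightarrow> real) \<Rightarrow> (real \<Rightarrow> complex \<Rightarrow> complex^3) \<Rightarrow> complex \<Rightarrow> complex" where
  "D_out v W z =
     cdot (W 0 z) (vector [0, -1, - (cnj z / (cnj z - of_real (deriv v 0)))])"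

definition unstable_roots :: "(complex \<Rightarrow> complex) \<Rightarrow> complex set" where
  "unstable_roots D = {z\<in>unstable_halfplane. D z = 0}"

(* zorder D z is the multiplicity of the zero z of D *)
definition even_count :: "(complex \<Rightarrow> complex) \<Rightarrow> complex set \<Rightarrow> bool" where
  "even_count D R \<longleftrightarrow> finite R \<and> even (\<Sum>z\<in>R. zorder D z)"

end

theory Submission
  imports Defs
begin

text \<open>
  All statements follow from two facts about the linear systems behind the four determinants.

  \<^bold>\<open>Positivity.\<close> For real \<open>z > 0\<close> the matrix of the system has nonnegative off-diagonal entries, so the growing
  mode, and the adjoint mode followed backwards from \<open>+\<infinity>\<close>, stay in the positive orthant (up to the complex factor
  by which they are normalized). In the outflow determinant two terms of equal sign are added, and the inflow
  determinant is a single component, so no determinant has a positive real zero. Moreover the comparison is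
  quantitative. Since the matrix dominates its limit at \<open>+\<infinity>\<close>, the modulus of \<open>D_in\<close> is at least that of the first component
  of the eigenvector at \<open>+\<infinity>\<close>, which does not vanish at \<open>z = 0\<close>; this gives \<open>D_in 0 \<noteq> 0\<close>. The other three
  determinants vanish at \<open>0\<close> and are bounded below by a positive multiple of \<open>z\<close> as \<open>z\<close> decreases to \<open>0\<close>, so their
  derivatives do not vanish. (Lemmas \<open>adjoint_mode_positive\<close>, \<open>growing_mode_positive\<close>,
  \<open>limiting_adjoint_mode_positive\<close>.)

  \<^bold>\<open>Energy estimates.\<close> For large \<open>|z|\<close> with \<open>Re z \<ge> 0\<close> the system consists, to leading order, of a hyperbolic pair
  with exponents \<open>\<plusminus> sqrt (z v)\<close> and a mode with exponent close to \<open>- z\<close>. A quadratic functional of the solution is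
  strictly monotone in \<open>x\<close> and tends to zero at the infinite end. If the determinant vanishes, the functional
  has the opposite sign at \<open>x = 0\<close>; then it is zero throughout, and so is the mode. Hence all unstable roots lie
  in a bounded set. (Lemmas \<open>adjoint_solution_zero_if_high_frequency\<close>, \<open>growing_solution_zero_if_high_frequency\<close>.)

  \<^bold>\<open>Parity.\<close> Positivity also shows that each determinant, divided by the normalizing factor of its mode, is real on the
  positive axis. By the identity theorem the zeros of the determinant in the half-plane, apart from \<open>0\<close>, are symmetric with
  respect to conjugation, with equal multiplicities. They are finite in number by the energy estimate, and none
  of them is real, so they pair up (lemma \<open>even_count_nonzero_roots\<close>).

  The limit \<open>v0 \<rightarrow> 0\<close> rests on a direct estimate: with the limit of the adjoint mode at \<open>+\<infinity>\<close> fixed, its first component is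
  driven by the coefficient \<open>v\<close> alone, which on the half-line is at most \<open>v0\<close> (lemma \<open>limiting_D_in_bound\<close>).
\<close>

unbundle no Formal_Power_Series.fps_syntax

section \<open>Differential inequalities on the line\<close>

text \<open>At the first time at which some component vanishes all components were positive before, so up to
  then each of them decays at most exponentially and cannot have reached zero.\<close>

lemma positive_orthant_invariant:
  fixes y y' :: "'i::finite \<Rightarrow> real \<Rightarrow> real"
  assumes "a \<le> b"
    and der: "\<And>i t. a \<le> t \<Longrightarrow> t \<le> b \<Longrightarrow> (y i has_real_derivative y' i t) (at t)"
    and ineq: "\<And>i t. a \<le> t \<Longrightarrow> t \<le> b \<Longrightarrow> (\<And>j. 0 < y j t) \<Longrightarrow> y' i t \<ge> - K * y i t"
    and start: "\<And>i. 0 < y i a"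
  shows "0 < y i b"
proof (rule ccontr)
  assume neg: "\<not> 0 < y i b"
  define S where "S = (\<Union>j. {t\<in>{a..b}. y j t \<le> 0})"
  have cont: "continuous_on {a..b} (y j)" for j
    using der by (intro DERIV_continuous_on[where D="y' j"]) (auto intro: DERIV_subset)
  have "closed {t\<in>{a..b}. y j t \<le> 0}" for j
    using continuous_on_closed_Collect_le[OF cont[of j] continuous_on_const closed_atLeastAtMost] by simp
  then have "compact {t\<in>{a..b}. y j t \<le> 0}" for j
    by (rule compact_Int_closed[OF compact_Icc, of _ a b, THEN back_subst[of compact]]) auto
  then have "compact S" unfolding S_def by (intro compact_UN) auto
  moreover have "b \<in> S" using neg assms(1) unfolding S_def by (auto simp: not_less)
  ultimately obtain t where t: "t \<in> S" "\<And>s. s \<in> S \<Longrightarrow> t \<le> s"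
    using compact_attains_inf[of S] by blast
  obtain j where j: "y j t \<le> 0" and tab: "a \<le> t" "t \<le> b" using t(1) unfolding S_def by auto
  have pos: "0 < y l s" if "a \<le> s" "s < t" for l s
  proof (rule ccontr)
    assume "\<not> 0 < y l s"
    then have "s \<in> S" using that tab unfolding S_def by (auto simp: not_less)
    then show False using t(2)[of s] that by simp
  qed
  have "a < t" using j start[of j] tab by (metis less_le not_le)
  have "y j a * exp (K * a) \<le> y j t * exp (K * t)"
  proof (rule DERIV_nonneg_imp_increasing_open[OF tab(1)])
    fix s assume s: "a < s" "s < t"
    have "((\<lambda>s. y j s * exp (K * s)) has_real_derivative (y' j s + K * y j s) * exp (K * s)) (at s)"
      using der[of s j] s tab by (auto intro!: derivative_eq_intros simp: algebra_simps)
    moreover have "y' j s + K * y j s \<ge> 0" using ineq[of s j] pos s tab by force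
    ultimately show "\<exists>d. ((\<lambda>s. y j s * exp (K * s)) has_real_derivative d) (at s) \<and> 0 \<le> d"
      by (meson exp_ge_zero mult_nonneg_nonneg)
  next
    show "continuous_on {a..t} (\<lambda>s. y j s * exp (K * s))"
      using continuous_on_subset[OF cont[of j], of "{a..t}"] tab by (auto intro!: continuous_intros)
  qed
  moreover have "y j a * exp (K * a) > 0" using start[of j] by simp
  ultimately have "0 < y j t * exp (K * t)" by linarith
  then show False using j by (simp add: zero_less_mult_iff)
qed

lemma nonincreasing_ge_limit:
  fixes g g' :: "real \<Rightarrow> real"
  assumes "\<And>x. a \<le> x \<Longrightarrow> (g has_real_derivative g' x) (at x)" "\<And>x. a \<le> x \<Longrightarrow> g' x \<le> 0"
    and "(g \<longlongrightarrow> l) at_top" and "a \<le> x"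
  shows "l \<le> g x"
proof (rule tendsto_upperbound[OF assms(3)])
  show "\<forall>\<^sub>F y in at_top. g y \<le> g x"
    using eventually_ge_at_top[of x]
  proof eventually_elim
    case (elim y)
    then show ?case
      using assms(1,2,4) by (intro DERIV_nonpos_imp_nonincreasing[OF elim]) (meson order_trans)
  qed
qed simp

lemma has_real_derivative_Re_mult_cnj:
  assumes "(f has_vector_derivative f') (at x)" "(g has_vector_derivative g') (at x)"
  shows "((\<lambda>x. Re (c * (f x * cnj (g x)))) has_real_derivative
          Re (c * (f' * cnj (g x) + f x * cnj g'))) (at x)"
proof -
  have "((\<lambda>x. f x * cnj (g x)) has_vector_derivative f x * cnj g' + f' * cnj (g x)) (at x)"
    by (intro has_vector_derivative_mult assms bounded_linear.has_vector_derivative[OF bounded_linear_cnj])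
  then have "((\<lambda>x. c * (f x * cnj (g x))) has_vector_derivative c * (f x * cnj g' + f' * cnj (g x))) (at x)"
    by (intro bounded_linear.has_vector_derivative[OF bounded_linear_mult_right])
  from bounded_linear.has_vector_derivative[OF bounded_linear_Re this]
  show ?thesis unfolding has_real_derivative_iff_has_vector_derivative by (simp add: add.commute)
qed

lemma has_real_derivative_Re_cmult:
  assumes "(f has_vector_derivative f') (at x)"
  shows "((\<lambda>x. Re (c * f x)) has_real_derivative Re (c * f')) (at x)"
  using has_real_derivative_Re_mult_cnj[OF assms has_vector_derivative_const[of 1], of c] by simp

lemma has_real_derivative_cmod_sq:
  assumes "(f has_vector_derivative f') (at x)"
  shows "((\<lambda>x. (cmod (f x))\<^sup>2) has_real_derivative 2 * Re (f' * cnj (f x))) (at x)"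
proof -
  have "(\<lambda>x. (cmod (f x))\<^sup>2) = (\<lambda>x. Re (1 * (f x * cnj (f x))))"
    by (auto simp: cmod_power2 simp flip: power2_eq_square)
  moreover have "Re (1 * (f' * cnj (f x) + f x * cnj f')) = 2 * Re (f' * cnj (f x))" by (simp add: algebra_simps)
  ultimately show ?thesis using has_real_derivative_Re_mult_cnj[OF assms assms, of 1] by metis
qed

lemma linear_ode_zero:
  fixes E :: "real \<Rightarrow> complex"
  assumes der: "\<And>x. (E has_vector_derivative h x * E x) (at x)"
    and cont: "continuous_on UNIV h" and "E x0 = 0"
  shows "E x = 0"
proof -
  have "compact (h ` {min x0 x..max x0 x})"
    by (intro compact_continuous_image continuous_on_subset[OF cont]) auto
  then have "bounded (h ` {min x0 x..max x0 x})" by (rule compact_imp_bounded)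
  then obtain K where K: "\<And>t. t \<in> {min x0 x..max x0 x} \<Longrightarrow> cmod (h t) \<le> K"
    unfolding bounded_iff by blast
  define q where "q x = 2 * Re (h x * E x * cnj (E x))" for x
  have q: "((\<lambda>x. (cmod (E x))\<^sup>2) has_real_derivative q x) (at x)" for x
    unfolding q_def using has_real_derivative_cmod_sq[OF der] .
  have qb: "\<bar>q t\<bar> \<le> 2 * K * (cmod (E t))\<^sup>2" if "t \<in> {min x0 x..max x0 x}" for t
  proof -
    have "\<bar>q t\<bar> \<le> 2 * cmod (h t * E t * cnj (E t))" unfolding q_def abs_mult using abs_Re_le_cmod[of "h t * E t * cnj (E t)"] by linarith
    also have "\<dots> = 2 * (cmod (h t) * (cmod (E t))\<^sup>2)" by (simp add: norm_mult power2_eq_square)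
    also have "\<dots> \<le> 2 * (K * (cmod (E t))\<^sup>2)" using K[OF that] by (intro mult_left_mono mult_right_mono) auto
    finally show ?thesis by simp
  qed
  have d: "((\<lambda>x. (cmod (E x))\<^sup>2 * exp (s * x)) has_real_derivative
      (q x + s * (cmod (E x))\<^sup>2) * exp (s * x)) (at x)" for s x
  proof -
    have "((\<lambda>x. exp (s * x)) has_real_derivative s * exp (s * x)) (at x)"
      by (auto intro!: derivative_eq_intros)
    from DERIV_mult[OF q this] show ?thesis by (simp add: algebra_simps)
  qed
  have "(cmod (E x))\<^sup>2 * exp (- 2 * K * x) \<le> (cmod (E x0))\<^sup>2 * exp (- 2 * K * x0)" if "x0 \<le> x"
  proof (rule DERIV_nonpos_imp_nonincreasing[OF that])
    fix t assume "x0 \<le> t" "t \<le> x"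
    then have "q t + - 2 * K * (cmod (E t))\<^sup>2 \<le> 0" using qb[of t] by simp
    then show "\<exists>y. ((\<lambda>x. (cmod (E x))\<^sup>2 * exp (- 2 * K * x)) has_real_derivative y) (at t) \<and> y \<le> 0"
      using d[of "-2*K" t] by (meson exp_ge_zero mult_nonpos_nonneg)
  qed
  moreover have "(cmod (E x))\<^sup>2 * exp (2 * K * x) \<le> (cmod (E x0))\<^sup>2 * exp (2 * K * x0)" if "x \<le> x0"
  proof (rule DERIV_nonneg_imp_nondecreasing[OF that])
    fix t assume "x \<le> t" "t \<le> x0"
    then have "q t + 2 * K * (cmod (E t))\<^sup>2 \<ge> 0" using qb[of t] by simp
    then show "\<exists>y. ((\<lambda>x. (cmod (E x))\<^sup>2 * exp (2 * K * x)) has_real_derivative y) (at t) \<and> 0 \<le> y"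
      using d[of "2*K" t] by (meson exp_ge_zero mult_nonneg_nonneg)
  qed
  ultimately show ?thesis using assms(3) by (cases "x0 \<le> x") (auto simp: mult_le_0_iff)
qed

text \<open>A maximum principle on the half-line: the supremum is either attained, at a point where the derivative is
  not positive, or it is the limit at infinity.\<close>

lemma bounded_by_limit_or_maximum:
  fixes g g' :: "real \<Rightarrow> real"
  assumes der: "\<And>x. 0 \<le> x \<Longrightarrow> (g has_real_derivative g' x) (at x)" and lim: "(g \<longlongrightarrow> l) at_top"
  shows "(\<forall>x\<ge>0. g x \<le> l) \<or> (\<exists>m\<ge>0. (\<forall>x\<ge>0. g x \<le> g m) \<and> g' m \<le> 0)"
proof (cases "\<forall>x\<ge>0. g x \<le> l")
  case False
  then obtain x0 where x0: "x0 \<ge> 0" "g x0 > l" by force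
  obtain X where X: "\<And>x. x \<ge> X \<Longrightarrow> g x < g x0"
    using order_tendstoD(2)[OF lim x0(2)] unfolding eventually_at_top_linorder by blast
  have "continuous_on {0..max X x0} g"
    using der by (intro DERIV_continuous_on[where D=g']) (auto intro: DERIV_subset)
  then obtain m where m: "m \<in> {0..max X x0}" "\<And>y. y \<in> {0..max X x0} \<Longrightarrow> g y \<le> g m"
    using continuous_attains_sup[of "{0..max X x0}" g] x0(1)
    by (metis atLeastatMost_empty_iff compact_Icc max.coboundedI2)
  have "g x0 \<le> g m" using m(2)[of x0] x0 by simp
  then have gm: "g x \<le> g m" if "x \<ge> 0" for x
    using X[of x] m(2)[of x] that \<open>g x0 \<le> g m\<close>
    by (cases "X \<le> x") (auto simp: le_max_iff_disj)
  have "g' m \<le> 0"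
  proof (rule ccontr)
    assume "\<not> g' m \<le> 0"
    then obtain d where "d > 0" "\<And>h. h > 0 \<Longrightarrow> h < d \<Longrightarrow> g m < g (m + h)"
      using DERIV_pos_inc_right[OF der[of m]] m by auto
    then have "g m < g (m + d/2)" by simp
    then show False using gm[of "m + d/2"] m(1) \<open>d > 0\<close> by simp
  qed
  then show ?thesis using gm m(1) by auto
qed simp

text \<open>The modes below are fixed only up to a complex factor, and positivity is available for real
  solutions, such as the real part of any complex multiple of a mode. Applying it to all multiples by
  \<open>1 + \<tau>\<i>\<close> leaves no room for an imaginary part.\<close>

lemma real_if_tilted_Re_ge:
  assumes "\<And>\<tau>::real. Re ((1 + \<tau> * \<i>) * q) \<ge> p"
  shows "Im q = 0" "Re q \<ge> p"
proof -
  show "Re q \<ge> p" using assms[of 0] by simp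
  show "Im q = 0"
  proof (rule ccontr)
    assume "Im q \<noteq> 0"
    then show False using assms[of "(Re q - p + 1) / Im q"] by simp
  qed
qed

section \<open>The spectral system in components\<close>
lemma growing_components: 
  assumes "solves (\<lambda>x. A_mat f (v x) z) W"
  shows "((\<lambda>x. W x $ 1) has_vector_derivative z * W x $ 2 + z * W x $ 3) (at x)"
    and "((\<lambda>x. W x $ 2) has_vector_derivative z * W x $ 3) (at x)"
    and "((\<lambda>x. W x $ 3) has_vector_derivative
            of_real (v x) * (W x $ 1 + W x $ 2) + (of_real (f (v x)) - z) * W x $ 3) (at x)"
proof -
  have d: "((\<lambda>x. W x $ i) has_vector_derivative (A_mat f (v x) z *v W x) $ i) (at x)" for i
    using assms bounded_linear.has_vector_derivative[OF bounded_linear_vec_nth] unfolding solves_def by blast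
  show "((\<lambda>x. W x $ 1) has_vector_derivative z * W x $ 2 + z * W x $ 3) (at x)"
    using d[of 1] by (simp add: A_mat_def matrix_vector_mult_def sum_3)
  show "((\<lambda>x. W x $ 2) has_vector_derivative z * W x $ 3) (at x)"
    using d[of 2] by (simp add: A_mat_def matrix_vector_mult_def sum_3)
  show "((\<lambda>x. W x $ 3) has_vector_derivative
            of_real (v x) * (W x $ 1 + W x $ 2) + (of_real (f (v x)) - z) * W x $ 3) (at x)"
    using d[of 3] by (simp add: A_mat_def matrix_vector_mult_def sum_3 algebra_simps)
qed
text \<open>For the adjoint system the conjugate components are used: conjugation turns \<open>- A\<^sup>*\<close> into minus the transpose
  of \<open>A\<close>, and dependence on the conjugate of \<open>z\<close> into dependence on \<open>z\<close>.\<close>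

lemma adjoint_components: 
  assumes "solves (\<lambda>x. - conj_transpose (A_mat f (v x) z)) W"
  shows "((\<lambda>x. cnj (W x $ 1)) has_vector_derivative - (of_real (v x) * cnj (W x $ 3))) (at x)"
    and "((\<lambda>x. cnj (W x $ 2)) has_vector_derivative - (z * cnj (W x $ 1) + of_real (v x) * cnj (W x $ 3))) (at x)"
    and "((\<lambda>x. cnj (W x $ 3)) has_vector_derivative
            - (z * cnj (W x $ 1) + z * cnj (W x $ 2) + (of_real (f (v x)) - z) * cnj (W x $ 3))) (at x)"
proof -
  have d: "((\<lambda>x. cnj (W x $ i)) has_vector_derivative cnj ((- conj_transpose (A_mat f (v x) z) *v W x) $ i)) (at x)" for i
    using assms bounded_linear.has_vector_derivative[OF bounded_linear_cnj]
      bounded_linear.has_vector_derivative[OF bounded_linear_vec_nth] unfolding solves_def by blast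
  note c = A_mat_def matrix_vector_mult_def sum_3 conj_transpose_def transpose_def map_matrix_def algebra_simps
  show "((\<lambda>x. cnj (W x $ 1)) has_vector_derivative - (of_real (v x) * cnj (W x $ 3))) (at x)"
    using d[of 1] by (simp add: c)
  show "((\<lambda>x. cnj (W x $ 2)) has_vector_derivative - (z * cnj (W x $ 1) + of_real (v x) * cnj (W x $ 3))) (at x)"
    using d[of 2] by (simp add: c)
  show "((\<lambda>x. cnj (W x $ 3)) has_vector_derivative
            - (z * cnj (W x $ 1) + z * cnj (W x $ 2) + (of_real (f (v x)) - z) * cnj (W x $ 3))) (at x)"
    using d[of 3] by (simp add: c)
qed

section \<open>Eigenvectors of the end states\<close>

lemma adjoint_eigenpair_components:
  assumes "is_eigenpair (- conj_transpose (A_mat f v z)) mu V" and "mu \<noteq> 0"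
  defines "m \<equiv> - cnj mu"
  shows "m * cnj (V $ 1) = of_real v * cnj (V $ 3)"
    and "m * cnj (V $ 2) = z * cnj (V $ 1) + of_real v * cnj (V $ 3)"
    and "m * cnj (V $ 3) = z * cnj (V $ 1) + z * cnj (V $ 2) + (of_real (f v) - z) * cnj (V $ 3)"
    and "V $ 3 \<noteq> 0"
proof -
  have "- (conj_transpose (A_mat f v z) *v V) = mu *s V"
    using assms(1) unfolding is_eigenpair_def
    by (simp add: matrix_vector_mult_def vec_eq_iff sum_negf)
  then have "(conj_transpose (A_mat f v z) *v V) $ i = - mu * V $ i" for i
    by (metis minus_mult_left minus_minus vector_smult_component vector_uminus_component)
  then have e: "cnj ((conj_transpose (A_mat f v z) *v V) $ i) = m * cnj (V $ i)" for i
    by (simp add: m_def)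
  note c = A_mat_def matrix_vector_mult_def sum_3 conj_transpose_def transpose_def map_matrix_def algebra_simps
  show 1: "m * cnj (V $ 1) = of_real v * cnj (V $ 3)" using e[of 1] by (simp add: c)
  show 2: "m * cnj (V $ 2) = z * cnj (V $ 1) + of_real v * cnj (V $ 3)"
    using e[of 2] by (simp add: c)
  show 3: "m * cnj (V $ 3) = z * cnj (V $ 1) + z * cnj (V $ 2) + (of_real (f v) - z) * cnj (V $ 3)"
    using e[of 3] by (simp add: c)
  show "V $ 3 \<noteq> 0"
  proof
    assume "V $ 3 = 0"
    then have "V $ 1 = 0" "V $ 2 = 0" using 1 2 assms(2) by (auto simp: m_def)
    then have "V = 0" using \<open>V $ 3 = 0\<close> by (simp add: vec_eq_iff forall_3)
    then show False using assms(1) by (simp add: is_eigenpair_def)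
  qed
qed

lemma growing_eigenpair_components:
  assumes "is_eigenpair (A_mat f v z) mu V" and "mu \<noteq> 0"
  shows "mu * V $ 1 = z * V $ 2 + z * V $ 3"
    and "mu * V $ 2 = z * V $ 3"
    and "mu * V $ 3 = of_real v * (V $ 1 + V $ 2) + (of_real (f v) - z) * V $ 3"
    and "V $ 3 \<noteq> 0"
proof -
  have e: "(A_mat f v z *v V) $ i = mu * V $ i" for i
    using assms(1) unfolding is_eigenpair_def by simp
  note c = A_mat_def matrix_vector_mult_def sum_3 algebra_simps
  show 1: "mu * V $ 1 = z * V $ 2 + z * V $ 3" using e[of 1] by (simp add: c)
  show 2: "mu * V $ 2 = z * V $ 3" using e[of 2] by (simp add: c)
  show 3: "mu * V $ 3 = of_real v * (V $ 1 + V $ 2) + (of_real (f v) - z) * V $ 3"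
    using e[of 3] by (simp add: c)
  show "V $ 3 \<noteq> 0"
  proof
    assume "V $ 3 = 0"
    then have "V $ 1 = 0" "V $ 2 = 0" using 1 2 assms(2) by auto
    then have "V = 0" using \<open>V $ 3 = 0\<close> by (simp add: vec_eq_iff forall_3)
    then show False using assms(1) by (simp add: is_eigenpair_def)
  qed
qed

text \<open>The characteristic equation of the end state, common to the matrix and its adjoint.\<close>

lemma adjoint_characteristic:
  fixes m :: complex
  assumes "m * c1 = v * c3" "m * c2 = z * c1 + v * c3" "m * c3 = z * c1 + z * c2 + (f - z) * c3" "c3 \<noteq> 0"
  shows "m ^ 3 = v * (z\<^sup>2 + 2 * z * m) + (f - z) * m\<^sup>2"
proof -
  have "m ^ 3 * c3 = m * (z * (m * c1) + z * (m * c2) + (f - z) * (m * c3))"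
    using arg_cong[OF assms(3), of "\<lambda>t. m * m * t"] by (simp add: power3_eq_cube algebra_simps)
  also have "\<dots> = z * m * (m * c1) + z * (z * (m * c1) + m * (v * c3)) + (f - z) * m\<^sup>2 * c3"
    unfolding assms(2) by (simp add: power2_eq_square algebra_simps)
  also have "\<dots> = (v * (z\<^sup>2 + 2 * z * m) + (f - z) * m\<^sup>2) * c3"
    unfolding assms(1) by (simp add: power2_eq_square algebra_simps)
  finally show ?thesis using assms(4) by simp
qed

lemma growing_characteristic:
  fixes m :: complex
  assumes "m * c1 = z * c2 + z * c3" "m * c2 = z * c3" "m * c3 = v * (c1 + c2) + (f - z) * c3" "c3 \<noteq> 0"
  shows "m ^ 3 = v * (z\<^sup>2 + 2 * z * m) + (f - z) * m\<^sup>2"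
proof -
  have "m ^ 3 * c3 = m * m * (m * c3)" by (simp add: power3_eq_cube)
  also have "\<dots> = v * (m * (m * c1) + m * (m * c2)) + (f - z) * m\<^sup>2 * c3"
    unfolding assms(3) by (simp add: power2_eq_square algebra_simps)
  also have "\<dots> = v * (z * (m * c2) + z * m * c3 + m * (m * c2)) + (f - z) * m\<^sup>2 * c3"
    unfolding assms(1) by (simp add: algebra_simps)
  also have "\<dots> = (v * (z\<^sup>2 + 2 * z * m) + (f - z) * m\<^sup>2) * c3"
    unfolding assms(2) by (simp add: power2_eq_square algebra_simps)
  finally show ?thesis using assms(4) by simp
qed

text \<open>Divided by \<open>m\<^sup>2\<close> the equation expresses \<open>m\<close> as a quadratic polynomial in \<open>1 / m\<close> whose linear and
  quadratic coefficients are positive. When \<open>Re m > 0\<close>, the imaginary part of that polynomial has the sign of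
  \<open>Im (1 / m)\<close>, which is opposite to the sign of \<open>Im m\<close>.\<close>

lemma characteristic_root_real:
  fixes v f l :: real and m :: complex
  assumes "0 < v" "0 < l" "0 < Re m"
    and eq: "m ^ 3 = of_real v * ((of_real l)\<^sup>2 + 2 * of_real l * m) + (of_real f - of_real l) * m\<^sup>2"
  shows "Im m = 0"
proof -
  define n where "n = inverse m"
  have m0: "m \<noteq> 0" using assms(3) by auto
  then have mn: "m * n = 1" by (simp add: n_def)
  have "m = m ^ 3 * n\<^sup>2"
    using mn by (simp add: power3_eq_cube power2_eq_square) (metis mult.assoc mult.commute mult.right_neutral)
  also have "\<dots> = of_real (v * l\<^sup>2) * n\<^sup>2 + of_real (2 * v * l) * (m * n) * n + of_real (f - l) * (m * n)\<^sup>2"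
    unfolding eq by (simp add: power2_eq_square algebra_simps)
  finally have "m = of_real (v * l\<^sup>2) * n\<^sup>2 + of_real (2 * v * l) * n + of_real (f - l)" by (simp add: mn)
  then have "Im m = Im (of_real (v * l\<^sup>2) * n\<^sup>2 + of_real (2 * v * l) * n + of_real (f - l))" by simp
  then have im: "Im m = (2 * v * l\<^sup>2 * Re n + 2 * v * l) * Im n"
    by (simp add: power2_eq_square algebra_simps)
  have "Re n > 0" using assms(3) by (simp add: n_def add_pos_nonneg)
  then have pos: "2 * v * l\<^sup>2 * Re n + 2 * v * l > 0" using assms by (simp add: add_pos_pos)
  have "Im n = - Im m / (cmod m)\<^sup>2" by (simp add: n_def cmod_power2)
  with im have "Im m = (2 * v * l\<^sup>2 * Re n + 2 * v * l) * (- Im m / (cmod m)\<^sup>2)" by simp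
  also have "\<dots> = - (Im m * ((2 * v * l\<^sup>2 * Re n + 2 * v * l) / (cmod m)\<^sup>2))" by simp
  finally have "Im m * (1 + (2 * v * l\<^sup>2 * Re n + 2 * v * l) / (cmod m)\<^sup>2) = 0"
    unfolding distrib_left mult_1_right by linarith
  moreover have "1 + (2 * v * l\<^sup>2 * Re n + 2 * v * l) / (cmod m)\<^sup>2 > 0" using pos by (simp add: add_pos_nonneg)
  ultimately show ?thesis by (metis less_irrefl mult_eq_0_iff)
qed

section \<open>Positivity of the modes at positive spectral parameter\<close>

text \<open>For \<open>z = l > 0\<close> the matrix has nonnegative off-diagonal entries, so solutions preserve the positive
  orthant. Moreover it dominates its limit at \<open>+\<infinity>\<close> entry by entry, so the exponentially normalized adjoint
  solution, followed from \<open>+\<infinity>\<close> to the left, stays above the positive left eigenvector \<open>p\<close> of the limit.\<close>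

lemma adjoint_solution_ge_eigenvector:
  fixes y :: "3 \<Rightarrow> real \<Rightarrow> real" and p :: "3 \<Rightarrow> real" and v g :: "real \<Rightarrow> real"
  assumes "0 < l" "0 < m" "0 < vp"
    and y1: "\<And>x. 0 \<le> x \<Longrightarrow> (y 1 has_real_derivative - (v x * y 3 x)) (at x)"
    and y2: "\<And>x. 0 \<le> x \<Longrightarrow> (y 2 has_real_derivative - (l * y 1 x + v x * y 3 x)) (at x)"
    and y3: "\<And>x. 0 \<le> x \<Longrightarrow> (y 3 has_real_derivative - (l * y 1 x + l * y 2 x + (g x - l) * y 3 x)) (at x)"
    and vp: "\<And>x. 0 \<le> x \<Longrightarrow> vp \<le> v x" and fp: "\<And>x. 0 \<le> x \<Longrightarrow> fp \<le> g x"
    and p: "\<And>i. 0 < p i" "m * p 1 = vp * p 3" "m * p 2 = l * p 1 + vp * p 3"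
      "m * p 3 = l * p 1 + l * p 2 + (fp - l) * p 3"
    and lim: "\<And>i. ((\<lambda>x. exp (m * x) * y i x) \<longlongrightarrow> p i) at_top"
  shows "p i \<le> y i 0"
proof (rule field_le_mult_one_interval)
  fix \<theta> :: real
  assume \<theta>: "0 < \<theta>" "\<theta> < 1"
  have "\<forall>\<^sub>F x in at_top. \<forall>j. \<theta> * p j < exp (m * x) * y j x"
    using order_tendstoD(1)[OF lim] p(1) \<theta> by (intro eventually_all_finite) auto
  then obtain X0 where X0: "\<And>x j. x \<ge> X0 \<Longrightarrow> \<theta> * p j < exp (m * x) * y j x"
    unfolding eventually_at_top_linorder by blast
  define X where "X = max X0 0"
  have X: "X \<ge> 0" "\<And>j. \<theta> * p j < exp (m * X) * y j X" using X0 by (auto simp: X_def)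
  define B where "B j x = (if j = 1 then v x * y 3 x else if j = 2 then l * y 1 x + v x * y 3 x
      else l * y 1 x + l * y 2 x + (g x - l) * y 3 x)" for j :: 3 and x
  \<comment> \<open>The comparison starts with strict inequality at a large \<open>X\<close>, which costs the factor \<open>\<theta>\<close>, and runs to the left in
    the time variable \<open>t = X - x\<close>.\<close>
  define d where "d j t = exp (m * (X - t)) * y j (X - t) - \<theta> * p j" for j t
  define d' where "d' j t = exp (m * (X - t)) * (B j (X - t) - m * y j (X - t))" for j t
  have yB: "\<And>x j. 0 \<le> x \<Longrightarrow> (y j has_real_derivative - B j x) (at x)"
    subgoal for x j using exhaust_3[of j] y1[of x] y2[of x] y3[of x] by (auto simp: B_def)
    done
  have "0 < d i X"
  proof (rule positive_orthant_invariant[where a=0 and b=X and y=d and y'=d' and K="m + l + \<bar>fp\<bar>"])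
    show "0 \<le> X" by (rule X(1))
    show "0 < d j 0" for j using X(2)[of j] by (simp add: d_def)
  next
    fix j t assume "0 \<le> t" "t \<le> X"
    then have s: "0 \<le> X - t" by simp
    have "((\<lambda>t. y j (X - t)) has_real_derivative B j (X - t)) (at t)"
    proof -
      have "((\<lambda>t. X - t) has_real_derivative - 1) (at t)" by (auto intro!: derivative_eq_intros)
      from DERIV_chain2[OF yB[OF s] this] show ?thesis by simp
    qed
    moreover have "((\<lambda>t. exp (m * (X - t))) has_real_derivative exp (m * (X - t)) * - m) (at t)"
      by (auto intro!: derivative_eq_intros)
    ultimately have "((\<lambda>t. exp (m * (X - t)) * y j (X - t) - \<theta> * p j) has_real_derivative
        (exp (m * (X - t)) * - m * y j (X - t) + B j (X - t) * exp (m * (X - t))) - 0) (at t)"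
      by (intro DERIV_diff DERIV_mult DERIV_const)
    then show "(d j has_real_derivative d' j t) (at t)"
      unfolding d_def[abs_def] d'_def by (simp add: algebra_simps)
    assume pos: "\<And>j. 0 < d j t"
    define s where "s = X - t"
    define Y where "Y j = exp (m * s) * y j s" for j
    have Y: "\<theta> * p j < Y j" "d j t = Y j - \<theta> * p j" for j using pos[of j] by (auto simp: d_def Y_def s_def)
    have v3: "v s * Y 3 \<ge> vp * (\<theta> * p 3)"
      using Y(1)[of 3] vp[of s] s assms(3) p(1)[of 3] \<theta> unfolding s_def
      by (intro mult_mono) (auto intro: less_imp_le)
    have K: "- (m + l + \<bar>fp\<bar>) * d j t \<le> - m * d j t" using pos[of j] assms(1)
      by (intro mult_right_mono) auto
    consider "j = 1" | "j = 2" | "j = 3" using exhaust_3[of j] by auto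
    then show "- (m + l + \<bar>fp\<bar>) * d j t \<le> d' j t"
    proof cases
      case 1
      have "d' 1 t = v s * Y 3 - m * Y 1" by (simp add: d'_def B_def Y_def s_def algebra_simps)
      moreover have "vp * (\<theta> * p 3) = m * (\<theta> * p 1)" using p(2) by (simp add: algebra_simps)
      moreover have "- m * d 1 t = m * (\<theta> * p 1) - m * Y 1" by (simp add: Y(2) algebra_simps)
      ultimately have "d' 1 t \<ge> - m * d 1 t" using v3 by linarith
      then show ?thesis using K 1 by simp
    next
      case 2
      have "d' 2 t = l * Y 1 + v s * Y 3 - m * Y 2" by (simp add: d'_def B_def Y_def s_def algebra_simps)
      moreover have "\<theta> * (m * p 2) = l * (\<theta> * p 1) + vp * (\<theta> * p 3)" unfolding p(3) by (simp add: algebra_simps)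
      moreover have "l * Y 1 \<ge> l * (\<theta> * p 1)" using Y(1)[of 1] assms(1) by (intro mult_left_mono) auto
      moreover have "- m * d 2 t = \<theta> * (m * p 2) - m * Y 2" by (simp add: Y(2) algebra_simps)
      ultimately have "d' 2 t \<ge> - m * d 2 t" using v3 by linarith
      then show ?thesis using K 2 by simp
    next
      case 3
      have "d' 3 t = l * Y 1 + l * Y 2 + (g s - l) * Y 3 - m * Y 3"
        by (simp add: d'_def B_def Y_def s_def algebra_simps)
      moreover have "l * Y 1 \<ge> l * (\<theta> * p 1)" "l * Y 2 \<ge> l * (\<theta> * p 2)"
        using Y(1)[of 1] Y(1)[of 2] assms(1) by simp_all
      moreover have "\<theta> * (m * p 3) = l * (\<theta> * p 1) + l * (\<theta> * p 2) + (fp - l) * (\<theta> * p 3)"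
        unfolding p(4) by (simp add: algebra_simps)
      moreover have "g s * Y 3 \<ge> fp * Y 3"
      proof (rule mult_right_mono)
        show "fp \<le> g s" using fp[of s] s by (simp add: s_def)
        have "0 < \<theta> * p 3" using \<theta> p(1) by simp
        then show "0 \<le> Y 3" using Y(1)[of 3] by linarith
      qed
      moreover have "(fp - l - m) * d 3 t = fp * Y 3 - l * Y 3 - m * Y 3 - (fp - l) * (\<theta> * p 3) + \<theta> * (m * p 3)"
        by (simp add: Y(2) algebra_simps)
      moreover have "(g s - l) * Y 3 = g s * Y 3 - l * Y 3" by (simp add: algebra_simps)
      ultimately have "d' 3 t \<ge> (fp - l - m) * d 3 t" by linarith
      moreover have "(fp - l - m) * d 3 t \<ge> - (m + l + \<bar>fp\<bar>) * d 3 t"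
        using pos[of 3] by (intro mult_right_mono) auto
      ultimately show ?thesis using 3 by simp
    qed
  qed
  then show "\<theta> * p i \<le> y i 0" by (simp add: d_def)
qed

lemma adjoint_solution_positive:
  fixes y :: "3 \<Rightarrow> real \<Rightarrow> real" and v g :: "real \<Rightarrow> real"
  assumes "0 < l" and "x \<le> X"
    and y1: "\<And>x. (y 1 has_real_derivative - (v x * y 3 x)) (at x)"
    and y2: "\<And>x. (y 2 has_real_derivative - (l * y 1 x + v x * y 3 x)) (at x)"
    and y3: "\<And>x. (y 3 has_real_derivative - (l * y 1 x + l * y 2 x + (g x - l) * y 3 x)) (at x)"
    and v: "\<And>x. 0 \<le> v x" and g: "\<And>x. - G \<le> g x"
    and pos: "\<And>i. 0 < y i X"
  shows "0 < y i x"
proof -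
  define B where "B j x = (if j = 1 then v x * y 3 x else if j = 2 then l * y 1 x + v x * y 3 x
      else l * y 1 x + l * y 2 x + (g x - l) * y 3 x)" for j :: 3 and x
  have yB: "\<And>x j. (y j has_real_derivative - B j x) (at x)"
    subgoal for x j using exhaust_3[of j] y1[of x] y2[of x] y3[of x] by (auto simp: B_def)
    done
  have "0 < y i (- (- x))"
  proof (rule positive_orthant_invariant[where a="-X" and b="-x" and y="\<lambda>i t. y i (- t)"
        and y'="\<lambda>j t. B j (- t)" and K="l + \<bar>G\<bar>"])
    fix j t
    show "((\<lambda>t. y j (- t)) has_real_derivative B j (- t)) (at t)"
    proof -
      have "(uminus has_real_derivative - 1) (at t)" by (auto intro!: derivative_eq_intros)
      from DERIV_chain2[OF yB this] show ?thesis by simp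
    qed
    assume p: "\<And>j. 0 < y j (- t)"
    have "(g (-t) - l) * y 3 (-t) \<ge> - (l + \<bar>G\<bar>) * y 3 (- t)"
      using p[of 3] g[of "-t"] by (intro mult_right_mono) auto
    moreover have "0 \<le> y j (- t)" for j using p[of j] by simp
    then have "0 \<le> v (-t) * y 3 (-t)" "0 \<le> l * y 1 (-t)" "0 \<le> l * y 2 (-t)" "- (l + \<bar>G\<bar>) * y j (- t) \<le> 0"
      using v[of "-t"] assms(1) by (auto intro!: mult_nonneg_nonneg mult_nonpos_nonneg)
    ultimately show "- (l + \<bar>G\<bar>) * y j (- t) \<le> B j (- t)"
      using exhaust_3[of j] unfolding B_def by auto
  qed (use assms(2) pos in auto)
  then show ?thesis by simp
qed

lemma growing_solution_positive:
  fixes y :: "3 \<Rightarrow> real \<Rightarrow> real" and v g :: "real \<Rightarrow> real"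
  assumes "0 < l"
    and y1: "\<And>x. (y 1 has_real_derivative l * y 2 x + l * y 3 x) (at x)"
    and y2: "\<And>x. (y 2 has_real_derivative l * y 3 x) (at x)"
    and y3: "\<And>x. (y 3 has_real_derivative v x * (y 1 x + y 2 x) + (g x - l) * y 3 x) (at x)"
    and v: "\<And>x. 0 \<le> v x" and g: "\<And>x. - G \<le> g x"
    and p: "\<And>i. 0 < p i" and lim: "\<And>i. ((\<lambda>x. exp (- (m * x)) * y i x) \<longlongrightarrow> p i) at_bot"
  shows "0 < y i x"
proof -
  define B where "B j x = (if j = 1 then l * y 2 x + l * y 3 x else if j = 2 then l * y 3 x
      else v x * (y 1 x + y 2 x) + (g x - l) * y 3 x)" for j :: 3 and x
  have yB: "\<And>x j. (y j has_real_derivative B j x) (at x)"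
    subgoal for x j using exhaust_3[of j] y1[of x] y2[of x] y3[of x] by (auto simp: B_def)
    done
  have "\<forall>\<^sub>F x in at_bot. \<forall>j. 0 < exp (- (m * x)) * y j x"
    using order_tendstoD(1)[OF lim p] by (intro eventually_all_finite) auto
  then obtain X0 where X0: "\<And>x j. x \<le> X0 \<Longrightarrow> 0 < exp (- (m * x)) * y j x"
    unfolding eventually_at_bot_linorder by blast
  define X where "X = min X0 x"
  have X: "X \<le> x" "\<And>j. 0 < y j X" using X0[of X] by (auto simp: X_def zero_less_mult_iff)
  show ?thesis
  proof (rule positive_orthant_invariant[where a="X" and b="x" and y=y and y'=B and K="l + \<bar>G\<bar>"])
    fix j t
    assume p: "\<And>j. 0 < y j t"
    have "(g t - l) * y 3 t \<ge> - (l + \<bar>G\<bar>) * y 3 t"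
      using p[of 3] g[of t] by (intro mult_right_mono) auto
    moreover have "0 \<le> y j t" for j using p[of j] by simp
    then have "0 \<le> v t * (y 1 t + y 2 t)" "0 \<le> l * y 3 t" "0 \<le> l * y 2 t" "- (l + \<bar>G\<bar>) * y j t \<le> 0"
      using v[of t] assms(1) by (auto intro!: mult_nonneg_nonneg add_nonneg_nonneg mult_nonpos_nonneg)
    ultimately show "- (l + \<bar>G\<bar>) * y j t \<le> B j t"
      using exhaust_3[of j] unfolding B_def by auto
  qed (use X yB in auto)
qed

lemma asymp_exp_component:
  assumes "asymp_exp W mu V F"
  shows "((\<lambda>x. exp (- (mu * of_real x)) * W x $ i) \<longlongrightarrow> V $ i) F"
  using tendsto_vec_nth[OF assms[unfolded asymp_exp_def], of i] by simp

lemma asymp_exp_component_cnj: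
  assumes "asymp_exp W mu V F"
  shows "((\<lambda>x. exp (- cnj mu * of_real x) * cnj (W x $ i)) \<longlongrightarrow> cnj (V $ i)) F"
  using tendsto_cnj[OF asymp_exp_component[OF assms, of i]] by (simp add: exp_cnj)

text \<open>The eigenvalue \<open>- m\<close> is real, and the comparison with the eigenvector applies to the real part of every
  tilted multiple of the mode. The lower bound \<open>vp / m\<close> is the ratio \<open>V1 / V3\<close>, so the first
  component at \<open>0\<close> is bounded below in modulus by \<open>|V1|\<close>, which has a limit as \<open>l \<rightarrow> 0\<close>. The last identity is the characteristic equation, from which the size of
  \<open>m\<close> for small \<open>l\<close> is read off.\<close>

lemma adjoint_mode_positive:
  assumes "0 < l" and solves: "solves (\<lambda>x. - conj_transpose (A_mat f (v x) (of_real l))) W"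
    and asymp: "asymp_exp W mu V at_top" and "Re mu < 0"
    and eig: "is_eigenpair (- conj_transpose (A_mat f vp (of_real l))) mu V"
    and vp: "0 < vp" "\<And>x. vp \<le> v x" and fp: "\<And>x. f vp \<le> f (v x)"
  obtains m where "0 < m" "mu = - of_real m" "V $ 3 \<noteq> 0" "V $ 1 = of_real (vp / m) * V $ 3"
    "of_real m * V $ 2 = of_real (l + m) * V $ 1"
    "Im (cnj (W 0 $ 1) / cnj (V $ 3)) = 0" "vp / m \<le> Re (cnj (W 0 $ 1) / cnj (V $ 3))"
    "vp * (l\<^sup>2 + 2 * l * m) + (f vp - l) * m\<^sup>2 = m ^ 3"
proof -
  have mu0: "mu \<noteq> 0" using assms(4) by auto
  define M where "M = - cnj mu"
  note ev = adjoint_eigenpair_components[OF eig mu0, folded M_def]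
  have c3: "cnj (V $ 3) \<noteq> 0" using ev(4) by simp
  note ch = adjoint_characteristic[OF ev(1-3) c3]
  have ReM: "0 < Re M" using assms(4) by (simp add: M_def)
  have "Im M = 0"
    by (rule characteristic_root_real[OF vp(1) assms(1) ReM ch])
  define m where "m = Re M"
  have Mm: "M = of_real m" using \<open>Im M = 0\<close> by (simp add: m_def complex_eq_iff)
  have m0: "0 < m" using ReM by (simp add: m_def)
  have mu: "mu = - of_real m" using arg_cong[OF Mm, of "\<lambda>t. - cnj t"] unfolding M_def by simp
  have "complex_of_real (vp * (l\<^sup>2 + 2 * l * m) + (f vp - l) * m\<^sup>2) = complex_of_real (m ^ 3)"
    using ch unfolding Mm by simp
  then have ch': "vp * (l\<^sup>2 + 2 * l * m) + (f vp - l) * m\<^sup>2 = m ^ 3"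
    unfolding of_real_eq_iff .
  define p :: "3 \<Rightarrow> real" where
    "p i = (if i = 1 then vp / m else if i = 2 then (l * (vp / m) + vp) / m else 1)" for i
  have p1: "cnj (V $ 1) = of_real (vp / m) * cnj (V $ 3)"
    using ev(1) m0 unfolding Mm by (simp add: field_simps)
  have p2: "cnj (V $ 2) = of_real ((l * (vp / m) + vp) / m) * cnj (V $ 3)"
    using ev(2) m0 unfolding Mm p1 by (simp add: field_simps)
  have pV: "cnj (V $ i) = of_real (p i) * cnj (V $ 3)" for i
    using exhaust_3[of i] p1 p2 by (auto simp: p_def)
  have pp: "0 < p i" for i using m0 vp(1) assms(1) by (auto simp: p_def intro!: divide_pos_pos add_pos_pos)
  have p3: "m * p 3 = l * p 1 + l * p 2 + (f vp - l) * p 3"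
    using ch' m0 by (simp add: p_def field_simps power2_eq_square power3_eq_cube)
  note w = adjoint_components[OF solves]
  have "p 1 \<le> Re ((1 + \<tau> * \<i>) * (cnj (W 0 $ 1) / cnj (V $ 3)))" for \<tau> :: real
  proof -
    define c where "c = (1 + \<tau> * \<i>) / cnj (V $ 3)"
    define y where "y i x = Re (c * cnj (W x $ i))" for i x
    note d = has_real_derivative_Re_cmult[of _ _ _ c]
    have y1: "(y 1 has_real_derivative - (v x * y 3 x)) (at x)" for x
      unfolding y_def using d[OF w(1)[of x]] by (simp add: algebra_simps)
    have y2: "(y 2 has_real_derivative - (l * y 1 x + v x * y 3 x)) (at x)" for x
      unfolding y_def using d[OF w(2)[of x]] by (simp add: algebra_simps)
    have y3: "(y 3 has_real_derivative - (l * y 1 x + l * y 2 x + (f (v x) - l) * y 3 x)) (at x)" for x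
      unfolding y_def using d[OF w(3)[of x]] by (simp add: algebra_simps)
    have lim: "((\<lambda>x. exp (m * x) * y i x) \<longlongrightarrow> p i) at_top" for i
    proof -
      have "((\<lambda>x. Re (c * (exp (- cnj mu * of_real x) * cnj (W x $ i)))) \<longlongrightarrow> Re (c * cnj (V $ i))) at_top"
        by (intro tendsto_intros asymp_exp_component_cnj asymp)
      moreover have "Re (c * (exp (- cnj mu * of_real x) * cnj (W x $ i))) = exp (m * x) * y i x" for x
      proof -
        have "exp (- cnj mu * of_real x) = of_real (exp (m * x))" by (simp add: mu flip: exp_of_real)
        then show ?thesis by (simp add: y_def algebra_simps)
      qed
      moreover have "c * cnj (V $ i) = of_real (p i) * (1 + \<tau> * \<i>)" unfolding pV[of i] c_def using c3 by simp
      then have "Re (c * cnj (V $ i)) = p i" by simp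
      ultimately show ?thesis by simp
    qed
    have e1: "m * p 1 = vp * p 3" and e2: "m * p 2 = l * p 1 + vp * p 3"
      using m0 by (simp_all add: p_def)
    have "p 1 \<le> y 1 0"
      by (rule adjoint_solution_ge_eigenvector[OF assms(1) m0 vp(1) y1 y2 y3 vp(2) fp pp e1 e2 p3 lim])
    then show ?thesis by (simp add: y_def c_def)
  qed
  note tilt = real_if_tilted_Re_ge[OF this]
  show thesis
  proof (rule that[OF m0 mu ev(4)])
    show V1: "V $ 1 = of_real (vp / m) * V $ 3"
      using arg_cong[OF p1, of cnj] by simp
    show "of_real m * V $ 2 = of_real (l + m) * V $ 1"
      unfolding V1 using arg_cong[OF p2, of cnj] m0 by (simp add: field_simps)
  qed (use tilt ch' in \<open>auto simp: p_def\<close>)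
qed

text \<open>At \<open>-\<infinity>\<close> the eigenvector of the unstable eigenvalue lies in the positive orthant, and the growing mode
  stays there.\<close>

lemma growing_mode_positive:
  assumes "0 < l" and solves: "solves (\<lambda>x. A_mat f (v x) (of_real l)) W"
    and asymp: "asymp_exp W mu V at_bot" and "Re mu > 0"
    and eig: "is_eigenpair (A_mat f 1 (of_real l)) mu V"
    and v: "\<And>x. 0 \<le> v x" and f: "\<And>x. - G \<le> f (v x)"
  shows "Im (W x $ i / V $ 3) = 0" "0 < Re (W x $ i / V $ 3)"
proof -
  have mu0: "mu \<noteq> 0" using assms(4) by auto
  note ev = growing_eigenpair_components[OF eig mu0]
  note ch = growing_characteristic[OF ev]
  have "Im mu = 0"
    by (rule characteristic_root_real[OF zero_less_one assms(1,4) ch])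
  define m where "m = Re mu"
  have mu: "mu = of_real m" using \<open>Im mu = 0\<close> by (simp add: m_def complex_eq_iff)
  have m0: "0 < m" using assms(4) by (simp add: m_def)
  define p :: "3 \<Rightarrow> real" where
    "p i = (if i = 1 then (l * (l / m) + l) / m else if i = 2 then l / m else 1)" for i
  have p2: "V $ 2 = of_real (l / m) * V $ 3"
    using ev(2) m0 unfolding mu by (simp add: field_simps)
  have p1: "V $ 1 = of_real ((l * (l / m) + l) / m) * V $ 3"
    using ev(1) m0 unfolding mu p2 by (simp add: field_simps)
  have pV: "V $ i = of_real (p i) * V $ 3" for i
    using exhaust_3[of i] p1 p2 by (auto simp: p_def)
  have pp: "0 < p i" for i using m0 assms(1) by (auto simp: p_def intro!: divide_pos_pos add_pos_pos)
  note w = growing_components[OF solves]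
  have pos: "0 < Re ((1 + \<tau> * \<i>) * (W x $ i / V $ 3))" for \<tau> :: real and x i
  proof -
    define c where "c = (1 + \<tau> * \<i>) / V $ 3"
    define y where "y i x = Re (c * W x $ i)" for i x
    note d = has_real_derivative_Re_cmult[of _ _ _ c]
    have y1: "(y 1 has_real_derivative l * y 2 x + l * y 3 x) (at x)" for x
      unfolding y_def using d[OF w(1)[of x]] by (simp add: algebra_simps)
    have y2: "(y 2 has_real_derivative l * y 3 x) (at x)" for x
      unfolding y_def using d[OF w(2)[of x]] by (simp add: algebra_simps)
    have y3: "(y 3 has_real_derivative v x * (y 1 x + y 2 x) + (f (v x) - l) * y 3 x) (at x)" for x
      unfolding y_def using d[OF w(3)[of x]] by (simp add: algebra_simps)
    have lim: "((\<lambda>x. exp (- (m * x)) * y i x) \<longlongrightarrow> p i) at_bot" for i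
    proof -
      have "((\<lambda>x. Re (c * (exp (- (mu * of_real x)) * W x $ i))) \<longlongrightarrow> Re (c * V $ i)) at_bot"
        by (intro tendsto_intros asymp_exp_component asymp)
      moreover have "Re (c * (exp (- (mu * of_real x)) * W x $ i)) = exp (- (m * x)) * y i x" for x
      proof -
        have "exp (- (mu * of_real x)) = of_real (exp (- (m * x)))" by (simp add: mu flip: exp_of_real)
        then show ?thesis by (simp add: y_def algebra_simps)
      qed
      moreover have "c * V $ i = of_real (p i) * (1 + \<tau> * \<i>)" unfolding pV[of i] c_def using ev(4) by simp
      then have "Re (c * V $ i) = p i" by simp
      ultimately show ?thesis by simp
    qed
    have "0 < y i x"
      by (rule growing_solution_positive[OF assms(1) y1 y2 y3 v f pp lim])
    then show ?thesis by (simp add: y_def c_def)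
  qed
  show "Im (W x $ i / V $ 3) = 0"
    by (rule real_if_tilted_Re_ge(1)[of 0]) (use pos less_imp_le in blast)
  show "0 < Re (W x $ i / V $ 3)" using pos[of 0] by simp
qed

text \<open>For the limiting profile the coefficient \<open>v\<close> vanishes at \<open>+\<infinity>\<close> and the limit \<open>(0, 1, l / (1 + l))\<close> of the
  negated mode lies on the boundary of the orthant. Its first component is positive near \<open>+\<infinity>\<close> all the
  same, because it decreases to its limit zero.\<close>

lemma limiting_adjoint_mode_positive:
  assumes "0 < l" and solves: "solves (\<lambda>x. - conj_transpose (A_mat f_coef0 (v x) (of_real l))) W"
    and lim: "(W \<longlongrightarrow> vector [0, -1, of_real l / (-1 - of_real l)]) at_top"
    and v: "\<And>x. (v has_real_derivative v x * (v x - 1)) (at x)" "\<And>x. 0 < v x"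
      "(v \<longlongrightarrow> 0) at_top"
  shows "Im (W 0 $ 1) = 0" "l / (1 + l) * v 0 \<le> - Re (W 0 $ 1)"
proof -
  note w = adjoint_components[OF solves]
  have lm: "((\<lambda>x. cnj (W x $ i)) \<longlongrightarrow> cnj (vector [0, -1, of_real l / (-1 - of_real l)] $ i)) at_top" for i
    by (intro tendsto_cnj tendsto_vec_nth lim)
  define q where "q = l / (1 + l)"
  have q0: "0 < q" using assms(1) by (simp add: q_def)
  have "of_real l / (-1 - of_real l) = complex_of_real (l / (- 1 - l))" by simp
  also have "l / (- 1 - l) = - q" using assms(1) by (simp add: q_def field_simps)
  finally have l3: "of_real l / (-1 - of_real l) = - complex_of_real q" by simp
  have tilted: "q * v 0 \<le> Re ((1 + \<tau> * \<i>) * (- cnj (W 0 $ 1)))" for \<tau> :: real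
  proof -
    define c where "c = - (1 + \<tau> * \<i>)"
    define y where "y i x = Re (c * cnj (W x $ i))" for i x
    note d = has_real_derivative_Re_cmult[of _ _ _ c]
    have y1: "(y 1 has_real_derivative - (v x * y 3 x)) (at x)" for x
      unfolding y_def using d[OF w(1)[of x]] by (simp add: algebra_simps)
    have y2: "(y 2 has_real_derivative - (l * y 1 x + v x * y 3 x)) (at x)" for x
      unfolding y_def using d[OF w(2)[of x]] by (simp add: algebra_simps)
    have y3: "(y 3 has_real_derivative - (l * y 1 x + l * y 2 x + (f_coef0 (v x) - l) * y 3 x)) (at x)" for x
      unfolding y_def using d[OF w(3)[of x]] by (simp add: algebra_simps)
    have lim1: "(y 1 \<longlongrightarrow> 0) at_top" unfolding y_def
      using tendsto_Re[OF tendsto_mult_left[OF lm[of 1], of c]] by simp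
    have lim2: "(y 2 \<longlongrightarrow> 1) at_top" unfolding y_def
      using tendsto_Re[OF tendsto_mult_left[OF lm[of 2], of c]] by (simp add: c_def)
    have lim3: "(y 3 \<longlongrightarrow> q) at_top" unfolding y_def
      using tendsto_Re[OF tendsto_mult_left[OF lm[of 3], of c]] by (simp add: l3 c_def)
    have "\<forall>\<^sub>F x in at_top. 0 < y 2 x \<and> 0 < y 3 x"
      by (intro eventually_conj order_tendstoD(1)[OF lim2] order_tendstoD(1)[OF lim3 q0]) simp
    then obtain X where X: "\<And>x. x \<ge> X \<Longrightarrow> 0 < y 2 x \<and> 0 < y 3 x"
      unfolding eventually_at_top_linorder by blast
    have X1: "0 < y 1 x" if x: "x \<ge> X" for x
    proof -
      have vy: "0 < v t * y 3 t" if "t \<ge> X" for t using X[OF that] v(2)[of t] by simp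
      have "0 \<le> y 1 (x + 1)"
      proof (rule nonincreasing_ge_limit[where a="x + 1" and x="x + 1", OF y1 _ lim1 order_refl])
        fix t assume "x + 1 \<le> t"
        then show "- (v t * y 3 t) \<le> 0" using vy[of t] x by simp
      qed
      moreover have "y 1 (x + 1) < y 1 x"
      proof (rule DERIV_neg_imp_decreasing[where f="y 1" and a=x])
        fix t assume "x \<le> t"
        then show "\<exists>d. (y 1 has_real_derivative d) (at t) \<and> d < 0" using y1[of t] vy[of t] x by force
      qed simp
      ultimately show ?thesis by simp
    qed
    have pos: "0 < y i x" for i x
    proof (cases "x \<le> X")
      case True
      have Xp: "0 < y i X" for i using X[of X] X1[of X] exhaust_3[of i] by auto
      show ?thesis
        by (rule adjoint_solution_positive[OF assms(1) True y1 y2 y3, where G=1])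
          (use v(2) Xp in \<open>auto simp: f_coef0_def intro: less_imp_le\<close>)
    next
      case False
      then show ?thesis using X[of x] X1[of x] exhaust_3[of i] by auto
    qed
    have nn: "0 \<le> l * y 1 x" "0 \<le> v x * y 3 x" for x
      using pos[of 1 x] pos[of 3 x] v(2)[of x] assms(1) by simp_all
    have g2: "1 \<le> y 2 x" for x
    proof (rule nonincreasing_ge_limit[where a=x and x=x, OF y2 _ lim2 order_refl])
      fix t show "- (l * y 1 t + v t * y 3 t) \<le> 0" using nn[of t] by linarith
    qed
    \<comment> \<open>As \<open>y 2 \<ge> 1\<close>, the difference \<open>y 3 - q\<close> grows at rate at most \<open>1 + l\<close>; it tends to zero, so it cannot be negative.\<close>
    have g3: "q \<le> y 3 x" for x
    proof -
      define h where "h x = exp (- (1 + l) * x) * (y 3 x - q)" for x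
      define h' where "h' x = - (l * y 1 x + l * y 2 x + (f_coef0 (v x) - l) * y 3 x) - (1 + l) * (y 3 x - q)" for x
      have e: "((\<lambda>x. exp (- (1 + l) * x)) has_real_derivative exp (- (1 + l) * x) * - (1 + l)) (at x)" for x
        by (auto intro!: derivative_eq_intros)
      have "(h has_real_derivative exp (- (1 + l) * x) * h' x) (at x)" for x
        unfolding h_def[abs_def] h'_def
        by (rule DERIV_cong[OF DERIV_mult[OF e DERIV_diff[OF y3 DERIV_const]]]) (simp add: algebra_simps)
      moreover have "exp (- (1 + l) * x) * h' x \<le> 0" for x
      proof -
        have "(1 + l) * q = l" using assms(1) by (simp add: q_def)
        moreover have "0 \<le> l * (y 2 x - 1)" using assms(1) g2[of x] by simp
        moreover have "h' x = - (l * y 1 x) - l * (y 2 x - 1) - 2 * (v x * y 3 x) + ((1 + l) * q - l)"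
          by (simp add: h'_def f_coef0_def algebra_simps)
        ultimately have "h' x \<le> 0" using nn[of x] by linarith
        then show ?thesis by (simp add: mult_nonneg_nonpos)
      qed
      moreover have "(h \<longlongrightarrow> 0 * (q - q)) at_top" unfolding h_def
      proof (intro tendsto_mult tendsto_diff lim3 tendsto_const)
        show "((\<lambda>x. exp (- (1 + l) * x)) \<longlongrightarrow> 0) at_top"
          using assms(1)
          by (intro filterlim_compose[OF exp_at_bot]
              filterlim_tendsto_neg_mult_at_bot[OF tendsto_const _ filterlim_ident]) simp
      qed
      ultimately have "0 * (q - q) \<le> h x" by (rule nonincreasing_ge_limit[OF _ _ _ order_refl])
      then show ?thesis by (simp add: h_def zero_le_mult_iff)
    qed
    \<comment> \<open>Since \<open>v' \<ge> - v\<close> and \<open>y 3 \<ge> q\<close>, the function \<open>y 1 - q v\<close> does not increase; its limit is zero.\<close>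
    have "0 - q * 0 \<le> y 1 0 - q * v 0"
    proof (rule nonincreasing_ge_limit[where a=0 and g="\<lambda>x. y 1 x - q * v x"])
      fix x :: real
      show "((\<lambda>x. y 1 x - q * v x) has_real_derivative - (v x * y 3 x) - q * (v x * (v x - 1))) (at x)"
        by (intro DERIV_diff DERIV_cmult y1 v(1))
      have "v x * q \<le> v x * y 3 x" using g3[of x] v(2)[of x] by (intro mult_left_mono) auto
      moreover have "0 \<le> q * (v x * v x)" using q0 by simp
      ultimately show "- (v x * y 3 x) - q * (v x * (v x - 1)) \<le> 0" by (simp add: algebra_simps)
    next
      show "((\<lambda>x. y 1 x - q * v x) \<longlongrightarrow> 0 - q * 0) at_top" by (intro tendsto_intros lim1 v(3))
    qed simp
    then show ?thesis by (simp add: y_def c_def)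
  qed
  note tilt = real_if_tilted_Re_ge[OF tilted]
  show "Im (W 0 $ 1) = 0" "l / (1 + l) * v 0 \<le> - Re (W 0 $ 1)" using tilt by (auto simp: q_def)
qed

section \<open>Absence of zeros at high frequency\<close>

text \<open>Multiplying an energy identity by this factor before taking real parts makes its term \<open>z |w1|\<^sup>2\<close> coercive on
  the whole half-plane, since it becomes \<open>(Re z + |Im z|) |w1|\<^sup>2\<close>, and leaves the coefficient of the other square at \<open>1\<close>.\<close>

definition tilt :: "complex \<Rightarrow> complex" where
  "tilt z = Complex 1 (- sgn (Im z))"

lemma Re_tilt [simp]: "Re (tilt z) = 1"
  by (simp add: tilt_def)

lemma Re_tilt_mult_ge: "0 \<le> Re z \<Longrightarrow> cmod z \<le> Re (tilt z * z)"
proof -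
  assume "0 \<le> Re z"
  moreover have "\<bar>Im z\<bar> = sgn (Im z) * Im z" by (simp add: abs_sgn mult.commute)
  ultimately show ?thesis using cmod_le[of z] by (simp add: tilt_def)
qed

lemma cmod_tilt_le: "cmod (tilt z) \<le> 2"
  using cmod_le[of "tilt z"] by (cases "Im z = 0") (simp_all add: tilt_def)

lemma Re_tilt_mult_cnj_bound: "\<bar>Re (tilt z * (p * cnj q))\<bar> \<le> 2 * (cmod p * cmod q)"
proof -
  have "\<bar>Re (tilt z * (p * cnj q))\<bar> \<le> cmod (tilt z) * (cmod p * cmod q)"
    using abs_Re_le_cmod[of "tilt z * (p * cnj q)"] by (simp add: norm_mult)
  also have "\<dots> \<le> 2 * (cmod p * cmod q)" by (intro mult_right_mono cmod_tilt_le) simp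
  finally show ?thesis .
qed

lemma Re_mult_cnj_bound: "\<bar>Re (p * cnj q)\<bar> \<le> cmod p * cmod q"
  using abs_Re_le_cmod[of "p * cnj q"] by (simp add: norm_mult)

lemma Re_mult_cnj_same: "Re (c * (p * cnj p)) = Re c * (cmod p)\<^sup>2"
proof -
  have "p * cnj p = of_real ((cmod p)\<^sup>2)" by (rule complex_norm_square[symmetric])
  then show ?thesis by (simp only: times_complex.sel Re_complex_of_real Im_complex_of_real mult_zero_right diff_0_right)
qed

lemma nondecreasing_ge_limit_at_bot:
  fixes g g' :: "real \<Rightarrow> real"
  assumes "\<And>x. x \<le> a \<Longrightarrow> (g has_real_derivative g' x) (at x)" "\<And>x. x \<le> a \<Longrightarrow> 0 \<le> g' x"
    and "(g \<longlongrightarrow> l) at_bot" and "x \<le> a"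
  shows "l \<le> g x"
proof (rule tendsto_upperbound[OF assms(3)])
  show "\<forall>\<^sub>F y in at_bot. g y \<le> g x"
    using eventually_le_at_bot[of x]
  proof eventually_elim
    case (elim y)
    then show ?case
      using assms(1,2,4) by (intro DERIV_nonneg_imp_nondecreasing[OF elim]) (meson order_trans)
  qed
qed simp

text \<open>The quadratic form that bounds the decay of the energy of the next lemma, with \<open>P\<close>, \<open>Q\<close>, \<open>R\<close> the moduli
  of \<open>w1\<close>, \<open>w3\<close>, \<open>\<epsilon>\<close>. The term \<open>B k R\<^sup>2\<close> absorbs \<open>Q R\<close>, which fixes \<open>B\<close>; every product with \<open>P\<close> is absorbed
  by \<open>L P\<^sup>2\<close>, and the products carrying \<open>1 / L\<close> are small.\<close>

lemma adjoint_energy_coercive: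
  fixes P Q R :: real
  assumes "0 \<le> P" "0 \<le> Q" "0 \<le> R" and c: "0 < c" "c \<le> k" "k \<le> K" and v: "0 \<le> v" "v \<le> 1"
    and B: "B = 8 / c" and L: "16 * K \<le> L" "8 * B * K \<le> L" "5 + (B * K)\<^sup>2 \<le> L"
  shows "v * (P\<^sup>2 + Q\<^sup>2 / 4 + R\<^sup>2) \<le> L * P\<^sup>2 + v * Q\<^sup>2 - 2 * v * (Q * P) - 2 * v * ((R + K * Q / L) * Q)
      + B * (v * (k * R\<^sup>2 - 2 * ((k * P + K * Q / L) * R)))"
proof -
  have L0: "0 < L" using L(3) by (smt (verit) zero_le_power2)
  have B0: "0 < B" using B c by simp
  have K0: "0 < K" using c by simp
  have a: "2 * (Q * P) \<le> Q\<^sup>2 / 4 + 4 * P\<^sup>2"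
    using zero_le_power2[of "Q / 2 - 2 * P"] by (simp add: power2_eq_square algebra_simps)
  have b: "2 * (R * Q) \<le> Q\<^sup>2 / 4 + 4 * R\<^sup>2"
    using zero_le_power2[of "Q / 2 - 2 * R"] by (simp add: power2_eq_square algebra_simps)
  have "K / L \<le> 1 / 16" using L(1) L0 by (simp add: field_simps)
  then have "K / L * (2 * Q\<^sup>2) \<le> 1 / 16 * (2 * Q\<^sup>2)" by (intro mult_right_mono) auto
  then have cc: "2 * (K * Q / L * Q) \<le> Q\<^sup>2 / 8" by (simp add: power2_eq_square algebra_simps)
  have "B * K / L \<le> 1 / 8" using L(2) L0 by (simp add: field_simps)
  then have "B * K / L * (2 * (Q * R)) \<le> 1 / 8 * (2 * (Q * R))" using assms by (intro mult_right_mono) auto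
  moreover have "2 * (Q * R) \<le> Q\<^sup>2 + R\<^sup>2"
    using zero_le_power2[of "Q - R"] by (simp add: power2_eq_square algebra_simps)
  ultimately have d: "2 * B * (K * Q / L * R) \<le> Q\<^sup>2 / 8 + R\<^sup>2 / 8" by (simp add: algebra_simps)
  have "2 * B * (k * P * R) \<le> 2 * B * (K * P * R)" using assms B0 by (intro mult_left_mono mult_right_mono) auto
  also have "\<dots> \<le> R\<^sup>2 + (B * K)\<^sup>2 * P\<^sup>2"
    using zero_le_power2[of "R - B * K * P"] by (simp add: power2_eq_square algebra_simps)
  finally have e: "2 * B * (k * P * R) \<le> R\<^sup>2 + (B * K)\<^sup>2 * P\<^sup>2" .
  have "B * c \<le> B * k" using B0 c(2) by (intro mult_left_mono) auto
  then have "8 \<le> B * k" using B c(1) by simp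
  then have f: "8 * R\<^sup>2 \<le> B * k * R\<^sup>2" by (intro mult_right_mono) auto
  have g: "(5 + (B * K)\<^sup>2) * P\<^sup>2 \<le> L * P\<^sup>2" using L(3) by (intro mult_right_mono) auto
  have "P\<^sup>2 + Q\<^sup>2 / 4 + R\<^sup>2 \<le> L * P\<^sup>2 + Q\<^sup>2 - 2 * (Q * P) - 2 * (R * Q) - 2 * (K * Q / L * Q)
      + B * k * R\<^sup>2 - 2 * B * (k * P * R) - 2 * B * (K * Q / L * R)"
    using a b cc d e f g zero_le_power2[of R] unfolding distrib_right by linarith
  then have "v * (P\<^sup>2 + Q\<^sup>2 / 4 + R\<^sup>2) \<le> v * (L * P\<^sup>2 + Q\<^sup>2 - 2 * (Q * P) - 2 * (R * Q) - 2 * (K * Q / L * Q)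
      + B * k * R\<^sup>2 - 2 * B * (k * P * R) - 2 * B * (K * Q / L * R))" using v by (intro mult_left_mono)
  also have "\<dots> = v * (L * P\<^sup>2) + v * Q\<^sup>2 - 2 * v * (Q * P) - 2 * v * ((R + K * Q / L) * Q)
      + B * (v * (k * R\<^sup>2 - 2 * ((k * P + K * Q / L) * R)))" by (simp add: algebra_simps)
  also have "v * (L * P\<^sup>2) \<le> 1 * (L * P\<^sup>2)" using v L0 by (intro mult_right_mono) auto
  finally show ?thesis by simp
qed

text \<open>In the variables \<open>w1\<close>, \<open>w2\<close> and \<open>\<epsilon> = w2 - w3 - k w3 / z\<close> the adjoint system splits, to leading order in
  \<open>1 / z\<close>, into a hyperbolic pair, for which \<open>Re (tilt z * w2 * cnj w1)\<close> is monotone, and a scalar mode \<open>\<epsilon>\<close>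
  damped towards \<open>-\<infinity>\<close> by \<open>Re z + k\<close>. Subtracting a multiple of \<open>v |\<epsilon>|\<^sup>2\<close> gives a strict Lyapunov
  function; the weight \<open>v\<close> makes it vanish at \<open>+\<infinity>\<close> even when \<open>\<epsilon>\<close> does not.\<close>

lemma adjoint_solution_zero_if_high_frequency:
  fixes w1 w2 w3 :: "real \<Rightarrow> complex" and v k kd H :: "real \<Rightarrow> real"
  assumes w1: "\<And>x. (w1 has_vector_derivative - (of_real (v x) * w3 x)) (at x)"
    and w2: "\<And>x. (w2 has_vector_derivative - (z * w1 x + of_real (v x) * w3 x)) (at x)"
    and w3: "\<And>x. (w3 has_vector_derivative
        - (z * w1 x + z * w2 x + (of_real (v x - k x) - z) * w3 x)) (at x)"
    and v: "\<And>x. 0 < v x" "\<And>x. v x \<le> 1" "\<And>x. (v has_real_derivative v x * H x) (at x)"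
    and H: "\<And>x. - k x \<le> H x"
    and c: "0 < c" "\<And>x. 0 \<le> x \<Longrightarrow> c \<le> k x" "\<And>x. k x \<le> K"
    and k: "\<And>x. (k has_real_derivative kd x) (at x)" "\<And>x. \<bar>v x * k x - kd x\<bar> \<le> K"
    and z: "0 \<le> Re z" and B: "B = 8 / c"
    and L: "16 * K \<le> cmod z" "8 * B * K \<le> cmod z" "5 + (B * K)\<^sup>2 \<le> cmod z"
    and lim: "(w1 \<longlongrightarrow> 0) at_top" "(w2 \<longlongrightarrow> l2) at_top" "(w3 \<longlongrightarrow> l3) at_top" "(v \<longlongrightarrow> l0) at_top"
      "l0 = 0 \<or> l2 = 0 \<and> l3 = 0"
    and zero: "w1 0 = 0" and "0 < x"
  shows "w1 x = 0" "w2 x = 0" "w3 x = 0"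
proof -
  define L where "L = cmod z"
  have L0: "0 < L" using L(3) unfolding L_def by (smt (verit) zero_le_power2)
  have z0: "z \<noteq> 0" using L0 by (auto simp: L_def)
  have K0: "0 < K" using c(1) c(2)[of 0] c(3)[of 0] by simp
  have B0: "0 < B" using B c(1) by simp
  have k0: "0 < k x" if "0 \<le> x" for x using c(2)[OF that] c(1) by simp
  \<comment> \<open>The difference \<open>w2 - w3\<close> follows \<open>k w3 / z\<close> up to the small remainder \<open>e\<close>, the \<open>\<epsilon>\<close> above.\<close>
  define e where "e x = w2 x - w3 x - (k x *\<^sub>R w3 x) / z" for x
  have ed: "(e has_vector_derivative (z + k x) * e x + k x * w1 x + (v x * k x - kd x) * (w3 x / z)) (at x)" for x
  proof -
    have s: "((\<lambda>x. (k x *\<^sub>R w3 x) / z) has_vector_derivative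
      (k x *\<^sub>R - (z * w1 x + z * w2 x + (of_real (v x - k x) - z) * w3 x) + kd x *\<^sub>R w3 x) / z) (at x)"
      by (intro bounded_linear.has_vector_derivative[OF bounded_linear_divide]
          has_vector_derivative_scaleR k w3)
    show ?thesis unfolding e_def[abs_def]
      by (rule has_vector_derivative_eq_rhs[OF has_vector_derivative_diff[OF has_vector_derivative_diff[OF w2 w3] s]])
        (use z0 in \<open>simp add: scaleR_conv_of_real field_simps\<close>)
  qed
  define G where "G x = Re (tilt z * (w2 x * cnj (w1 x))) - B * (v x * (cmod (e x))\<^sup>2)" for x
  define g1 where "g1 x = Re (tilt z * (- (z * w1 x + of_real (v x) * w3 x) * cnj (w1 x)
      + w2 x * cnj (- (of_real (v x) * w3 x))))" for x
  define g2 where "g2 x = v x * H x * (cmod (e x))\<^sup>2 + 2 * Re (((z + k x) * e x + k x * w1 x + (v x * k x - kd x) * (w3 x / z)) * cnj (e x)) * v x" for x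
  have Gd: "(G has_real_derivative g1 x - B * g2 x) (at x)" for x
    unfolding G_def[abs_def] g1_def g2_def
    by (intro DERIV_diff DERIV_cmult DERIV_mult v(3) has_real_derivative_cmod_sq[OF ed]
        has_real_derivative_Re_mult_cnj[OF w2 w1])
  have coercive: "v x * ((cmod (w1 x))\<^sup>2 + (cmod (w3 x))\<^sup>2 / 4 + (cmod (e x))\<^sup>2) \<le> - (g1 x - B * g2 x)"
    if x: "0 \<le> x" for x
  proof -
    define P Q R where "P = cmod (w1 x)" and "Q = cmod (w3 x)" and "R = cmod (e x)"
    have pqr: "0 \<le> P" "0 \<le> Q" "0 \<le> R" by (simp_all add: P_def Q_def R_def)
    have kp: "0 \<le> k x" using k0[OF x] by simp
    have neg2: "v x * - (2 * T) = - (2 * v x * T)" for T :: real by simp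
    have w2e: "w2 x = w3 x + (e x + k x * (w3 x / z))" by (simp add: e_def scaleR_conv_of_real)
    have "g1 x = - (Re (tilt z * z * (w1 x * cnj (w1 x))) + v x * Re (tilt z * (w3 x * cnj (w1 x)))
        + v x * Re (tilt z * (w3 x * cnj (w3 x))) + v x * Re (tilt z * ((e x + k x * (w3 x / z)) * cnj (w3 x))))"
    proof -
      have "Re (t * (- (z * a + of_real r * b) * cnj a + (b + s) * cnj (- (of_real r * b)))) =
          - (Re (t * z * (a * cnj a)) + r * Re (t * (b * cnj a)) + r * Re (t * (b * cnj b)) + r * Re (t * (s * cnj b)))"
        for t a b s and r :: real by (simp add: algebra_simps)
      then show ?thesis unfolding g1_def w2e by blast
    qed
    moreover have "L * P\<^sup>2 \<le> Re (tilt z * z * (w1 x * cnj (w1 x)))"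
      unfolding Re_mult_cnj_same P_def L_def using Re_tilt_mult_ge[OF z] by (intro mult_right_mono) auto
    moreover have "v x * - (2 * (Q * P)) \<le> v x * Re (tilt z * (w3 x * cnj (w1 x)))"
      using Re_tilt_mult_cnj_bound[of z "w3 x" "w1 x"] v(1)[of x] unfolding P_def Q_def
      by (intro mult_left_mono) auto
    then have "- (2 * v x * (Q * P)) \<le> v x * Re (tilt z * (w3 x * cnj (w1 x)))" unfolding neg2 .
    moreover have "v x * Re (tilt z * (w3 x * cnj (w3 x))) = v x * Q\<^sup>2" unfolding Re_mult_cnj_same Q_def by simp
    moreover have "v x * - (2 * ((R + K * Q / L) * Q)) \<le> v x * Re (tilt z * ((e x + k x * (w3 x / z)) * cnj (w3 x)))"
    proof (rule mult_left_mono)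
      have "cmod (e x + k x * (w3 x / z)) \<le> R + k x * Q / L"
        unfolding R_def Q_def L_def using norm_triangle_ineq[of "e x" "k x * (w3 x / z)"] kp
        by (simp add: norm_mult norm_divide)
      also have "\<dots> \<le> R + K * Q / L" using c(3)[of x] pqr L0 by (intro add_left_mono divide_right_mono mult_right_mono) auto
      finally have "cmod (e x + k x * (w3 x / z)) * Q \<le> (R + K * Q / L) * Q" using pqr by (intro mult_right_mono)
      then show "- (2 * ((R + K * Q / L) * Q)) \<le> Re (tilt z * ((e x + k x * (w3 x / z)) * cnj (w3 x)))"
        using Re_tilt_mult_cnj_bound[of z "e x + k x * (w3 x / z)" "w3 x"] unfolding Q_def by linarith
    qed (use v(1)[of x] in simp)
    then have "- (2 * v x * ((R + K * Q / L) * Q)) \<le> v x * Re (tilt z * ((e x + k x * (w3 x / z)) * cnj (w3 x)))"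
      unfolding neg2 .
    ultimately have A1: "L * P\<^sup>2 + v x * Q\<^sup>2 - 2 * v x * (Q * P) - 2 * v x * ((R + K * Q / L) * Q) \<le> - g1 x"
      by linarith
    define T where "T = Re (((z + k x) * e x + k x * w1 x + (v x * k x - kd x) * (w3 x / z)) * cnj (e x))"
    have "T =
        Re ((z + k x) * (e x * cnj (e x))) + Re ((k x * w1 x + (v x * k x - kd x) * (w3 x / z)) * cnj (e x))"
      unfolding T_def by (simp add: algebra_simps)
    moreover have "Re ((z + k x) * (e x * cnj (e x))) = (Re z + k x) * R\<^sup>2"
      unfolding Re_mult_cnj_same R_def by simp
    moreover have "- ((k x * P + K * Q / L) * R) \<le> Re ((k x * w1 x + (v x * k x - kd x) * (w3 x / z)) * cnj (e x))"
    proof -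
      have "cmod (k x * w1 x + (v x * k x - kd x) * (w3 x / z)) \<le> cmod (k x * w1 x) + cmod ((of_real (v x * k x - kd x)) * (w3 x / z))"
        using norm_triangle_ineq by simp
      also have "\<dots> = k x * P + \<bar>v x * k x - kd x\<bar> * Q / L"
        unfolding norm_mult norm_divide norm_of_real P_def Q_def L_def using kp by simp
      also have "\<dots> \<le> k x * P + K * Q / L" using k(2)[of x] pqr L0
        by (intro add_left_mono divide_right_mono mult_right_mono) auto
      finally have "cmod (k x * w1 x + (v x * k x - kd x) * (w3 x / z)) * R \<le> (k x * P + K * Q / L) * R"
        using pqr by (intro mult_right_mono)
      then show ?thesis
        using Re_mult_cnj_bound[of "k x * w1 x + (v x * k x - kd x) * (w3 x / z)" "e x"] unfolding R_def by linarith
    qed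
    ultimately have "(Re z + k x) * R\<^sup>2 - (k x * P + K * Q / L) * R \<le>
        T" by linarith
    moreover have "0 \<le> Re z * R\<^sup>2" using z by simp
    ultimately have "2 * (k x * R\<^sup>2 - (k x * P + K * Q / L) * R) \<le>
        2 * T"
    proof -
      have "(a + b) * r - X \<le> t \<Longrightarrow> 0 \<le> a * r \<Longrightarrow> 2 * (b * r - X) \<le> 2 * t" for a b r X t :: real
        by (simp add: distrib_right)
      then show ?thesis using \<open>(Re z + k x) * R\<^sup>2 - (k x * P + K * Q / L) * R \<le> T\<close> \<open>0 \<le> Re z * R\<^sup>2\<close> by blast
    qed
    moreover have "- k x * R\<^sup>2 \<le> H x * R\<^sup>2" using H[of x] by (intro mult_right_mono) auto
    ultimately have "k x * R\<^sup>2 - 2 * ((k x * P + K * Q / L) * R) \<le> H x * R\<^sup>2 + 2 * T"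
    proof -
      have "2 * (b * r - X) \<le> 2 * t \<Longrightarrow> - b * r \<le> h * r \<Longrightarrow> b * r - 2 * X \<le> h * r + 2 * t" for b r h X t :: real
        by (simp add: algebra_simps)
      then show ?thesis
        using \<open>2 * (k x * R\<^sup>2 - (k x * P + K * Q / L) * R) \<le> 2 * T\<close> \<open>- k x * R\<^sup>2 \<le> H x * R\<^sup>2\<close> by blast
    qed
    then have "v x * (k x * R\<^sup>2 - 2 * ((k x * P + K * Q / L) * R)) \<le> v x * (H x * R\<^sup>2 +
        2 * T)"
      using v(1)[of x] by (intro mult_left_mono) auto
    also have "\<dots> = g2 x" unfolding g2_def R_def T_def by (simp add: algebra_simps)
    finally have "B * (v x * (k x * R\<^sup>2 - 2 * ((k x * P + K * Q / L) * R))) \<le> B * g2 x"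
      using B0 by (intro mult_left_mono) auto
    then have "L * P\<^sup>2 + v x * Q\<^sup>2 - 2 * v x * (Q * P) - 2 * v x * ((R + K * Q / L) * Q)
      + B * (v x * (k x * R\<^sup>2 - 2 * ((k x * P + K * Q / L) * R))) \<le> - (g1 x - B * g2 x)" using A1 by linarith
    moreover have "v x * (P\<^sup>2 + Q\<^sup>2 / 4 + R\<^sup>2) \<le> L * P\<^sup>2 + v x * Q\<^sup>2 - 2 * v x * (Q * P) - 2 * v x * ((R + K * Q / L) * Q)
      + B * (v x * (k x * R\<^sup>2 - 2 * ((k x * P + K * Q / L) * R)))"
      by (rule adjoint_energy_coercive[OF pqr c(1) c(2)[OF x] c(3) _ v(2) B]) (use v(1)[of x] L in \<open>auto simp: L_def\<close>)
    ultimately show ?thesis unfolding P_def Q_def R_def by linarith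
  qed
  have neg: "g1 x - B * g2 x \<le> 0" if "0 \<le> x" for x
  proof -
    have "0 \<le> v x * ((cmod (w1 x))\<^sup>2 + (cmod (w3 x))\<^sup>2 / 4 + (cmod (e x))\<^sup>2)" using v(1)[of x] by simp
    then show ?thesis using coercive[OF that] by linarith
  qed
  have elim: "((\<lambda>x. v x * (cmod (e x))\<^sup>2) \<longlongrightarrow> 0) at_top"
  proof (rule tendsto_sandwich)
    show "((\<lambda>x. 0) \<longlongrightarrow> 0) at_top" by simp
    have "((\<lambda>x. v x * (cmod (w2 x) + 2 * cmod (w3 x))\<^sup>2) \<longlongrightarrow> l0 * (cmod l2 + 2 * cmod l3)\<^sup>2) at_top"
      by (intro tendsto_intros lim)
    then show "((\<lambda>x. v x * (cmod (w2 x) + 2 * cmod (w3 x))\<^sup>2) \<longlongrightarrow> 0) at_top" using lim(5) by auto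
    show "\<forall>\<^sub>F x in at_top. 0 \<le> v x * (cmod (e x))\<^sup>2" using v(1) by (simp add: less_imp_le)
    show "\<forall>\<^sub>F x in at_top. v x * (cmod (e x))\<^sup>2 \<le> v x * (cmod (w2 x) + 2 * cmod (w3 x))\<^sup>2"
      using eventually_ge_at_top[of 0]
    proof eventually_elim
      case (elim x)
      have "cmod (k x *\<^sub>R w3 x / z) \<le> 1 * cmod (w3 x)"
      proof -
        have "k x \<le> L" using c(3)[of x] L(1) K0 by (simp add: L_def)
        then have "k x / L \<le> 1" using L0 by simp
        then have "k x / L * cmod (w3 x) \<le> 1 * cmod (w3 x)" by (intro mult_right_mono) auto
        then show ?thesis using k0[OF elim] by (simp add: norm_divide L_def)
      qed
      then have "cmod (e x) \<le> cmod (w2 x) + 2 * cmod (w3 x)" unfolding e_def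
        using norm_triangle_ineq4[of "w2 x - w3 x" "k x *\<^sub>R w3 x / z"] norm_triangle_ineq4[of "w2 x" "w3 x"] by linarith
      then show ?case using v(1)[of x] by (intro mult_left_mono power_mono) auto
    qed
  qed
  have "(G \<longlongrightarrow> Re (tilt z * (l2 * cnj 0)) - B * 0) at_top" unfolding G_def
    by (intro tendsto_intros lim elim)
  then have Glim: "(G \<longlongrightarrow> 0) at_top" by simp
  have "G 0 \<le> 0" using zero v(1)[of 0] B0 by (simp add: G_def)
  moreover have "0 \<le> G x" if "0 \<le> x" for x by (rule nonincreasing_ge_limit[OF Gd neg Glim that])
  moreover have "G x \<le> G 0" if "0 \<le> x" for x
    using DERIV_nonpos_imp_nonincreasing[OF that, of G] Gd neg by blast
  ultimately have Gz: "G x = 0" if "0 \<le> x" for x using that by (meson order.antisym order_trans)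
  have "g1 x - B * g2 x = 0"
    by (rule DERIV_local_const[OF Gd \<open>0 < x\<close>]) (use \<open>0 < x\<close> Gz in auto)
  then have "v x * ((cmod (w1 x))\<^sup>2 + (cmod (w3 x))\<^sup>2 / 4 + (cmod (e x))\<^sup>2) \<le> 0"
    using coercive[of x] \<open>0 < x\<close> by simp
  then have s: "(cmod (w1 x))\<^sup>2 + (cmod (w3 x))\<^sup>2 / 4 + (cmod (e x))\<^sup>2 \<le> 0"
    using v(1)[of x] by (simp add: mult_le_0_iff)
  have "(cmod (w1 x))\<^sup>2 = 0" "(cmod (w3 x))\<^sup>2 = 0" "(cmod (e x))\<^sup>2 = 0"
    using s zero_le_power2[of "cmod (w1 x)"] zero_le_power2[of "cmod (w3 x)"] zero_le_power2[of "cmod (e x)"] by linarith+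
  then show "w1 x = 0" "w3 x = 0" "w2 x = 0" by (auto simp: e_def)
qed

text \<open>The counterpart for the growing mode, with \<open>P\<close>, \<open>Q\<close>, \<open>R\<close> the moduli of \<open>w1\<close>, \<open>U = w1'\<close>, \<open>w3\<close>. Here \<open>k\<close>
  is the total damping of \<open>w3\<close>, the constant \<open>B\<close> is chosen after \<open>K\<close> to absorb \<open>Q R\<close>, and \<open>L\<close> after both.\<close>

lemma growing_energy_coercive:
  fixes P Q R :: real
  assumes "0 \<le> P" "0 \<le> Q" "0 \<le> R" and K: "1 \<le> K" and c: "0 < c" "c \<le> k" and M: "0 \<le> M"
    and B: "B = (4 * K\<^sup>2 + 5) / (2 * c)"
    and L: "16 * K \<le> L" "2 * B \<le> L" "(6 + 2 * M)\<^sup>2 + 3 + 9 * K\<^sup>2 + B\<^sup>2 \<le> vm * L"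
  shows "P\<^sup>2 + Q\<^sup>2 / 8 + R\<^sup>2 \<le> vm * L * P\<^sup>2 + Q\<^sup>2 - (6 + 2 * M) * (Q * P)
      - 6 * K * ((Q / L + R) * P) - 2 * K * ((Q / L + R) * Q) + 2 * B * (k * R\<^sup>2) - 2 * B * ((P + Q / L) * R)"
proof -
  have L0: "0 < L" using L(1) K by simp
  have B0: "0 < B" using B c by (simp add: add_nonneg_pos)
  have a: "(6 + 2 * M) * (Q * P) \<le> Q\<^sup>2 / 4 + (6 + 2 * M)\<^sup>2 * P\<^sup>2"
    using zero_le_power2[of "Q / 2 - (6 + 2 * M) * P"] by (simp add: power2_eq_square algebra_simps)
  have qp: "Q * P \<le> Q\<^sup>2 / 8 + 2 * P\<^sup>2"
    using zero_le_power2[of "Q - 4 * P"] by (simp add: power2_eq_square algebra_simps)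
  have "6 * K / L \<le> 1" using L(1) L0 K by (simp add: field_simps)
  then have "6 * K / L * (Q * P) \<le> 1 * (Q * P)" using assms by (intro mult_right_mono) auto
  then have b1: "6 * K * (Q / L * P) \<le> Q\<^sup>2 / 8 + 2 * P\<^sup>2" using qp by simp
  have b2: "6 * K * (R * P) \<le> R\<^sup>2 + 9 * K\<^sup>2 * P\<^sup>2"
    using zero_le_power2[of "R - 3 * K * P"] by (simp add: power2_eq_square algebra_simps)
  have "2 * K / L \<le> 1 / 8" using L(1) L0 by (simp add: field_simps)
  then have "2 * K / L * Q\<^sup>2 \<le> 1 / 8 * Q\<^sup>2" by (intro mult_right_mono) auto
  then have c1: "2 * K * (Q / L * Q) \<le> Q\<^sup>2 / 8" by (simp add: power2_eq_square)
  have c2: "2 * K * (R * Q) \<le> Q\<^sup>2 / 4 + 4 * K\<^sup>2 * R\<^sup>2"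
    using zero_le_power2[of "Q / 2 - 2 * K * R"] by (simp add: power2_eq_square algebra_simps)
  have d1: "2 * B * (P * R) \<le> R\<^sup>2 + B\<^sup>2 * P\<^sup>2"
    using zero_le_power2[of "R - B * P"] by (simp add: power2_eq_square algebra_simps)
  have "2 * B / L \<le> 1" using L(2) L0 by (simp add: field_simps)
  then have "2 * B / L * (Q * R) \<le> 1 * (Q * R)" using assms by (intro mult_right_mono) auto
  moreover have "Q * R \<le> Q\<^sup>2 / 8 + 2 * R\<^sup>2"
    using zero_le_power2[of "Q - 4 * R"] by (simp add: power2_eq_square algebra_simps)
  ultimately have d2: "2 * B * (Q / L * R) \<le> Q\<^sup>2 / 8 + 2 * R\<^sup>2" by simp
  have "2 * B * c \<le> 2 * B * k" using B0 c(2) by (intro mult_left_mono) auto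
  then have "4 * K\<^sup>2 + 5 \<le> 2 * B * k" using B c(1) by simp
  then have e: "(4 * K\<^sup>2 + 5) * R\<^sup>2 \<le> 2 * B * k * R\<^sup>2" by (intro mult_right_mono) auto
  have f: "((6 + 2 * M)\<^sup>2 + 3 + 9 * K\<^sup>2 + B\<^sup>2) * P\<^sup>2 \<le> vm * L * P\<^sup>2" using L(3) by (intro mult_right_mono) auto
  have "6 * K * ((Q / L + R) * P) = 6 * K * (Q / L * P) + 6 * K * (R * P)"
    "2 * K * ((Q / L + R) * Q) = 2 * K * (Q / L * Q) + 2 * K * (R * Q)"
    "2 * B * ((P + Q / L) * R) = 2 * B * (P * R) + 2 * B * (Q / L * R)"
    "2 * B * (k * R\<^sup>2) = 2 * B * k * R\<^sup>2"
    by (simp_all add: algebra_simps)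
  then show ?thesis using a b1 b2 c1 c2 d1 d2 e f unfolding distrib_right by linarith
qed

text \<open>With \<open>U = w1'\<close>, the quantity \<open>N = U + k w2\<close> satisfies \<open>N' = z v w1 + v U + k' w2\<close>, in which no term of
  the size of \<open>z w2\<close> is left, so \<open>Re (tilt z * N * cnj w1)\<close> increases for large \<open>z\<close> up to errors controlled by the
  mode \<open>w3\<close>, which is damped at rate \<open>Re z + k\<close>. A multiple of \<open>|w1|\<^sup>2\<close> is subtracted to absorb the boundary contribution
  at \<open>0\<close>. Where \<open>k\<close> itself tends to zero, the damping is supplied by the weight \<open>exp (- \<theta> x)\<close> on the solution.\<close>

lemma growing_solution_zero_if_high_frequency:
  fixes w1 w2 w3 :: "real \<Rightarrow> complex" and v k kd :: "real \<Rightarrow> real"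
  assumes w1: "\<And>x. (w1 has_vector_derivative z * w2 x + z * w3 x) (at x)"
    and w2: "\<And>x. (w2 has_vector_derivative z * w3 x) (at x)"
    and w3: "\<And>x. (w3 has_vector_derivative
        of_real (v x) * (w1 x + w2 x) + (of_real (v x - k x) - z) * w3 x) (at x)"
    and v: "0 < vm" "\<And>x. x \<le> 0 \<Longrightarrow> vm \<le> v x" "\<And>x. v x \<le> 1"
    and k: "\<And>x. (k has_real_derivative kd x) (at x)" "\<And>x. \<bar>k x\<bar> \<le> K" "\<And>x. \<bar>kd x\<bar> \<le> K" "1 \<le> K"
    and \<theta>: "0 \<le> \<theta>" "\<theta> \<le> 1" and c: "0 < c" "\<And>x. c \<le> k x + \<theta>"
    and z: "0 \<le> Re z" and B: "B = (4 * K\<^sup>2 + 5) / (2 * c)" and M: "M = 16 * K\<^sup>2 / B"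
    and L: "16 * K \<le> cmod z" "2 * B \<le> cmod z" "(6 + 2 * M)\<^sup>2 + 3 + 9 * K\<^sup>2 + B\<^sup>2 \<le> vm * cmod z"
    and lim: "((\<lambda>x. exp (- \<theta> * x) *\<^sub>R w1 x) \<longlongrightarrow> 0) at_bot" "((\<lambda>x. exp (- \<theta> * x) *\<^sub>R w2 x) \<longlongrightarrow> 0) at_bot"
      "((\<lambda>x. exp (- \<theta> * x) *\<^sub>R w3 x) \<longlongrightarrow> 0) at_bot"
    and boundary: "z * (w2 0 + w3 0) = of_real b * w2 0" "\<bar>b\<bar> \<le> K" and "x < 0"
  shows "w1 x = 0" "w2 x = 0" "w3 x = 0"
proof -
  define L where "L = cmod z"
  have L0: "0 < L" using L(1) k(4) unfolding L_def by linarith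
  have z0: "z \<noteq> 0" using L0 unfolding L_def by (metis norm_zero less_irrefl)
  have B0: "0 < B" using B c(1) by (simp add: add_nonneg_pos)
  have M0: "0 \<le> M" using M B0 by simp
  define U where "U x = z * (w2 x + w3 x)" for x
  define N where "N x = U x + k x *\<^sub>R w2 x" for x
  have w1U: "(w1 has_vector_derivative U x) (at x)" for x
    using w1[of x] by (simp add: U_def algebra_simps)
  have Nd: "(N has_vector_derivative z * (v x * w1 x) + v x * U x + kd x * w2 x) (at x)" for x
  proof -
    have "(N has_vector_derivative (z * (z * w3 x + (of_real (v x) * (w1 x + w2 x) + (of_real (v x - k x) - z) * w3 x)))
        + (k x *\<^sub>R (z * w3 x) + kd x *\<^sub>R w2 x)) (at x)"
      unfolding N_def[abs_def] U_def
      by (intro has_vector_derivative_add has_vector_derivative_scaleR k(1) w2 w3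
          bounded_linear.has_vector_derivative[OF bounded_linear_mult_right])
    then show ?thesis
      by (rule has_vector_derivative_eq_rhs) (simp add: U_def scaleR_conv_of_real algebra_simps)
  qed
  define J where "J x = Re (tilt z * (N x * cnj (w1 x))) - B * (cmod (w3 x))\<^sup>2 - M * (cmod (w1 x))\<^sup>2" for x
  define J' where "J' x = Re (tilt z * ((z * (v x * w1 x) + v x * U x + kd x * w2 x) * cnj (w1 x) + N x * cnj (U x)))
      - B * (2 * Re ((of_real (v x) * (w1 x + w2 x) + (of_real (v x - k x) - z) * w3 x) * cnj (w3 x)))
      - M * (2 * Re (U x * cnj (w1 x)))" for x
  define E where "E x = exp (- 2 * \<theta> * x)" for x
  have E0: "0 < E x" for x by (simp add: E_def)
  have Jd: "(J has_real_derivative J' x) (at x)" for x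
    unfolding J_def[abs_def] J'_def
    by (intro DERIV_diff DERIV_cmult has_real_derivative_cmod_sq[OF w3] has_real_derivative_cmod_sq[OF w1U]
        has_real_derivative_Re_mult_cnj[OF Nd w1U])
  have Ed: "(E has_real_derivative E x * (- 2 * \<theta>)) (at x)" for x
    unfolding E_def[abs_def] by (auto intro!: derivative_eq_intros)
  have Gd: "((\<lambda>x. E x * J x) has_real_derivative E x * (J' x - 2 * \<theta> * J x)) (at x)" for x
    by (rule DERIV_cong[OF DERIV_mult[OF Ed Jd]]) (simp add: algebra_simps)
  have coercive: "(cmod (w1 x))\<^sup>2 + (cmod (U x))\<^sup>2 / 8 + (cmod (w3 x))\<^sup>2 \<le> J' x - 2 * \<theta> * J x"
    if x: "x \<le> 0" for x
  proof -
    define P Q R S where "P = cmod (w1 x)" and "Q = cmod (U x)" and "R = cmod (w3 x)" and "S = Q / L + R"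
    have pqr: "0 \<le> P" "0 \<le> Q" "0 \<le> R" "0 \<le> S" using L0 by (simp_all add: P_def Q_def R_def S_def)
    have v0: "0 < v x" using v(1) v(2)[OF x] by simp
    have w2U: "w2 x = U x / z - w3 x" using z0 by (simp add: U_def field_simps)
    have w2b: "cmod (w2 x) \<le> S" unfolding w2U S_def Q_def R_def L_def
      using norm_triangle_ineq4[of "U x / z" "w3 x"] by (simp add: norm_divide)
    have A1: "vm * L * P\<^sup>2 \<le> v x * Re (tilt z * z * (w1 x * cnj (w1 x)))"
    proof -
      have "vm * L * P\<^sup>2 \<le> v x * L * P\<^sup>2" using v(2)[OF x] L0 by (intro mult_right_mono) auto
      also have "L * P\<^sup>2 \<le> Re (tilt z * z * (w1 x * cnj (w1 x)))"
        unfolding Re_mult_cnj_same P_def L_def using Re_tilt_mult_ge[OF z] by (intro mult_right_mono) auto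
      then have "v x * L * P\<^sup>2 \<le> v x * Re (tilt z * z * (w1 x * cnj (w1 x)))"
        using v0 by (simp only: mult.assoc) (intro mult_left_mono, auto simp: mult.assoc)
      finally show ?thesis .
    qed
    have bd: "\<bar>s * Re (tilt z * (p * cnj q))\<bar> \<le> \<kappa> * (2 * (p' * q'))"
      if "\<bar>s\<bar> \<le> \<kappa>" "cmod p \<le> p'" "cmod q \<le> q'" for s \<kappa> p' q' :: real and p q :: complex
    proof -
      have "cmod p * cmod q \<le> p' * q'" using that order_trans[OF norm_ge_zero] by (intro mult_mono) auto
      then have "\<bar>Re (tilt z * (p * cnj q))\<bar> \<le> 2 * (p' * q')" using Re_tilt_mult_cnj_bound[of z p q] by linarith
      then show ?thesis unfolding abs_mult using that(1) by (intro mult_mono) auto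
    qed
    have A2: "\<bar>v x * Re (tilt z * (U x * cnj (w1 x)))\<bar> \<le> 1 * (2 * (Q * P))"
      by (rule bd) (use v0 v(3)[of x] in \<open>auto simp: P_def Q_def\<close>)
    have A3: "\<bar>kd x * Re (tilt z * (w2 x * cnj (w1 x)))\<bar> \<le> K * (2 * (S * P))"
      by (rule bd) (use k(3) w2b in \<open>auto simp: P_def\<close>)
    have A4: "Re (tilt z * (U x * cnj (U x))) = Q\<^sup>2" unfolding Re_mult_cnj_same Q_def by simp
    have A5: "\<bar>k x * Re (tilt z * (w2 x * cnj (U x)))\<bar> \<le> K * (2 * (S * Q))"
      by (rule bd) (use k(2) w2b in \<open>auto simp: Q_def\<close>)
    have A: "Re (tilt z * ((z * (v x * w1 x) + v x * U x + kd x * w2 x) * cnj (w1 x) + N x * cnj (U x))) =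
        v x * Re (tilt z * z * (w1 x * cnj (w1 x))) + v x * Re (tilt z * (U x * cnj (w1 x)))
        + kd x * Re (tilt z * (w2 x * cnj (w1 x))) + Re (tilt z * (U x * cnj (U x))) + k x * Re (tilt z * (w2 x * cnj (U x)))"
    proof -
      have "Re (t * ((z * (of_real r * a) + of_real r * u + of_real s * b) * cnj a + (u + q *\<^sub>R b) * cnj u)) =
        r * Re (t * z * (a * cnj a)) + r * Re (t * (u * cnj a)) + s * Re (t * (b * cnj a)) + Re (t * (u * cnj u))
        + q * Re (t * (b * cnj u))" for t a b u and r s q :: real
        by (simp add: scaleR_conv_of_real algebra_simps)
      then show ?thesis unfolding N_def by blast
    qed
    have B1: "Re ((of_real (v x) * (w1 x + w2 x) + (of_real (v x - k x) - z) * w3 x) * cnj (w3 x)) \<le>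
        (P + Q / L) * R - k x * R\<^sup>2"
    proof -
      have "of_real (v x) * (w1 x + w2 x) + (of_real (v x - k x) - z) * w3 x =
          v x * (w1 x + U x / z) - (z + k x) * w3 x" using z0 by (simp add: U_def field_simps)
      moreover have "Re ((of_real r * s - t * u) * cnj u) = r * Re (s * cnj u) - Re (t * (u * cnj u))" for r s t u
        by (simp add: algebra_simps)
      ultimately have "Re ((of_real (v x) * (w1 x + w2 x) + (of_real (v x - k x) - z) * w3 x) * cnj (w3 x)) =
          v x * Re ((w1 x + U x / z) * cnj (w3 x)) - Re ((z + k x) * (w3 x * cnj (w3 x)))"
        by (simp only:)
      also have "Re ((z + k x) * (w3 x * cnj (w3 x))) = (Re z + k x) * R\<^sup>2"
        unfolding Re_mult_cnj_same R_def by simp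
      also have "v x * Re ((w1 x + U x / z) * cnj (w3 x)) \<le> 1 * ((P + Q / L) * R)"
      proof -
        have "cmod (w1 x + U x / z) \<le> P + Q / L" unfolding P_def Q_def L_def
          using norm_triangle_ineq[of "w1 x" "U x / z"] by (simp add: norm_divide)
        then have "cmod (w1 x + U x / z) * R \<le> (P + Q / L) * R" using pqr by (intro mult_right_mono)
        then have "\<bar>Re ((w1 x + U x / z) * cnj (w3 x))\<bar> \<le> (P + Q / L) * R"
          using Re_mult_cnj_bound[of "w1 x + U x / z" "w3 x"] unfolding R_def by linarith
        then have "v x * \<bar>Re ((w1 x + U x / z) * cnj (w3 x))\<bar> \<le> 1 * ((P + Q / L) * R)"
          using v0 v(3)[of x] by (intro mult_mono) auto
        moreover have "v x * Re ((w1 x + U x / z) * cnj (w3 x)) \<le> v x * \<bar>Re ((w1 x + U x / z) * cnj (w3 x))\<bar>"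
          using v0 by (intro mult_left_mono) auto
        ultimately show ?thesis by linarith
      qed
      moreover have "0 \<le> Re z * R\<^sup>2" using z by simp
      ultimately show ?thesis using distrib_right[of "Re z" "k x" "R\<^sup>2"] by linarith
    qed
    have C1: "\<bar>Re (U x * cnj (w1 x))\<bar> \<le> Q * P" unfolding Q_def P_def by (rule Re_mult_cnj_bound)
    have D1: "\<theta> * Re (tilt z * (N x * cnj (w1 x))) \<le> 1 * (2 * ((Q + K * S) * P))"
    proof -
      have "cmod (N x) \<le> Q + \<bar>k x\<bar> * cmod (w2 x)" unfolding N_def Q_def
        using norm_triangle_ineq[of "U x" "k x *\<^sub>R w2 x"] by simp
      also have "\<bar>k x\<bar> * cmod (w2 x) \<le> K * S" using k(2)[of x] w2b by (intro mult_mono) auto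
      finally have "\<bar>\<theta> * Re (tilt z * (N x * cnj (w1 x)))\<bar> \<le> 1 * (2 * ((Q + K * S) * P))"
        using \<theta> by (intro bd) (auto simp: P_def)
      then show ?thesis by linarith
    qed
    have F: "P\<^sup>2 + Q\<^sup>2 / 8 + R\<^sup>2 \<le> vm * L * P\<^sup>2 + Q\<^sup>2 - (6 + 2 * M) * (Q * P)
      - 6 * K * (S * P) - 2 * K * (S * Q) + 2 * B * ((k x + \<theta>) * R\<^sup>2) - 2 * B * ((P + Q / L) * R)"
      unfolding S_def
      by (rule growing_energy_coercive[OF pqr(1-3) k(4) c M0 B]) (use L in \<open>auto simp: L_def\<close>)
    have B2: "2 * B * (Re ((of_real (v x) * (w1 x + w2 x) + (of_real (v x - k x) - z) * w3 x) * cnj (w3 x))) \<le>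
        2 * B * ((P + Q / L) * R - k x * R\<^sup>2)" using B1 B0 by (intro mult_left_mono) auto
    have C2: "2 * M * Re (U x * cnj (w1 x)) \<le> 2 * M * (Q * P)" using C1 M0 by (intro mult_left_mono) auto
    have D2: "0 \<le> 2 * \<theta> * M * P\<^sup>2" using \<theta> M0 by simp
    have "J' x - 2 * \<theta> * J x = v x * Re (tilt z * z * (w1 x * cnj (w1 x))) + v x * Re (tilt z * (U x * cnj (w1 x)))
        + kd x * Re (tilt z * (w2 x * cnj (w1 x))) + Re (tilt z * (U x * cnj (U x))) + k x * Re (tilt z * (w2 x * cnj (U x)))
        - 2 * B * (Re ((of_real (v x) * (w1 x + w2 x) + (of_real (v x - k x) - z) * w3 x) * cnj (w3 x)))
        - 2 * M * Re (U x * cnj (w1 x)) - 2 * (\<theta> * Re (tilt z * (N x * cnj (w1 x)))) + 2 * B * (\<theta> * R\<^sup>2) + 2 * \<theta> * M * P\<^sup>2"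
    proof -
      have "a - B * (2 * b) - M * (2 * d) - 2 * \<theta> * (n - B * R\<^sup>2 - M * P\<^sup>2) =
        a - 2 * B * b - 2 * M * d - 2 * (\<theta> * n) + 2 * B * (\<theta> * R\<^sup>2) + 2 * \<theta> * M * P\<^sup>2" for a b d n :: real
        by (simp add: algebra_simps)
      then show ?thesis unfolding J'_def J_def A P_def R_def by blast
    qed
    moreover have "2 * B * ((k x + \<theta>) * R\<^sup>2) = 2 * B * (k x * R\<^sup>2) + 2 * B * (\<theta> * R\<^sup>2)"
      "2 * B * ((P + Q / L) * R - k x * R\<^sup>2) = 2 * B * ((P + Q / L) * R) - 2 * B * (k x * R\<^sup>2)"
      "(6 + 2 * M) * (Q * P) = 6 * (Q * P) + 2 * M * (Q * P)"
      "1 * (2 * ((Q + K * S) * P)) = 2 * (Q * P) + 2 * K * (S * P)"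
      "K * (2 * (S * P)) = 2 * K * (S * P)" "K * (2 * (S * Q)) = 2 * K * (S * Q)"
      "6 * K * (S * P) = 3 * (2 * K * (S * P))"
      by (simp_all add: algebra_simps)
    ultimately show ?thesis
      using F A1 A2 A3 A4 A5 B2 C2 D1 D2 unfolding P_def[symmetric] Q_def[symmetric] R_def[symmetric] by linarith
  qed
  have pos: "0 \<le> E x * (J' x - 2 * \<theta> * J x)" if "x \<le> 0" for x
  proof -
    have "0 \<le> (cmod (w1 x))\<^sup>2 + (cmod (U x))\<^sup>2 / 8 + (cmod (w3 x))\<^sup>2" by simp
    then have "0 \<le> J' x - 2 * \<theta> * J x" using coercive[OF that] by linarith
    then show ?thesis by (rule mult_nonneg_nonneg[OF less_imp_le[OF E0]])
  qed
  have Jlim: "((\<lambda>x. E x * J x) \<longlongrightarrow> 0) at_bot"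
  proof (rule Lim_null_comparison)
    define Z where "Z x = (2 * L + K) * (cmod (exp (- \<theta> * x) *\<^sub>R w2 x) + cmod (exp (- \<theta> * x) *\<^sub>R w3 x))" for x
    define Y where "Y x = 2 * (Z x * cmod (exp (- \<theta> * x) *\<^sub>R w1 x)) + B * (cmod (exp (- \<theta> * x) *\<^sub>R w3 x))\<^sup>2
       + M * (cmod (exp (- \<theta> * x) *\<^sub>R w1 x))\<^sup>2" for x
    have "(Y \<longlongrightarrow> 2 * ((2 * L + K) * (cmod 0 + cmod 0) * cmod 0) + B * (cmod 0)\<^sup>2 + M * (cmod 0)\<^sup>2) at_bot"
      unfolding Y_def Z_def by (intro tendsto_intros lim)
    then show "(Y \<longlongrightarrow> 0) at_bot" by simp
    show "\<forall>\<^sub>F x in at_bot. norm (E x * J x) \<le> Y x"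
    proof (rule always_eventually, rule allI)
      fix x
      have E2: "E x = (exp (- \<theta> * x))\<^sup>2" by (simp add: E_def power2_eq_square flip: exp_add)
      have "cmod (N x) \<le> L * cmod (w2 x + w3 x) + \<bar>k x\<bar> * cmod (w2 x)"
        unfolding N_def U_def L_def using norm_triangle_ineq[of "z * (w2 x + w3 x)" "k x *\<^sub>R w2 x"] by (simp add: norm_mult)
      also have "\<dots> \<le> L * (cmod (w2 x) + cmod (w3 x)) + K * (cmod (w2 x) + cmod (w3 x))"
        using k(2)[of x] L0 k(4) by (intro add_mono mult_mono norm_triangle_ineq) auto
      also have "\<dots> \<le> (2 * L + K) * (cmod (w2 x) + cmod (w3 x))" using L0 by (simp add: algebra_simps)
      finally have "cmod (N x) * cmod (w1 x) \<le> (2 * L + K) * (cmod (w2 x) + cmod (w3 x)) * cmod (w1 x)"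
        by (intro mult_right_mono) auto
      then have "\<bar>J x\<bar> \<le> 2 * ((2 * L + K) * (cmod (w2 x) + cmod (w3 x)) * cmod (w1 x)) + B * (cmod (w3 x))\<^sup>2 + M * (cmod (w1 x))\<^sup>2"
        using Re_tilt_mult_cnj_bound[of z "N x" "w1 x"] B0 M0 zero_le_power2[of "cmod (w3 x)"] zero_le_power2[of "cmod (w1 x)"]
          mult_nonneg_nonneg[of B "(cmod (w3 x))\<^sup>2"] mult_nonneg_nonneg[of M "(cmod (w1 x))\<^sup>2"]
        unfolding J_def by linarith
      then have "E x * \<bar>J x\<bar> \<le> E x * (2 * ((2 * L + K) * (cmod (w2 x) + cmod (w3 x)) * cmod (w1 x)) + B * (cmod (w3 x))\<^sup>2 + M * (cmod (w1 x))\<^sup>2)"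
        using E0[of x] by (intro mult_left_mono) auto
      also have "\<dots> = Y x" unfolding Y_def Z_def E2 by (simp add: power2_eq_square algebra_simps)
      finally show "norm (E x * J x) \<le> Y x" using E0[of x] by (simp add: abs_mult)
    qed
  qed
  have ge: "0 \<le> E x * J x" if "x \<le> 0" for x
    by (rule nondecreasing_ge_limit_at_bot[OF Gd pos Jlim that])
  \<comment> \<open>The boundary condition ties \<open>w2 0\<close> to \<open>w3 0\<close>, and \<open>M\<close> is what completes the square of the product of \<open>w3 0\<close> and \<open>w1 0\<close>.\<close>
  have "E 0 * J 0 \<le> 0"
  proof -
    define R P where "R = cmod (w3 0)" and "P = cmod (w1 0)"
    have bL: "2 * K \<le> L" using L(1) k(4) by (simp add: L_def)
    have U0: "U 0 = of_real b * w2 0" using boundary(1) by (simp add: U_def)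
    then have "w2 0 = of_real b * w2 0 / z - w3 0" using z0 by (simp add: U_def field_simps)
    then have "cmod (w2 0) \<le> \<bar>b\<bar> * cmod (w2 0) / L + R" unfolding R_def L_def
      by (metis norm_divide norm_mult norm_of_real norm_triangle_ineq4)
    also have "\<bar>b\<bar> * cmod (w2 0) / L \<le> (L / 2) * cmod (w2 0) / L"
      using boundary(2) bL L0 by (intro divide_right_mono mult_right_mono) auto
    finally have w2R: "cmod (w2 0) \<le> 2 * R" using L0 by simp
    have "cmod (N 0) \<le> \<bar>b\<bar> * cmod (w2 0) + \<bar>k 0\<bar> * cmod (w2 0)" unfolding N_def U0
      using norm_triangle_ineq[of "of_real b * w2 0" "k 0 *\<^sub>R w2 0"] by (simp add: norm_mult)
    also have "\<dots> \<le> K * (2 * R) + K * (2 * R)" using boundary(2) k(2)[of 0] k(4) w2R by (intro add_mono mult_mono) auto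
    finally have "cmod (N 0) * P \<le> 4 * K * R * P" unfolding P_def by (intro mult_right_mono) auto
    then have "Re (tilt z * (N 0 * cnj (w1 0))) \<le> 8 * K * R * P"
      using Re_tilt_mult_cnj_bound[of z "N 0" "w1 0"] unfolding P_def by linarith
    moreover have "8 * K * R * P \<le> B * R\<^sup>2 + M * P\<^sup>2"
    proof -
      have "0 \<le> B * (R - 4 * K / B * P)\<^sup>2" using B0 by simp
      also have "\<dots> = B * R\<^sup>2 - 8 * K * R * P + M * P\<^sup>2"
        using B0 unfolding M by (simp add: power2_eq_square field_simps)
      finally show ?thesis by simp
    qed
    ultimately have "J 0 \<le> 0" unfolding J_def R_def P_def by linarith
    then show ?thesis using E0[of 0] by (simp add: mult_le_0_iff)
  qed
  moreover have "E x * J x \<le> E 0 * J 0" if "x \<le> 0" for x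
    by (rule DERIV_nonneg_imp_nondecreasing[OF that]) (use Gd pos in blast)
  ultimately have Gz: "E x * J x = 0" if "x \<le> 0" for x
    using ge[OF that] that by (meson order.antisym order_trans)
  have "E x * (J' x - 2 * \<theta> * J x) = 0"
  proof (rule DERIV_local_const[OF Gd, of "- x"])
    show "\<forall>y. \<bar>x - y\<bar> < - x \<longrightarrow> E x * J x = E y * J y"
    proof (intro allI impI)
      fix y assume "\<bar>x - y\<bar> < - x"
      then have "y \<le> 0" by linarith
      then show "E x * J x = E y * J y" using Gz[of x] Gz[of y] \<open>x < 0\<close> by linarith
    qed
  qed (use \<open>x < 0\<close> in simp)
  then have s: "(cmod (w1 x))\<^sup>2 + (cmod (U x))\<^sup>2 / 8 + (cmod (w3 x))\<^sup>2 \<le> 0"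
    using coercive[of x] \<open>x < 0\<close> E0[of x] by simp
  have "(cmod (w1 x))\<^sup>2 = 0" "(cmod (U x))\<^sup>2 = 0" "(cmod (w3 x))\<^sup>2 = 0"
    using s zero_le_power2[of "cmod (w1 x)"] zero_le_power2[of "cmod (U x)"] zero_le_power2[of "cmod (w3 x)"] by linarith+
  then show "w1 x = 0" "w3 x = 0" "w2 x = 0" using z0 by (auto simp: U_def)
qed

section \<open>Parity of the number of zeros\<close>

lemma convex_unstable_halfplane: "convex unstable_halfplane"
  unfolding unstable_halfplane_def by (rule convex_halfspace_Re_ge)

lemma closed_unstable_halfplane: "closed unstable_halfplane"
  unfolding unstable_halfplane_def by (rule closed_halfspace_Re_ge)

lemma cnj_unstable_halfplane: "cnj ` unstable_halfplane = unstable_halfplane"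
  unfolding unstable_halfplane_def image_cnj_conv_vimage_cnj by auto

lemma of_real_in_unstable_halfplane [simp]: "of_real x \<in> unstable_halfplane \<longleftrightarrow> 0 \<le> x"
  by (simp add: unstable_halfplane_def)

lemma unstable_halfplane_neighbourhood:
  assumes "f analytic_on unstable_halfplane"
  obtains S where "open S" "connected S" "unstable_halfplane \<subseteq> S" "f holomorphic_on S"
proof -
  obtain T where T: "open T" "unstable_halfplane \<subseteq> T" "f holomorphic_on T"
    using assms unfolding analytic_on_holomorphic by blast
  show thesis
  proof (rule that)
    have "(1::complex) \<in> unstable_halfplane" by (simp add: unstable_halfplane_def)
    then show "unstable_halfplane \<subseteq> connected_component_set T 1"
      using T(2) convex_connected[OF convex_unstable_halfplane] by (intro connected_component_maximal)
    show "f holomorphic_on connected_component_set T 1"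
      by (rule holomorphic_on_subset[OF T(3) connected_component_subset])
  qed (use T(1) in \<open>auto intro: open_connected_component\<close>)
qed

lemma zero_near_halfplane_if_zero_on_positive_reals:
  assumes "h analytic_on unstable_halfplane" and zero: "\<And>x::real. 0 < x \<Longrightarrow> h (of_real x) = 0"
    and "z \<in> unstable_halfplane"
  shows "\<forall>\<^sub>F w in nhds z. h w = 0"
proof -
  obtain S where S: "open S" "connected S" "unstable_halfplane \<subseteq> S" "h holomorphic_on S"
    using unstable_halfplane_neighbourhood[OF assms(1)] .
  have lim: "(1::complex) islimpt (of_real ` {0<..})"
    unfolding islimpt_approachable
  proof (intro allI impI)
    fix e :: real assume "0 < e"
    then have "complex_of_real (1 + e / 2) \<in> complex_of_real ` {0<..}" by (intro imageI) simp
    moreover have "complex_of_real (1 + e / 2) \<noteq> 1 \<and> dist (complex_of_real (1 + e / 2)) 1 < e"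
      using \<open>0 < e\<close> by (simp add: dist_norm norm_divide)
    ultimately show "\<exists>x'\<in>complex_of_real ` {0<..}. x' \<noteq> 1 \<and> dist x' 1 < e" by blast
  qed
  have "h w = 0" if "w \<in> S" for w
  proof (rule analytic_continuation[OF S(4,1,2) _ _ lim _ that])
    show "of_real ` {0<..} \<subseteq> S" "(1::complex) \<in> S"
      using S(3) by (auto simp: unstable_halfplane_def subset_iff)
  qed (use zero in auto)
  then show ?thesis using S(1,3) assms(3) unfolding eventually_nhds by blast
qed

lemma analytic_on_cnj_cnj:
  assumes "f analytic_on S"
  shows "(\<lambda>z. cnj (f (cnj z))) analytic_on (cnj ` S)"
proof -
  obtain T where T: "open T" "S \<subseteq> T" "f holomorphic_on T"
    using assms unfolding analytic_on_holomorphic by blast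
  have "cnj ` (cnj ` T) = T" by (simp add: image_image)
  moreover have o: "open (cnj ` T)"
    unfolding image_cnj_conv_vimage_cnj using T(1) by (intro open_vimage) (auto intro: continuous_intros)
  ultimately have "cnj \<circ> f \<circ> cnj holomorphic_on (cnj ` T)"
    using T(3) by (intro holomorphic_on_compose_cnj_cnj) auto
  then show ?thesis using o T(2) unfolding analytic_on_holomorphic comp_def by blast
qed

lemma finite_zeros_unstable_halfplane:
  assumes D: "D analytic_on unstable_halfplane" and "z0 \<in> unstable_halfplane" "D z0 \<noteq> 0"
    and bound: "\<And>z. z \<in> unstable_halfplane \<Longrightarrow> R \<le> cmod z \<Longrightarrow> D z \<noteq> 0"
  shows "finite (unstable_roots D)"
proof -
  obtain S where S: "open S" "connected S" "unstable_halfplane \<subseteq> S" "D holomorphic_on S"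
    using unstable_halfplane_neighbourhood[OF D] .
  show ?thesis
  proof (cases "\<exists>z\<in>S. D z = 0")
    case True
    define K where "K = unstable_halfplane \<inter> cball 0 R"
    have "compact K" unfolding K_def by (intro closed_Int_compact closed_unstable_halfplane compact_cball)
    moreover have "\<not> D constant_on S" using True assms(2,3) S(3) unfolding constant_on_def by (metis subsetD)
    ultimately have "finite {z\<in>K. D z = 0}"
      using S by (intro holomorphic_compact_finite_zeros) (auto simp: K_def)
    moreover have "unstable_roots D \<subseteq> {z\<in>K. D z = 0}"
      using bound unfolding unstable_roots_def K_def by (force simp: not_le[symmetric])
    ultimately show ?thesis by (rule rev_finite_subset)
  next
    case False
    then have "unstable_roots D = {}" using S(3) unfolding unstable_roots_def by auto
    then show ?thesis by simp
  qed
qed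

lemma eventually_nonzero_unstable_halfplane:
  assumes D: "D analytic_on unstable_halfplane" and "z0 \<in> unstable_halfplane" "D z0 \<noteq> 0" and "z \<in> unstable_halfplane"
  shows "\<forall>\<^sub>F w in at z. D w \<noteq> 0"
proof -
  obtain S where S: "open S" "connected S" "unstable_halfplane \<subseteq> S" "D holomorphic_on S"
    using unstable_halfplane_neighbourhood[OF D] .
  show ?thesis
    by (rule eventually_mono[OF non_zero_neighbour_alt[OF S(4,1,2), of z z0]]) (use assms S(3) in auto)
qed

lemma zorder_cnj_cnj:
  assumes "f analytic_on {z}" "\<forall>\<^sub>F w in at z. f w \<noteq> 0"
  shows "zorder (\<lambda>w. cnj (f (cnj w))) (cnj z) = zorder f z"
proof -
  have "\<exists>\<^sub>F w in at z. f w \<noteq> 0" using assms(2) by (intro eventually_frequently) auto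
  with assms(1) obtain r where r: "r > 0" "zor_poly f z holomorphic_on cball z r"
    "\<And>w. w \<in> cball z r - {z} \<Longrightarrow> f w = zor_poly f z w * (w - z) powi zorder f z" "zor_poly f z z \<noteq> 0"
    using zorder_exist[of f z] isolated_singularity_at_analytic not_essential_analytic by blast
  have im: "cnj ` ball (cnj z) r = ball z r"
  proof -
    have "dist (cnj z) (cnj w) = dist z w" for w
      by (metis complex_cnj_diff complex_mod_cnj dist_norm)
    then show ?thesis unfolding image_cnj_conv_vimage_cnj by auto
  qed
  have "zor_poly f z holomorphic_on cnj ` ball (cnj z) r"
    unfolding im by (rule holomorphic_on_subset[OF r(2)]) auto
  from holomorphic_on_compose_cnj_cnj[OF this open_ball]
  have h: "(\<lambda>w. cnj (zor_poly f z (cnj w))) holomorphic_on ball (cnj z) r" by (simp add: comp_def)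
  show ?thesis
  proof (rule zorder_eqI[OF open_ball _ h])
    fix w assume w: "w \<in> ball (cnj z) r" "w \<noteq> cnj z"
    have "cnj w \<in> ball z r" using w(1) im by blast
    moreover have "cnj w \<noteq> z" using w(2) by auto
    ultimately have "f (cnj w) = zor_poly f z (cnj w) * (cnj w - z) powi zorder f z" by (intro r(3)) auto
    then show "cnj (f (cnj w)) = cnj (zor_poly f z (cnj w)) * (w - cnj z) powi zorder f z"
      by (simp add: power_int_def)
  qed (use r in auto)
qed

text \<open>Up to the nonvanishing factor \<open>p\<close> the function \<open>D\<close> is real on the positive axis, hence its zeros come in
  conjugate pairs of equal multiplicity. None of them is real, so they are even in number.\<close>

lemma even_count_nonzero_roots:
  assumes D: "D analytic_on unstable_halfplane" and p: "p analytic_on unstable_halfplane"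
    and p0: "\<And>z. z \<in> unstable_halfplane \<Longrightarrow> z \<noteq> 0 \<Longrightarrow> p z \<noteq> 0"
    and real: "\<And>x::real. 0 < x \<Longrightarrow> Im (D (of_real x) / p (of_real x)) = 0"
    and nz: "\<And>x::real. 0 < x \<Longrightarrow> D (of_real x) \<noteq> 0"
    and bound: "\<And>z. z \<in> unstable_halfplane \<Longrightarrow> R \<le> cmod z \<Longrightarrow> D z \<noteq> 0"
  shows "even_count D (unstable_roots D - {0})"
proof -
  define Dc where "Dc z = cnj (D (cnj z))" for z
  define pc where "pc z = cnj (p (cnj z))" for z
  have Dc: "Dc analytic_on unstable_halfplane" and pc: "pc analytic_on unstable_halfplane"
    using analytic_on_cnj_cnj[OF D] analytic_on_cnj_cnj[OF p]
    unfolding cnj_unstable_halfplane Dc_def[abs_def] pc_def[abs_def] by auto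
  have H: "cnj z \<in> unstable_halfplane \<longleftrightarrow> z \<in> unstable_halfplane" for z by (simp add: unstable_halfplane_def)
  have one: "(1::complex) \<in> unstable_halfplane" "D 1 \<noteq> 0"
    using nz[of 1] by (auto simp: unstable_halfplane_def)
  have ident: "D (of_real x) * pc (of_real x) - Dc (of_real x) * p (of_real x) = 0" if "0 < x" for x :: real
  proof -
    define q where "q = D (of_real x) / p (of_real x)"
    have "p (of_real x) \<noteq> 0" using p0[of "of_real x"] that by auto
    then have Dq: "D (of_real x) = q * p (of_real x)" by (simp add: q_def)
    have "Im q = 0" using real[OF that] by (simp add: q_def)
    then have "cnj q = q" by (simp add: complex_eq_iff)
    then show ?thesis unfolding Dc_def pc_def by (simp add: Dq)
  qed
  have "(\<lambda>z. D z * pc z - Dc z * p z) analytic_on unstable_halfplane" by (intro analytic_intros D p Dc pc)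
  note loc = zero_near_halfplane_if_zero_on_positive_reals[OF this ident]
  have sym: "D (cnj z) = 0 \<and> zorder D (cnj z) = zorder D z"
    if z: "z \<in> unstable_halfplane" "z \<noteq> 0" "D z = 0" for z
  proof -
    have at: "D analytic_on {z}" "Dc analytic_on {z}" "p analytic_on {z}" "pc analytic_on {z}"
      "D analytic_on {cnj z}"
      using D Dc p pc z(1) H[of z] by (auto elim: analytic_on_subset)
    have pz: "p z \<noteq> 0" "pc z \<noteq> 0" using p0[of z] p0[of "cnj z"] z H by (auto simp: pc_def)
    have eq: "\<forall>\<^sub>F w in nhds z. D w * pc w = Dc w * p w" using loc[OF _ z(1)] by simp
    then have "D z * pc z = Dc z * p z" by (rule eventually_nhds_x_imp_x)
    then have Dz: "D (cnj z) = 0" using z(3) pz by (simp add: Dc_def)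
    have nzp: "\<forall>\<^sub>F w in at z. p w \<noteq> 0" "\<forall>\<^sub>F w in at z. pc w \<noteq> 0"
      by (rule eventually_nonzero_unstable_halfplane[OF p z(1) pz(1) z(1)],
          rule eventually_nonzero_unstable_halfplane[OF pc z(1) pz(2) z(1)])
    have nzD: "\<forall>\<^sub>F w in at z. D w \<noteq> 0" by (rule eventually_nonzero_unstable_halfplane[OF D one z(1)])
    have nzDc: "\<forall>\<^sub>F w in at z. Dc w \<noteq> 0"
    proof (rule eventually_nonzero_unstable_halfplane[OF Dc one(1) _ z(1)])
      show "Dc 1 \<noteq> 0" using one(2) by (simp add: Dc_def)
    qed
    have "zorder D z + zorder pc z = zorder (\<lambda>w. D w * pc w) z"
    proof (rule zorder_times_analytic[OF at(1,4), symmetric])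
      show "\<forall>\<^sub>F w in at z. D w * pc w \<noteq> 0"
        using eventually_conj[OF nzD nzp(2)] by (rule eventually_mono) simp
    qed
    also have "\<dots> = zorder (\<lambda>w. Dc w * p w) z"
      by (rule zorder_cong) (use eq in \<open>auto simp: eventually_at_filter elim: eventually_mono\<close>)
    also have "\<dots> = zorder Dc z + zorder p z"
    proof (rule zorder_times_analytic[OF at(2,3)])
      show "\<forall>\<^sub>F w in at z. Dc w * p w \<noteq> 0"
        using eventually_conj[OF nzDc nzp(1)] by (rule eventually_mono) simp
    qed
    finally have "zorder D z = zorder Dc z" using zorder_eq_0I[OF at(3) pz(1)] zorder_eq_0I[OF at(4) pz(2)] by simp
    also have "\<dots> = zorder D (cnj z)"
    proof -
      have "\<forall>\<^sub>F w in at (cnj z). D w \<noteq> 0"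
        by (rule eventually_nonzero_unstable_halfplane[OF D one]) (use z(1) H in simp)
      from zorder_cnj_cnj[OF at(5) this] show ?thesis by (simp add: Dc_def[abs_def])
    qed
    finally show ?thesis using Dz by simp
  qed
  define Rt where "Rt = unstable_roots D - {0}"
  define Up where "Up = {z\<in>Rt. 0 < Im z}"
  have fin: "finite Rt" unfolding Rt_def
    using finite_zeros_unstable_halfplane[OF D one bound] by simp
  have symR: "cnj z \<in> Rt" if "z \<in> Rt" for z
    using sym[of z] that H[of z] by (auto simp: Rt_def unstable_roots_def)
  have im: "Im z \<noteq> 0" if "z \<in> Rt" for z
  proof
    assume "Im z = 0"
    then have "z = of_real (Re z)" by (simp add: complex_eq_iff)
    moreover have "0 \<le> Re z" "z \<noteq> 0" "D z = 0" using that by (auto simp: Rt_def unstable_roots_def unstable_halfplane_def)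
    ultimately show False using nz[of "Re z"] by (cases "Re z = 0") auto
  qed
  have split: "Rt = Up \<union> cnj ` Up" "Up \<inter> cnj ` Up = {}"
  proof -
    have "z \<in> cnj ` Up" if "z \<in> Rt" "z \<notin> Up" for z
      using that im[of z] symR[of z] by (intro image_eqI[of _ _ "cnj z"]) (auto simp: Up_def)
    then show "Rt = Up \<union> cnj ` Up" using symR by (auto simp: Up_def)
    show "Up \<inter> cnj ` Up = {}" by (auto simp: Up_def)
  qed
  have "finite Up" using fin by (simp add: Up_def)
  have "(\<Sum>z\<in>Rt. zorder D z) = (\<Sum>z\<in>Up. zorder D z) + (\<Sum>z\<in>cnj ` Up. zorder D z)"
    unfolding split(1) by (intro sum.union_disjoint split(2)) (use \<open>finite Up\<close> in auto)
  also have "(\<Sum>z\<in>cnj ` Up. zorder D z) = (\<Sum>z\<in>Up. zorder D (cnj z))"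
    by (subst sum.reindex) (auto simp: inj_on_def)
  also have "\<dots> = (\<Sum>z\<in>Up. zorder D z)"
    using sym by (intro sum.cong) (auto simp: Up_def Rt_def unstable_roots_def)
  finally have "even (\<Sum>z\<in>Rt. zorder D z)" by simp
  then show ?thesis using fin unfolding even_count_def Rt_def by simp
qed

section \<open>The outflow determinant\<close>

lemma tendsto_at_right_analytic:
  assumes "f analytic_on unstable_halfplane"
  shows "((\<lambda>x::real. f (of_real x)) \<longlongrightarrow> f 0) (at_right 0)"
proof -
  have "f analytic_on {0}" using assms by (rule analytic_on_subset) (simp add: unstable_halfplane_def)
  then have "isCont f 0" by (rule analytic_at_imp_isCont)
  moreover have "((\<lambda>x::real. complex_of_real x) \<longlongrightarrow> complex_of_real 0) (at_right 0)"
    by (intro tendsto_of_real tendsto_ident_at)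
  ultimately show ?thesis using isCont_tendsto_compose[of 0 f] by simp
qed

lemma conj_analytic_on_cnj:
  assumes "conj_analytic_on F unstable_halfplane"
  shows "(\<lambda>z. cnj (F z)) analytic_on unstable_halfplane"
  using analytic_on_cnj_cnj[OF assms[unfolded conj_analytic_on_def]] by (simp add: image_image)

lemma tendsto_at_right_conj_analytic:
  assumes "conj_analytic_on F unstable_halfplane"
  shows "((\<lambda>x::real. F (of_real x)) \<longlongrightarrow> F 0) (at_right 0)"
  using tendsto_cnj[OF tendsto_at_right_analytic[OF conj_analytic_on_cnj[OF assms]]] by simp

lemma deriv_nonzero_if_linear_lower_bound:
  assumes D: "D analytic_on unstable_halfplane" and "D 0 = 0"
    and low: "\<And>x::real. 0 < x \<Longrightarrow> g x * x \<le> cmod (D (of_real x))"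
    and g: "(g \<longlongrightarrow> g0) (at_right 0)" "0 < g0"
  shows "deriv D 0 \<noteq> 0"
proof -
  have "D analytic_on {0}" using D by (rule analytic_on_subset) (simp add: unstable_halfplane_def)
  then have "(D has_field_derivative deriv D 0) (at 0)"
    by (simp add: DERIV_deriv_iff_field_differentiable analytic_on_imp_differentiable_at)
  then have lim: "((\<lambda>z. D z / z) \<longlongrightarrow> deriv D 0) (at 0)"
    using assms(2) by (simp add: has_field_derivative_iff)
  have "filterlim complex_of_real (at 0) (at_right 0)"
    unfolding filterlim_at by (auto intro!: tendsto_eq_intros simp: eventually_at_filter)
  from tendsto_norm[OF filterlim_compose[OF lim this]]
  have "((\<lambda>x. cmod (D (of_real x) / of_real x)) \<longlongrightarrow> cmod (deriv D 0)) (at_right 0)" .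
  moreover have "\<forall>\<^sub>F x in at_right 0. g x \<le> cmod (D (of_real x) / of_real x)"
    using eventually_at_right_less[of 0]
  proof eventually_elim
    case (elim x)
    then show ?case using low[of x] by (simp add: norm_divide field_simps)
  qed
  ultimately have "g0 \<le> cmod (deriv D 0)" by (intro tendsto_le[OF _ _ g(1)]) auto
  then show ?thesis using g(2) by auto
qed

lemma D_out_eq:
  "D_out v W z = - (W 0 z $ 2 + z / (z - of_real (deriv v 0)) * W 0 z $ 3)"
  by (simp add: D_out_def cdot_def sum_3 mult.commute)

text \<open>At \<open>z = 0\<close> the first two components of the growing mode are constant in \<open>x\<close>, hence zero by decay, so \<open>D_out\<close>
  vanishes there while the third component does not. For \<open>z > 0\<close> both terms of \<open>D_out / V3\<close> have the same sign. Hence there are no positive zeros, and \<open>|D_out| / z\<close> is at least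
  \<open>|W3| / (z - v' 0)\<close>, whose limit at \<open>z = 0\<close> is positive.\<close>

lemma D_out_parity:
  fixes v k kd vd :: "real \<Rightarrow> real"
  assumes mode: "is_growing_mode f v mu V W"
    and v: "\<And>x. 0 < v x" "\<And>x. v x \<le> 1" "0 < vm" "\<And>x. x \<le> 0 \<Longrightarrow> vm \<le> v x"
    and vd: "\<And>x. (v has_real_derivative vd x) (at x)" and vd0: "vd 0 < 0" "\<bar>vd 0\<bar> \<le> K"
    and fk: "\<And>x. f (v x) = v x - k x"
    and k: "\<And>x. (k has_real_derivative kd x) (at x)" "\<And>x. \<bar>k x\<bar> \<le> K" "\<And>x. \<bar>kd x\<bar> \<le> K" "1 \<le> K"
    and \<theta>: "0 \<le> \<theta>" "\<theta> \<le> 1" "\<And>z. z \<in> unstable_halfplane \<Longrightarrow> \<theta> < Re (mu z)"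
    and c: "0 < c" "\<And>x. c \<le> k x + \<theta>"
  shows "deriv (D_out v W) 0 \<noteq> 0" "even_count (D_out v W) (unstable_roots (D_out v W) - {0})"
proof -
  define b where "b = deriv v 0"
  have b: "b = vd 0" unfolding b_def by (rule DERIV_imp_deriv[OF vd])
  define D where "D = D_out v W"
  have Dz: "D z = - (W 0 z $ 2 + z / (z - of_real b) * W 0 z $ 3)" for z
    unfolding D_def D_out_eq b_def ..
  have zb: "z - of_real b \<noteq> 0" if "z \<in> unstable_halfplane" for z
    using that vd0(1) b by (auto simp: unstable_halfplane_def)
  have Wan: "(\<lambda>z. W x z $ i) analytic_on unstable_halfplane" for x i
    using mode unfolding is_growing_mode_def vec_analytic_on_def by blast
  have Van: "(\<lambda>z. V z $ i) analytic_on unstable_halfplane" for i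
    using mode unfolding is_growing_mode_def vec_analytic_on_def by blast
  have D: "D analytic_on unstable_halfplane"
    unfolding Dz[abs_def] by (intro analytic_intros Wan) (use zb in auto)
  have at: "0 < Re (mu z)" "is_eigenpair (A_mat f 1 z) (mu z) (V z)"
      "solves (\<lambda>x. A_mat f (v x) z) (\<lambda>x. W x z)" "asymp_exp (\<lambda>x. W x z) (mu z) (V z) at_bot"
    if "z \<in> unstable_halfplane" for z
    using mode that unfolding is_growing_mode_def by blast+
  have V3: "V z $ 3 \<noteq> 0" if "z \<in> unstable_halfplane" for z
  proof -
    have "mu z \<noteq> 0" using at(1)[OF that] by auto
    then show ?thesis by (rule growing_eigenpair_components(4)[OF at(2)[OF that]])
  qed
  have decay: "((\<lambda>x. exp (- \<theta> * x) *\<^sub>R W x z $ i) \<longlongrightarrow> 0) at_bot" if z: "z \<in> unstable_halfplane" for z i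
  proof -
    have "((\<lambda>x. exp ((mu z - of_real \<theta>) * of_real x)) \<longlongrightarrow> 0) at_bot"
    proof (rule tendsto_norm_zero_cancel)
      have "filterlim (\<lambda>x. (Re (mu z) - \<theta>) * x) at_bot at_bot"
        using \<theta>(3)[OF z] by (intro filterlim_tendsto_pos_mult_at_bot[OF tendsto_const _ filterlim_ident]) simp
      then show "((\<lambda>x. cmod (exp ((mu z - of_real \<theta>) * of_real x))) \<longlongrightarrow> 0) at_bot"
        by (simp add: filterlim_compose[OF exp_at_bot])
    qed
    from tendsto_mult[OF this asymp_exp_component[OF at(4)[OF z], of i]]
    have "((\<lambda>x. exp ((mu z - of_real \<theta>) * of_real x) * (exp (- (mu z * of_real x)) * W x z $ i)) \<longlongrightarrow> 0) at_bot"
      by simp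
    moreover have "exp ((mu z - of_real \<theta>) * of_real x) * (exp (- (mu z * of_real x)) * W x z $ i) = exp (- \<theta> * x) *\<^sub>R W x z $ i" for x
    proof -
      have e: "exp ((mu z - of_real \<theta>) * of_real x) * exp (- (mu z * of_real x)) = exp (of_real (- \<theta> * x))"
        by (simp add: algebra_simps flip: exp_add)
      then show ?thesis by (simp only: scaleR_conv_of_real exp_of_real mult.assoc[symmetric] e)
    qed
    ultimately show ?thesis by simp
  qed
  have nonzero_left: "\<exists>x<0. W x z \<noteq> 0" if z: "z \<in> unstable_halfplane" for z
  proof (rule ccontr)
    assume "\<not> (\<exists>x<0. W x z \<noteq> 0)"
    then have "\<forall>\<^sub>F x in at_bot. exp (- (mu z * of_real x)) * W x z $ 3 = 0"
      by (intro eventually_mono[OF eventually_gt_at_bot[of 0]]) auto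
    then have "((\<lambda>x. exp (- (mu z * of_real x)) * W x z $ 3) \<longlongrightarrow> 0) at_bot" by (rule tendsto_eventually)
    from tendsto_unique[OF _ this asymp_exp_component[OF at(4)[OF z]]] show False using V3[OF z] by simp
  qed
  note w = growing_components[OF at(3)]
  have z0: "(0::complex) \<in> unstable_halfplane" by (simp add: unstable_halfplane_def)
  have const: "W 0 0 $ i = 0" if "i = 1 \<or> i = 2" for i
  proof -
    have "((\<lambda>x. W x 0 $ i) has_vector_derivative 0) (at x within UNIV)" for x
      using w(1,2)[OF z0, of x] that by auto
    then obtain cc where cc: "\<And>x. W x 0 $ i = cc" using has_vector_derivative_zero_constant[of UNIV "\<lambda>x. W x 0 $ i"] by auto
    have "((\<lambda>x::real. cc) \<longlongrightarrow> 0) at_bot"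
    proof (rule Lim_null_comparison)
      show "\<forall>\<^sub>F x in at_bot. norm cc \<le> norm (exp (- \<theta> * x) *\<^sub>R W x 0 $ i)"
        using eventually_le_at_bot[of 0]
      proof eventually_elim
        case (elim x)
        then have "1 \<le> exp (- \<theta> * x)" using \<theta>(1) by (simp add: mult_nonneg_nonpos)
        then show ?case unfolding cc by (simp add: mult_le_cancel_right1)
      qed
      show "((\<lambda>x. norm (exp (- \<theta> * x) *\<^sub>R W x 0 $ i)) \<longlongrightarrow> 0) at_bot" by (rule tendsto_norm_zero[OF decay[OF z0]])
    qed
    then have "cc = 0" by (simp add: tendsto_const_iff)
    then show ?thesis using cc[of 0] by simp
  qed
  have D0: "D 0 = 0" by (simp add: Dz const)
  have W30: "W 0 0 $ 3 \<noteq> 0"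
  proof
    assume a: "W 0 0 $ 3 = 0"
    have c12: "W x 0 $ i = 0" if "i = 1 \<or> i = 2" for i x
    proof -
      have "((\<lambda>x. W x 0 $ i) has_vector_derivative 0 * W x 0 $ i) (at x)" for x
        using w(1,2)[OF z0, of x] that by auto
      from linear_ode_zero[OF this continuous_on_const const[OF that]] show ?thesis .
    qed
    have d3: "((\<lambda>x. W x 0 $ 3) has_vector_derivative of_real (f (v x)) * W x 0 $ 3) (at x)" for x
      using w(3)[OF z0, of x] by (simp add: c12)
    have "continuous_on UNIV v" "continuous_on UNIV k"
      using vd k(1) by (auto intro!: DERIV_continuous_on)
    then have "continuous_on UNIV (\<lambda>x. complex_of_real (f (v x)))" unfolding fk by (intro continuous_intros)
    from linear_ode_zero[OF d3 this a] have "W x 0 $ 3 = 0" for x .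
    then have "W x 0 = 0" for x using c12 by (simp add: vec_eq_iff forall_3)
    then show False using nonzero_left[OF z0] by simp
  qed
  have pos: "Im (D (of_real l) / V (of_real l) $ 3) = 0"
      "cmod (W 0 (of_real l) $ 3) / (l - b) * l \<le> cmod (D (of_real l))" "D (of_real l) \<noteq> 0" if l: "0 < l" for l :: real
  proof -
    have lz: "complex_of_real l \<in> unstable_halfplane" using l by simp
    define q where "q i = W 0 (of_real l) $ i / V (of_real l) $ 3" for i
    have "- K \<le> f (v x)" for x using v(1)[of x] k(2)[of x] unfolding fk by linarith
    note gm = growing_mode_positive[OF l at(3)[OF lz] at(4)[OF lz] at(1)[OF lz] at(2)[OF lz] less_imp_le[OF v(1)] this, of 0]
    have q: "Im (q i) = 0" "0 < Re (q i)" for i unfolding q_def using gm by auto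
    have qr: "q i = of_real (Re (q i))" for i using q(1)[of i] by (simp add: complex_eq_iff)
    have Wq: "W 0 (of_real l) $ i = of_real (Re (q i)) * V (of_real l) $ 3" for i
      unfolding qr[symmetric] using V3[OF lz] by (simp add: q_def)
    have lb: "0 < l - b" using l vd0(1) b by simp
    define s where "s = Re (q 2) + l / (l - b) * Re (q 3)"
    have s: "l / (l - b) * Re (q 3) < s" "0 < s"
      using q(2)[of 2] q(2)[of 3] l lb by (auto simp: s_def intro!: add_pos_pos)
    have Ds: "D (of_real l) = - of_real s * V (of_real l) $ 3"
      unfolding Dz Wq s_def by (simp add: algebra_simps)
    show "Im (D (of_real l) / V (of_real l) $ 3) = 0" unfolding Ds using V3[OF lz] by simp
    show "D (of_real l) \<noteq> 0" unfolding Ds using V3[OF lz] s by simp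
    have "cmod (W 0 (of_real l) $ 3) / (l - b) * l = (l / (l - b) * Re (q 3)) * cmod (V (of_real l) $ 3)"
      unfolding Wq using q(2)[of 3] by (simp add: norm_mult)
    also have "\<dots> \<le> s * cmod (V (of_real l) $ 3)" using s by (intro mult_right_mono) auto
    also have "\<dots> = cmod (D (of_real l))" unfolding Ds using s by (simp add: norm_mult)
    finally show "cmod (W 0 (of_real l) $ 3) / (l - b) * l \<le> cmod (D (of_real l))" .
  qed
  show "deriv (D_out v W) 0 \<noteq> 0"
    unfolding D_def[symmetric]
  proof (rule deriv_nonzero_if_linear_lower_bound[OF D D0])
    show "cmod (W 0 (of_real l) $ 3) / (l - b) * l \<le> cmod (D (of_real l))" if "0 < l" for l
      by (rule pos(2)[OF that])
    have "((\<lambda>l. cmod (W 0 (of_real l) $ 3) / (l - b)) \<longlongrightarrow> cmod (W 0 0 $ 3) / (0 - b)) (at_right 0)"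
      by (intro tendsto_intros tendsto_at_right_analytic[OF Wan]) (use vd0(1) b in auto)
    then show "((\<lambda>l. cmod (W 0 (of_real l) $ 3) / (l - b)) \<longlongrightarrow> cmod (W 0 0 $ 3) / (0 - b)) (at_right 0)" .
    show "0 < cmod (W 0 0 $ 3) / (0 - b)" using W30 vd0(1) b by (simp add: divide_pos_neg)
  qed
  define B where "B = (4 * K\<^sup>2 + 5) / (2 * c)"
  define M where "M = 16 * K\<^sup>2 / B"
  define R where "R = Max {16 * K, 2 * B, ((6 + 2 * M)\<^sup>2 + 3 + 9 * K\<^sup>2 + B\<^sup>2) / vm}"
  have high: "D z \<noteq> 0" if z: "z \<in> unstable_halfplane" "R \<le> cmod z" for z
  proof
    assume D0: "D z = 0"
    have R: "16 * K \<le> cmod z" "2 * B \<le> cmod z" "((6 + 2 * M)\<^sup>2 + 3 + 9 * K\<^sup>2 + B\<^sup>2) / vm \<le> cmod z"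
      using z(2) by (auto simp: R_def)
    then have R3: "(6 + 2 * M)\<^sup>2 + 3 + 9 * K\<^sup>2 + B\<^sup>2 \<le> vm * cmod z" using v(3) by (simp add: field_simps)
    have bc: "z * (W 0 z $ 2 + W 0 z $ 3) = of_real b * W 0 z $ 2"
      using D0 zb[OF z(1)] unfolding Dz by (simp add: field_simps)
    have Re: "0 \<le> Re z" using z(1) by (simp add: unstable_halfplane_def)
    have w3: "((\<lambda>x. W x z $ 3) has_vector_derivative
      of_real (v x) * (W x z $ 1 + W x z $ 2) + (of_real (v x - k x) - z) * W x z $ 3) (at x)" for x
      using w(3)[OF z(1), of x] unfolding fk .
    have bK: "\<bar>b\<bar> \<le> K" using vd0(2) b by simp
    note zero = growing_solution_zero_if_high_frequency[OF w(1)[OF z(1)] w(2)[OF z(1)] w3 v(3,4) v(2) k \<theta>(1,2) c Re B_def M_def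
      R(1,2) R3 decay[OF z(1)] decay[OF z(1)] decay[OF z(1)] bc bK]
    have "W x z = 0" if "x < 0" for x using zero[OF _ that] by (simp add: vec_eq_iff forall_3)
    then show False using nonzero_left[OF z(1)] by blast
  qed
  show "even_count (D_out v W) (unstable_roots (D_out v W) - {0})"
    unfolding D_def[symmetric]
    by (rule even_count_nonzero_roots[OF D Van V3 pos(1,3) high])
qed

section \<open>The inflow determinant\<close>

lemma D_in_eq: "D_in W z = cnj (W 0 z $ 1)"
  by (simp add: D_in_def cdot_def sum_3)

lemma D_in_analytic:
  assumes "\<And>x. vec_conj_analytic_on (W x) unstable_halfplane"
  shows "D_in W analytic_on unstable_halfplane"
  unfolding D_in_eq[abs_def] using assms by (intro conj_analytic_on_cnj) (simp add: vec_conj_analytic_on_def)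

text \<open>For \<open>z > 0\<close> positivity gives \<open>|D_in| \<ge> |V1|\<close>. This survives the limit \<open>z \<rightarrow> 0\<close>, and \<open>V1\<close> does not vanish
  there: by the characteristic equation the eigenvalue is of order at least \<open>z\<close>, so \<open>V2\<close> and \<open>V3\<close> are controlled
  by \<open>V1\<close>.\<close>

lemma D_in_parity:
  fixes v k kd H :: "real \<Rightarrow> real"
  assumes mode: "is_adjoint_mode f vp v mu V W"
    and vp: "0 < vp" "\<And>x. vp \<le> v x" "\<And>x. v x \<le> 1" and fp: "\<And>x. f vp \<le> f (v x)"
    and vlim: "(v \<longlongrightarrow> vp) at_top" and vd: "\<And>x. (v has_real_derivative v x * H x) (at x)"
    and fk: "\<And>x. f (v x) = v x - k x" and H: "\<And>x. - k x \<le> H x"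
    and k: "\<And>x. (k has_real_derivative kd x) (at x)" "\<And>x. k x \<le> K" "\<And>x. \<bar>v x * k x - kd x\<bar> \<le> K"
    and c: "0 < c" "\<And>x. c \<le> k x"
  shows "D_in W 0 \<noteq> 0" "even_count (D_in W) (unstable_roots (D_in W))"
proof -
  define D where "D = D_in W"
  have Wan: "vec_conj_analytic_on (W x) unstable_halfplane" for x
    using mode unfolding is_adjoint_mode_def by blast
  have Van: "conj_analytic_on (\<lambda>z. V z $ i) unstable_halfplane" for i
    using mode unfolding is_adjoint_mode_def vec_conj_analytic_on_def by blast
  have muan: "conj_analytic_on mu unstable_halfplane" and V0: "V 0 \<noteq> 0"
    using mode unfolding is_adjoint_mode_def by auto
  have at: "Re (mu z) < 0" "is_eigenpair (- conj_transpose (A_mat f vp z)) (mu z) (V z)"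
      "solves (\<lambda>x. - conj_transpose (A_mat f (v x) z)) (\<lambda>x. W x z)" "asymp_exp (\<lambda>x. W x z) (mu z) (V z) at_top"
    if "z \<in> unstable_halfplane" "z \<noteq> 0" for z
    using mode that unfolding is_adjoint_mode_def by blast+
  have D: "D analytic_on unstable_halfplane" unfolding D_def by (rule D_in_analytic[OF Wan])
  have Dz: "D z = cnj (W 0 z $ 1)" for z unfolding D_def by (rule D_in_eq)
  have V3: "cnj (V z $ 3) \<noteq> 0" if "z \<in> unstable_halfplane" "z \<noteq> 0" for z
  proof -
    have "mu z \<noteq> 0" using at(1)[OF that] by auto
    then show ?thesis using adjoint_eigenpair_components(4)[OF at(2)[OF that]] by simp
  qed
  have pos: "Im (D (of_real l) / cnj (V (of_real l) $ 3)) = 0" "D (of_real l) \<noteq> 0"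
      "cmod (V (of_real l) $ 1) \<le> cmod (D (of_real l))"
      "of_real vp * V (of_real l) $ 3 = - mu (of_real l) * V (of_real l) $ 1"
      "cmod (V (of_real l) $ 2) \<le> (2 + (cmod (mu (of_real l)) + l + \<bar>f vp\<bar>) / vp) * cmod (V (of_real l) $ 1)"
    if l: "0 < l" for l :: real
  proof -
    have lz: "complex_of_real l \<in> unstable_halfplane" "complex_of_real l \<noteq> 0" using l by auto
    obtain m where m: "0 < m" "mu (of_real l) = - of_real m" "V (of_real l) $ 3 \<noteq> 0"
      "V (of_real l) $ 1 = of_real (vp / m) * V (of_real l) $ 3"
      "of_real m * V (of_real l) $ 2 = of_real (l + m) * V (of_real l) $ 1"
      "Im (D (of_real l) / cnj (V (of_real l) $ 3)) = 0" "vp / m \<le> Re (D (of_real l) / cnj (V (of_real l) $ 3))"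
      "vp * (l\<^sup>2 + 2 * l * m) + (f vp - l) * m\<^sup>2 = m ^ 3"
      unfolding Dz using adjoint_mode_positive[OF l at(3)[OF lz] at(4)[OF lz] at(1)[OF lz] at(2)[OF lz] vp(1,2) fp] .
    show "Im (D (of_real l) / cnj (V (of_real l) $ 3)) = 0" by (rule m(6))
    have vm: "0 < vp / m" using vp(1) m(1) by simp
    have "vp / m \<le> cmod (D (of_real l) / cnj (V (of_real l) $ 3))"
      using m(7) complex_Re_le_cmod order_trans by blast
    then have ge: "vp / m * cmod (V (of_real l) $ 3) \<le> cmod (D (of_real l))"
      using m(3) by (simp add: norm_divide pos_le_divide_eq)
    then show "cmod (V (of_real l) $ 1) \<le> cmod (D (of_real l))"
      unfolding m(4) using vp(1) m(1) by (simp add: norm_mult norm_divide)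
    have "0 < vp / m * cmod (V (of_real l) $ 3)" by (rule mult_pos_pos[OF vm]) (use m(3) in simp)
    then show "D (of_real l) \<noteq> 0" using ge by auto
    show "of_real vp * V (of_real l) $ 3 = - mu (of_real l) * V (of_real l) $ 1"
      unfolding m(2,4) using m(1) by simp
    have "V (of_real l) $ 2 = of_real ((l + m) / m) * V (of_real l) $ 1"
      using m(1,5) by (simp add: field_simps)
    then have V2: "cmod (V (of_real l) $ 2) = (l + m) / m * cmod (V (of_real l) $ 1)"
      using l m(1) by (simp add: norm_mult norm_divide flip: of_real_add)
    have "vp * l\<^sup>2 = m ^ 3 - (f vp - l) * m\<^sup>2 - 2 * vp * l * m" using m(8) by (simp add: algebra_simps)
    also have "\<dots> \<le> m ^ 3 + (\<bar>f vp\<bar> + l) * m\<^sup>2"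
    proof -
      have "- (f vp) * m\<^sup>2 \<le> \<bar>f vp\<bar> * m\<^sup>2" by (intro mult_right_mono) auto
      moreover have "0 \<le> 2 * vp * l * m" using vp(1) l m(1) by simp
      ultimately show ?thesis by (simp add: algebra_simps)
    qed
    also have "\<dots> = (m + l + \<bar>f vp\<bar>) * m\<^sup>2" by (simp add: power2_eq_square power3_eq_cube algebra_simps)
    finally have "(l / m)\<^sup>2 \<le> (m + l + \<bar>f vp\<bar>) / vp"
      using vp(1) m(1) by (simp add: power_divide field_simps)
    moreover have "l / m \<le> 1 + (l / m)\<^sup>2"
    proof -
      have "t \<le> 1 + t\<^sup>2" for t :: real
        using zero_le_power2[of "t - 1 / 2"] unfolding power2_diff by (simp add: power2_eq_square)
      then show ?thesis .
    qed
    moreover have "(l + m) / m = l / m + 1" using m(1) by (simp add: field_simps)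
    ultimately have "(l + m) / m \<le> 2 + (cmod (mu (of_real l)) + l + \<bar>f vp\<bar>) / vp"
      using m(1) unfolding m(2) by simp
    then show "cmod (V (of_real l) $ 2) \<le> (2 + (cmod (mu (of_real l)) + l + \<bar>f vp\<bar>) / vp) * cmod (V (of_real l) $ 1)"
      unfolding V2 by (intro mult_right_mono) auto
  qed
  note Vlim = tendsto_at_right_conj_analytic[OF Van]
  have V10: "V 0 $ 1 \<noteq> 0"
  proof
    assume V1: "V 0 $ 1 = 0"
    have "\<forall>\<^sub>F l in at_right 0. - mu (of_real l) * V (of_real l) $ 1 = of_real vp * V (of_real l) $ 3"
      using eventually_at_right_less[of 0] by eventually_elim (simp add: pos(4))
    moreover have "((\<lambda>l. - mu (of_real l) * V (of_real l) $ 1) \<longlongrightarrow> - mu 0 * V 0 $ 1) (at_right 0)"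
      by (intro tendsto_intros Vlim tendsto_at_right_conj_analytic[OF muan])
    ultimately have "((\<lambda>l. of_real vp * V (of_real l) $ 3) \<longlongrightarrow> - mu 0 * V 0 $ 1) (at_right 0)"
      by (rule Lim_transform_eventually[rotated])
    moreover have "((\<lambda>l. of_real vp * V (of_real l) $ 3) \<longlongrightarrow> of_real vp * V 0 $ 3) (at_right 0)"
      by (intro tendsto_intros Vlim)
    ultimately have "of_real vp * V 0 $ 3 = - mu 0 * V 0 $ 1"
      by (rule tendsto_unique[OF trivial_limit_at_right_real, rotated])
    then have V30: "V 0 $ 3 = 0" using V1 vp(1) by simp
    have "cmod (V 0 $ 2) \<le> (2 + (cmod (mu 0) + 0 + \<bar>f vp\<bar>) / vp) * cmod (V 0 $ 1)"
    proof (rule tendsto_le[OF trivial_limit_at_right_real])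
      show "((\<lambda>l. (2 + (cmod (mu (of_real l)) + l + \<bar>f vp\<bar>) / vp) * cmod (V (of_real l) $ 1)) \<longlongrightarrow>
          (2 + (cmod (mu 0) + 0 + \<bar>f vp\<bar>) / vp) * cmod (V 0 $ 1)) (at_right 0)"
        by (intro tendsto_intros Vlim tendsto_at_right_conj_analytic[OF muan]) (use vp(1) in auto)
      show "((\<lambda>l. cmod (V (of_real l) $ 2)) \<longlongrightarrow> cmod (V 0 $ 2)) (at_right 0)" by (intro tendsto_intros Vlim)
      show "\<forall>\<^sub>F l in at_right 0. cmod (V (of_real l) $ 2) \<le> (2 + (cmod (mu (of_real l)) + l + \<bar>f vp\<bar>) / vp) * cmod (V (of_real l) $ 1)"
        using eventually_at_right_less[of 0] by eventually_elim (rule pos(5))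
    qed
    then have "V 0 = 0" using V1 V30 by (simp add: vec_eq_iff forall_3)
    then show False using V0 by simp
  qed
  have "cmod (V 0 $ 1) \<le> cmod (D 0)"
  proof (rule tendsto_le[OF trivial_limit_at_right_real])
    show "((\<lambda>l. cmod (D (of_real l))) \<longlongrightarrow> cmod (D 0)) (at_right 0)"
      by (intro tendsto_intros tendsto_at_right_analytic[OF D])
    show "((\<lambda>l. cmod (V (of_real l) $ 1)) \<longlongrightarrow> cmod (V 0 $ 1)) (at_right 0)" by (intro tendsto_intros Vlim)
    show "\<forall>\<^sub>F l in at_right 0. cmod (V (of_real l) $ 1) \<le> cmod (D (of_real l))"
      using eventually_at_right_less[of 0] by eventually_elim (rule pos(3))
  qed
  then have D0: "D 0 \<noteq> 0" using V10 by auto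
  then show "D_in W 0 \<noteq> 0" by (simp add: D_def)
  define B where "B = 8 / c"
  define R where "R = Max {16 * K, 8 * B * K, 5 + (B * K)\<^sup>2}"
  have high: "D z \<noteq> 0" if z: "z \<in> unstable_halfplane" "R \<le> cmod z" for z
  proof
    assume Dz0: "D z = 0"
    have R: "16 * K \<le> cmod z" "8 * B * K \<le> cmod z" "5 + (B * K)\<^sup>2 \<le> cmod z"
      using z(2) by (auto simp: R_def)
    have "0 < cmod z" using R(3) zero_le_power2[of "B * K"] by linarith
    then have z0: "z \<noteq> 0" by auto
    note zz = z(1) z0
    note w = adjoint_components[OF at(3)[OF zz]]
    have Re: "0 \<le> Re z" using z(1) by (simp add: unstable_halfplane_def)
    have w3: "((\<lambda>x. cnj (W x z $ 3)) has_vector_derivative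
      - (z * cnj (W x z $ 1) + z * cnj (W x z $ 2) + (of_real (v x - k x) - z) * cnj (W x z $ 3))) (at x)" for x
      using w(3)[of x] unfolding fk .
    have lim: "((\<lambda>x. cnj (W x z $ i)) \<longlongrightarrow> 0) at_top" for i
    proof -
      have "((\<lambda>x. exp (cnj (mu z) * of_real x)) \<longlongrightarrow> 0) at_top"
      proof (rule tendsto_norm_zero_cancel)
        have "filterlim (\<lambda>x. Re (mu z) * x) at_bot at_top"
          using at(1)[OF zz] by (intro filterlim_tendsto_neg_mult_at_bot[OF tendsto_const _ filterlim_ident])
        then show "((\<lambda>x. cmod (exp (cnj (mu z) * of_real x))) \<longlongrightarrow> 0) at_top"
          by (simp add: filterlim_compose[OF exp_at_bot])
      qed
      from tendsto_mult[OF this asymp_exp_component_cnj[OF at(4)[OF zz], of i]]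
      have "((\<lambda>x. exp (cnj (mu z) * of_real x) * (exp (- cnj (mu z) * of_real x) * cnj (W x z $ i))) \<longlongrightarrow> 0) at_top"
        by simp
      moreover have "exp (cnj (mu z) * of_real x) * (exp (- cnj (mu z) * of_real x) * cnj (W x z $ i)) = cnj (W x z $ i)" for x
        by (simp add: mult.assoc[symmetric] flip: exp_add)
      ultimately show ?thesis by (simp only:)
    qed
    have v0: "0 < v x" for x using vp(1) vp(2)[of x] by linarith
    note zero = adjoint_solution_zero_if_high_frequency[OF w(1,2) w3 v0 vp(3) vd H c k(2) k(1,3) Re B_def R lim lim lim vlim disjI2[OF conjI[OF refl refl]] Dz0[unfolded Dz]]
    have "\<forall>\<^sub>F x in at_top. exp (- cnj (mu z) * of_real x) * cnj (W x z $ 3) = 0"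
      using eventually_gt_at_top[of 0] by eventually_elim (simp add: zero(3)[simplified])
    then have "((\<lambda>x. exp (- cnj (mu z) * of_real x) * cnj (W x z $ 3)) \<longlongrightarrow> 0) at_top" by (rule tendsto_eventually)
    from tendsto_unique[OF _ this asymp_exp_component_cnj[OF at(4)[OF zz]]] show False using V3[OF zz] by simp
  qed
  have "unstable_roots D - {0} = unstable_roots D" using D0 by (auto simp: unstable_roots_def)
  moreover have "even_count D (unstable_roots D - {0})"
    by (rule even_count_nonzero_roots[OF D conj_analytic_on_cnj[OF Van] V3 pos(1,2) high])
  ultimately show "even_count (D_in W) (unstable_roots (D_in W))" unfolding D_def by simp
qed

text \<open>For \<open>z > 0\<close> positivity gives \<open>|D_in| \<ge> v 0 z / (1 + z)\<close>, which excludes positive zeros and, together with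
  \<open>D_in 0 = 0\<close>, bounds the derivative at \<open>0\<close> from below by \<open>v 0\<close>.\<close>

lemma limiting_D_in_parity:
  fixes v :: "real \<Rightarrow> real"
  assumes mode: "is_adjoint_mode0 v W"
    and v: "\<And>x. (v has_real_derivative v x * (v x - 1)) (at x)" "\<And>x. 0 < v x" "\<And>x. v x < 1" "(v \<longlongrightarrow> 0) at_top"
  shows "D_in W 0 = 0" "deriv (D_in W) 0 \<noteq> 0" "even_count (D_in W) (unstable_roots (D_in W) - {0})"
proof -
  define D where "D = D_in W"
  have Wan: "vec_conj_analytic_on (W x) unstable_halfplane" for x
    using mode unfolding is_adjoint_mode0_def by blast
  have at: "solves (\<lambda>x. - conj_transpose (A_mat f_coef0 (v x) z)) (\<lambda>x. W x z)"
      "((\<lambda>x. W x z) \<longlongrightarrow> vector [0, -1, cnj z / cnj (-1 - z)]) at_top"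
    if "z \<in> unstable_halfplane" for z
    using mode that unfolding is_adjoint_mode0_def by blast+
  have D: "D analytic_on unstable_halfplane" unfolding D_def by (rule D_in_analytic[OF Wan])
  have Dz: "D z = cnj (W 0 z $ 1)" for z unfolding D_def by (rule D_in_eq)
  have lim: "((\<lambda>x. cnj (W x z $ i)) \<longlongrightarrow> cnj (vector [0, -1, cnj z / cnj (-1 - z)] $ i)) at_top"
    if "z \<in> unstable_halfplane" for z i
    by (intro tendsto_cnj tendsto_vec_nth at(2)[OF that])
  have z0: "(0::complex) \<in> unstable_halfplane" by (simp add: unstable_halfplane_def)
  note w0 = adjoint_components[OF at(1)[OF z0]]
  \<comment> \<open>At \<open>z = 0\<close> the product of \<open>v'\<close> and the third component is constant along the profile, hence zero.\<close>
  have w3: "W x 0 $ 3 = 0" for x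
  proof -
    define g where "g x = (v x * (v x - 1)) *\<^sub>R cnj (W x 0 $ 3)" for x
    have vv: "((\<lambda>x. v x * (v x - 1)) has_real_derivative (2 * v x - 1) * (v x * (v x - 1))) (at x)" for x
      by (rule DERIV_cong[OF DERIV_mult[OF v(1) DERIV_diff[OF v(1) DERIV_const]]]) (simp add: algebra_simps)
    have "(g has_vector_derivative 0) (at x within UNIV)" for x
      unfolding g_def[abs_def]
      by (rule has_vector_derivative_eq_rhs[OF has_vector_derivative_scaleR[OF vv w0(3)]])
        (simp add: f_coef0_def scaleR_conv_of_real algebra_simps)
    then obtain cc where cc: "\<And>x. g x = cc" using has_vector_derivative_zero_constant[of UNIV g] by auto
    have "(g \<longlongrightarrow> (0 * (0 - 1)) *\<^sub>R cnj ((vector [0, -1, cnj 0 / cnj (-1 - 0)] :: complex^3) $ 3)) at_top"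
      unfolding g_def by (intro tendsto_scaleR tendsto_mult tendsto_diff tendsto_const v(4) lim z0)
    then have "((\<lambda>x::real. cc) \<longlongrightarrow> 0) at_top" unfolding cc by simp
    then have "cc = 0" by (simp add: tendsto_const_iff)
    then have "g x = 0" by (simp add: cc)
    then show ?thesis using v(2)[of x] v(3)[of x] by (simp add: g_def)
  qed
  have "W 0 0 $ 1 = 0"
  proof -
    have "((\<lambda>x. cnj (W x 0 $ 1)) has_vector_derivative 0) (at x within UNIV)" for x
      using w0(1)[of x] by (simp add: w3)
    then obtain cc where cc: "\<And>x. cnj (W x 0 $ 1) = cc"
      using has_vector_derivative_zero_constant[of UNIV "\<lambda>x. cnj (W x 0 $ 1)"] by auto
    have "((\<lambda>x::real. cc) \<longlongrightarrow> 0) at_top" using lim[OF z0, of 1] unfolding cc by simp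
    then have "cc = 0" by (simp add: tendsto_const_iff)
    then show ?thesis using cc[of 0] by simp
  qed
  then have D0: "D 0 = 0" by (simp add: Dz)
  then show "D_in W 0 = 0" by (simp add: D_def)
  have pos: "Im (D (of_real l) / 1) = 0" "v 0 / (1 + l) * l \<le> cmod (D (of_real l))" "D (of_real l) \<noteq> 0"
    if l: "0 < l" for l :: real
  proof -
    have lz: "complex_of_real l \<in> unstable_halfplane" using l by simp
    have "((\<lambda>x. W x (of_real l)) \<longlongrightarrow> vector [0, -1, of_real l / (-1 - of_real l)]) at_top"
      using at(2)[OF lz] by simp
    note p = limiting_adjoint_mode_positive[OF l at(1)[OF lz] this v(1,2,4)]
    show "Im (D (of_real l) / 1) = 0" using p(1) by (simp add: Dz)
    have "l / (1 + l) * v 0 \<le> cmod (D (of_real l))" unfolding Dz complex_mod_cnj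
      using p(2) abs_Re_le_cmod[of "W 0 (of_real l) $ 1"] by linarith
    then show ge: "v 0 / (1 + l) * l \<le> cmod (D (of_real l))" by (simp add: mult.commute)
    have "0 < v 0 / (1 + l) * l" using v(2)[of 0] l by simp
    then show "D (of_real l) \<noteq> 0" using ge by auto
  qed
  show "deriv (D_in W) 0 \<noteq> 0" unfolding D_def[symmetric]
  proof (rule deriv_nonzero_if_linear_lower_bound[OF D D0 pos(2)])
    show "((\<lambda>l. v 0 / (1 + l)) \<longlongrightarrow> v 0 / (1 + 0)) (at_right 0)"
      by (intro tendsto_intros) auto
    show "0 < v 0 / (1 + 0)" using v(2)[of 0] by simp
  qed
  define c where "c = 1 - v 0"
  define B where "B = 8 / c"
  define R :: real where "R = Max {16 * 1, 8 * B * 1, 5 + (B * 1)\<^sup>2}"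
  have high: "D z \<noteq> 0" if z: "z \<in> unstable_halfplane" "R \<le> cmod z" for z
  proof
    assume Dz0: "D z = 0"
    have R: "16 * 1 \<le> cmod z" "8 * B * 1 \<le> cmod z" "5 + (B * 1)\<^sup>2 \<le> cmod z"
      using z(2) by (auto simp: R_def)
    note w = adjoint_components[OF at(1)[OF z(1)]]
    have Re: "0 \<le> Re z" using z(1) by (simp add: unstable_halfplane_def)
    define k where "k x = 1 - v x" for x
    have w3: "((\<lambda>x. cnj (W x z $ 3)) has_vector_derivative
      - (z * cnj (W x z $ 1) + z * cnj (W x z $ 2) + (of_real (v x - k x) - z) * cnj (W x z $ 3))) (at x)" for x
      using w(3)[of x] by (simp add: f_coef0_def k_def)
    have kd: "(k has_real_derivative - (v x * (v x - 1))) (at x)" for x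
      unfolding k_def[abs_def] by (rule DERIV_cong[OF DERIV_diff[OF DERIV_const v(1)]]) simp
    have kc: "c \<le> k x" if "0 \<le> x" for x
    proof -
      have "v x \<le> v 0"
      proof (rule DERIV_nonpos_imp_nonincreasing[OF that])
        fix t
        show "\<exists>y. (v has_real_derivative y) (at t) \<and> y \<le> 0"
          using v(1)[of t] v(2)[of t] v(3)[of t] by (intro exI[of _ "v t * (v t - 1)"]) (simp add: mult_nonneg_nonpos)
      qed
      then show ?thesis by (simp add: c_def k_def)
    qed
    have c0: "0 < c" using v(3)[of 0] by (simp add: c_def)
    have H: "- k x \<le> v x - 1" and k1: "k x \<le> 1" and k2: "\<bar>v x * k x - - (v x * (v x - 1))\<bar> \<le> 1" for x
      using v(2)[of x] by (simp_all add: k_def algebra_simps)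
    have l1: "((\<lambda>x. cnj (W x z $ 1)) \<longlongrightarrow> 0) at_top" using lim[OF z(1), of 1] by simp
    note zero = adjoint_solution_zero_if_high_frequency[OF w(1,2) w3 v(2) less_imp_le[OF v(3)] v(1) H c0 kc k1 kd k2 Re B_def R
        l1 lim[OF z(1), of 2] lim[OF z(1), of 3] v(4) disjI1[OF refl] Dz0[unfolded Dz]]
    have "\<forall>\<^sub>F x in at_top. cnj (W x z $ 2) = 0"
      using eventually_gt_at_top[of 0] by eventually_elim (rule zero(2))
    then have "((\<lambda>x. cnj (W x z $ 2)) \<longlongrightarrow> 0) at_top" by (rule tendsto_eventually)
    from tendsto_unique[OF _ this lim[OF z(1), of 2]] show False by simp
  qed
  show "even_count (D_in W) (unstable_roots (D_in W) - {0})" unfolding D_def[symmetric]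
    by (rule even_count_nonzero_roots[where p="\<lambda>_. 1", OF D _ _ pos(1,3) high]) auto
qed

section \<open>The limiting profile\<close>

text \<open>The difference between \<open>v\<close> and the explicit logistic solution, cleared of denominators, solves a linear
  homogeneous equation and vanishes at \<open>0\<close>.\<close>

lemma limiting_profile_eq:
  assumes "is_profile0 v0 v" and "0 < v0" "v0 < 1"
  shows "v x = v0 * exp (- x) / (1 - v0 + v0 * exp (- x))"
proof -
  have v: "\<And>x. (v has_real_derivative v x * (v x - 1)) (at x)" "v 0 = v0"
    using assms(1) by (auto simp: is_profile0_def)
  define E where "E x = v x * (1 - v0 + v0 * exp (- x)) - v0 * exp (- x)" for x
  have e: "((\<lambda>x. v0 * exp (- x)) has_real_derivative - v0 * exp (- x)) (at x)" for x
    by (auto intro!: derivative_eq_intros)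
  have "(E has_real_derivative (v x * (v x - 1)) * (1 - v0 + v0 * exp (- x)) + (0 + - v0 * exp (- x)) * v x - - v0 * exp (- x)) (at x)" for x
    unfolding E_def[abs_def] by (intro DERIV_diff DERIV_mult DERIV_add DERIV_const v e)
  moreover have "(v x * (v x - 1)) * (1 - v0 + v0 * exp (- x)) + (0 + - v0 * exp (- x)) * v x - - v0 * exp (- x) = (v x - 1) * E x" for x
    by (simp add: E_def algebra_simps)
  ultimately have "(E has_vector_derivative (v x - 1) * E x) (at x)" for x
    by (simp add: has_real_derivative_iff_has_vector_derivative)
  from bounded_linear.has_vector_derivative[OF bounded_linear_of_real this]
  have "((\<lambda>x. complex_of_real (E x)) has_vector_derivative complex_of_real (v x - 1) * complex_of_real (E x)) (at x)" for x
    by (simp only: of_real_mult)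
  moreover have "continuous_on UNIV v" using v(1) by (auto intro!: DERIV_continuous_on)
  then have "continuous_on UNIV (\<lambda>x. complex_of_real (v x - 1))" by (intro continuous_intros)
  moreover have "complex_of_real (E 0) = 0" using v(2) by (simp add: E_def)
  ultimately have "complex_of_real (E x) = 0" by (rule linear_ode_zero)
  then have "E x = 0" by simp
  moreover have "0 < 1 - v0 + v0 * exp (- x)" using assms by (simp add: add_pos_pos)
  ultimately show ?thesis by (simp add: E_def field_simps)
qed

lemma limiting_profile_props:
  assumes p: "is_profile0 v0 v" and v0: "0 < v0" "v0 < 1"
  shows "(v has_real_derivative v x * (v x - 1)) (at x)" "v 0 = v0" "0 < v x" "v x < 1" "(v \<longlongrightarrow> 0) at_top"
    "x \<le> y \<Longrightarrow> v y \<le> v x"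
proof -
  show d: "(v has_real_derivative v x * (v x - 1)) (at x)" for x using p by (auto simp: is_profile0_def)
  show "v 0 = v0" using p by (auto simp: is_profile0_def)
  have pos: "0 < 1 - v0 + v0 * exp (- x)" for x :: real using v0 by (simp add: add_pos_pos)
  show b: "0 < v x" "v x < 1" for x
    using pos[of x] v0 unfolding limiting_profile_eq[OF p v0] by (simp_all add: field_simps)
  have "((\<lambda>x. v0 * exp (- x) / (1 - v0 + v0 * exp (- x))) \<longlongrightarrow> v0 * 0 / (1 - v0 + v0 * 0)) at_top"
    by (intro tendsto_intros filterlim_compose[OF exp_at_bot] filterlim_uminus_at_bot_at_top) (use v0 in auto)
  then have lim0: "((\<lambda>x. v0 * exp (- x) / (1 - v0 + v0 * exp (- x))) \<longlongrightarrow> 0) at_top" by simp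
  have eq: "v = (\<lambda>x. v0 * exp (- x) / (1 - v0 + v0 * exp (- x)))"
    by (rule ext) (rule limiting_profile_eq[OF p v0])
  show "(v \<longlongrightarrow> 0) at_top" unfolding eq by (rule lim0)
  show "v y \<le> v x" if "x \<le> y"
  proof (rule DERIV_nonpos_imp_nonincreasing[OF that])
    fix t
    show "\<exists>y. (v has_real_derivative y) (at t) \<and> y \<le> 0"
      using d[of t] b[of t] by (intro exI[of _ "v t * (v t - 1)"]) (simp add: mult_nonneg_nonpos)
  qed
qed

lemma norm_le_if_derivative_le:
  fixes f :: "real \<Rightarrow> complex" and h :: "real \<Rightarrow> real"
  assumes f: "\<And>x. 0 \<le> x \<Longrightarrow> (f has_vector_derivative f' x) (at x)"
    and h: "\<And>x. 0 \<le> x \<Longrightarrow> (h has_real_derivative - h' x) (at x)"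
    and le: "\<And>x. 0 \<le> x \<Longrightarrow> cmod (f' x) \<le> h' x"
    and lim: "(f \<longlongrightarrow> 0) at_top" "(h \<longlongrightarrow> 0) at_top" and "0 \<le> x"
  shows "cmod (f x) \<le> h x"
proof -
  have "\<forall>\<^sub>F b in at_top. cmod (f b - f x) \<le> h x - h b"
    using eventually_gt_at_top[of x]
  proof eventually_elim
    case (elim b)
    have "cmod (f b - f x) \<le> - h b - - h x"
    proof (rule differentiable_bound_general[OF elim])
      show "continuous_on {x..b} f"
        using \<open>0 \<le> x\<close> by (intro continuous_at_imp_continuous_on ballI has_vector_derivative_continuous[OF f]) auto
      show "continuous_on {x..b} (\<lambda>x. - h x)"
        using \<open>0 \<le> x\<close> by (intro continuous_on_minus continuous_at_imp_continuous_on ballI DERIV_isCont[OF h]) auto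
      fix t assume "x < t"
      then show "(f has_vector_derivative f' t) (at t)" "cmod (f' t) \<le> h' t"
        using f le \<open>0 \<le> x\<close> by auto
      show "((\<lambda>x. - h x) has_vector_derivative h' t) (at t)"
        using DERIV_minus[OF h[of t]] \<open>x < t\<close> \<open>0 \<le> x\<close> by (simp add: has_real_derivative_iff_has_vector_derivative)
    qed
    then show ?case by simp
  qed
  moreover have "((\<lambda>b. cmod (f b - f x)) \<longlongrightarrow> cmod (0 - f x)) at_top" by (intro tendsto_intros lim)
  moreover have "((\<lambda>b. h x - h b) \<longlongrightarrow> h x - 0) at_top" by (intro tendsto_intros lim)
  ultimately have "cmod (0 - f x) \<le> h x - 0" by (intro tendsto_le[OF trivial_limit_at_top_linorder]) auto
  then show ?thesis by simp
qed

text \<open>The first component of the mode is driven by \<open>v\<close> alone, so it is of the order of \<open>v 0 = u\<close>, provided the third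
  component is bounded independently of \<open>u\<close>. The latter bound comes from the maximum principle: at an interior maximum
  of \<open>|w3|\<close> the unstable term \<open>(1 + z) w3\<close> is balanced by \<open>z (w1 + w2)\<close>. The decaying function
  \<open>Y = v / (1 - v)\<close> satisfies \<open>Y' = - Y\<close> and majorizes \<open>v\<close>.\<close>

lemma limiting_D_in_bound:
  assumes p: "is_profile0 u v" and mode: "is_adjoint_mode0 v W" and u: "0 < u" "u \<le> 1/4" and z: "0 \<le> Re z"
    and small: "2 * cmod z * (2 + cmod z) * (u / (1 - u)) \<le> 1/2"
  shows "cmod (D_in W z) \<le> (4 * cmod z + 1) * (u / (1 - u))"
proof -
  have u1: "u < 1" using u by simp
  note v = limiting_profile_props[OF p u(1) u1]
  have zH: "z \<in> unstable_halfplane" using z by (simp add: unstable_halfplane_def)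
  define L where "L = cmod z"
  have L0: "0 \<le> L" by (simp add: L_def)
  have at: "solves (\<lambda>x. - conj_transpose (A_mat f_coef0 (v x) z)) (\<lambda>x. W x z)"
      "((\<lambda>x. W x z) \<longlongrightarrow> vector [0, -1, cnj z / cnj (-1 - z)]) at_top"
    using mode zH unfolding is_adjoint_mode0_def by blast+
  define w1 w2 w3 where "w1 x = cnj (W x z $ 1)" and "w2 x = cnj (W x z $ 2)" and "w3 x = cnj (W x z $ 3)" for x
  note w = adjoint_components[OF at(1), folded w1_def w2_def w3_def]
  have lim: "((\<lambda>x. cnj (W x z $ i)) \<longlongrightarrow> cnj ((vector [0, -1, cnj z / cnj (-1 - z)] :: complex^3) $ i)) at_top" for i
    by (intro tendsto_cnj tendsto_vec_nth at(2))
  define l3 where "l3 = z / (-1 - z)"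
  have lim1: "(w1 \<longlongrightarrow> 0) at_top" using lim[of 1] by (simp add: w1_def[abs_def])
  have lim2: "(w2 \<longlongrightarrow> - 1) at_top" using lim[of 2] by (simp add: w2_def[abs_def])
  have lim3: "(w3 \<longlongrightarrow> l3) at_top" using lim[of 3] by (simp add: w3_def[abs_def] l3_def)
  have l3: "cmod l3 \<le> 1"
  proof -
    have "(cmod z)\<^sup>2 \<le> (cmod (1 + z))\<^sup>2" unfolding cmod_power2 using z by (simp add: power2_eq_square algebra_simps)
    then have "cmod z \<le> cmod (1 + z)" by (rule power2_le_imp_le) simp
    also have "\<dots> = cmod (-1 - z)" by (metis norm_minus_cancel minus_add_distrib uminus_add_conv_diff diff_conv_add_uminus)
    finally show ?thesis unfolding l3_def norm_divide by (simp add: divide_le_eq_1)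
  qed
  define Y where "Y x = v x / (1 - v x)" for x
  have v1: "1 - v x \<noteq> 0" for x using v(4)[of x] by simp
  have Yd: "(Y has_real_derivative - Y x) (at x)" for x
  proof -
    have "(Y has_real_derivative (v x * (v x - 1) * (1 - v x) - v x * (0 - v x * (v x - 1))) / ((1 - v x) * (1 - v x))) (at x)"
      unfolding Y_def[abs_def] by (intro DERIV_divide DERIV_diff DERIV_const v(1) v1)
    moreover have "(v x * (v x - 1) * (1 - v x) - v x * (0 - v x * (v x - 1))) / ((1 - v x) * (1 - v x)) = - Y x"
      unfolding Y_def using v1[of x] by (simp add: divide_simps) (simp add: algebra_simps)
    ultimately show ?thesis by simp
  qed
  have vY: "v x \<le> Y x" and Ypos: "0 < Y x" for x
    using v(3)[of x] v(4)[of x] unfolding Y_def by (simp_all add: field_simps)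
  have "(Y \<longlongrightarrow> 0 / (1 - 0)) at_top" unfolding Y_def by (intro tendsto_intros v(5)) auto
  then have Ylim: "(Y \<longlongrightarrow> 0) at_top" by simp
  define y where "y = u / (1 - u)"
  have Y0: "Y 0 = y" using v(2) by (simp add: Y_def y_def)
  have Yy: "Y x \<le> y" if "0 \<le> x" for x
    unfolding Y0[symmetric]
  proof (rule DERIV_nonpos_imp_nonincreasing[OF that])
    fix t
    show "\<exists>d. (Y has_real_derivative d) (at t) \<and> d \<le> 0"
      using Yd[of t] Ypos[of t] by (intro exI[of _ "- Y t"]) simp
  qed
  define g where "g x = (cmod (w3 x))\<^sup>2" for x
  define g' where "g' x = 2 * Re (- (z * w1 x + z * w2 x + (of_real (f_coef0 (v x)) - z) * w3 x) * cnj (w3 x))" for x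
  have gd: "(g has_real_derivative g' x) (at x)" for x
    unfolding g_def[abs_def] g'_def by (rule has_real_derivative_cmod_sq[OF w(3)])
  have "(g \<longlongrightarrow> (cmod l3)\<^sup>2) at_top" unfolding g_def by (intro tendsto_intros lim3)
  note max = bounded_by_limit_or_maximum[OF gd this]
  obtain C where C: "\<And>x. 0 \<le> x \<Longrightarrow> cmod (w3 x) \<le> C"
    and C': "C \<le> 1 \<or> (\<exists>m\<ge>0. C \<le> 2 * L * (cmod (w1 m) + cmod (w2 m)))"
    using max
  proof
    assume "\<forall>x\<ge>0. g x \<le> (cmod l3)\<^sup>2"
    then have "\<And>x. 0 \<le> x \<Longrightarrow> cmod (w3 x) \<le> cmod l3"
      unfolding g_def by (metis norm_ge_zero power2_le_imp_le)
    then show ?thesis using l3 by (intro that[of 1]) (auto intro: order_trans)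
  next
    assume "\<exists>m\<ge>0. (\<forall>x\<ge>0. g x \<le> g m) \<and> g' m \<le> 0"
    then obtain m where m: "0 \<le> m" "\<And>x. 0 \<le> x \<Longrightarrow> g x \<le> g m" "g' m \<le> 0" by blast
    define Q where "Q = cmod (w3 m)"
    have "Q \<le> 2 * L * (cmod (w1 m) + cmod (w2 m))"
    proof (cases "Q = 0")
      case False
      then have Q0: "0 < Q" by (simp add: Q_def)
      have "g' m = 2 * (Re ((1 + z - 2 * v m) * (w3 m * cnj (w3 m))) - Re (z * (w1 m + w2 m) * cnj (w3 m)))"
        unfolding g'_def f_coef0_def by (simp add: algebra_simps)
      moreover have "Re ((1 + z - 2 * v m) * (w3 m * cnj (w3 m))) = (1 + Re z - 2 * v m) * Q\<^sup>2"
        unfolding Re_mult_cnj_same Q_def by simp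
      moreover have "r = 2 * (p - q) \<Longrightarrow> p = p' \<Longrightarrow> r \<le> 0 \<Longrightarrow> p' \<le> q" for p q r p' :: real by simp
      ultimately have "(1 + Re z - 2 * v m) * Q\<^sup>2 \<le> Re (z * (w1 m + w2 m) * cnj (w3 m))" using m(3) by blast
      also have "\<dots> \<le> cmod (z * (w1 m + w2 m)) * Q" unfolding Q_def using Re_mult_cnj_bound[of "z * (w1 m + w2 m)" "w3 m"] by linarith
      also have "\<dots> \<le> L * (cmod (w1 m) + cmod (w2 m)) * Q"
        unfolding norm_mult L_def using Q0 by (intro mult_right_mono mult_left_mono norm_triangle_ineq) auto
      finally have "(1 + Re z - 2 * v m) * Q\<^sup>2 \<le> L * (cmod (w1 m) + cmod (w2 m)) * Q" .
      moreover have "v m \<le> 1/4" using v(6)[OF m(1)] v(2) u(2) by simp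
      then have "1/2 * Q\<^sup>2 \<le> (1 + Re z - 2 * v m) * Q\<^sup>2" using z by (intro mult_right_mono) auto
      ultimately have "1/2 * Q * Q \<le> L * (cmod (w1 m) + cmod (w2 m)) * Q" by (simp add: power2_eq_square)
      then have "1/2 * Q \<le> L * (cmod (w1 m) + cmod (w2 m))" using Q0 by (rule mult_right_le_imp_le)
      then show ?thesis by simp
    qed (use L0 in simp)
    moreover have "cmod (w3 x) \<le> Q" if "0 \<le> x" for x
      using m(2)[OF that] unfolding g_def Q_def by (rule power2_le_imp_le) simp
    ultimately show ?thesis using m(1) by (intro that[of Q]) auto
  qed
  have C0: "0 \<le> C" using C[of 0] norm_ge_zero order_trans by blast
  have Cd: "((\<lambda>x. c * Y x) has_real_derivative - (c * Y x)) (at x)" for c x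
    using DERIV_cmult[OF Yd, of c x] by simp
  have Clim: "((\<lambda>x. c * Y x) \<longlongrightarrow> 0) at_top" for c
    using tendsto_mult_left[OF Ylim, of c] by simp
  have w1b: "cmod (w1 x) \<le> C * Y x" if "0 \<le> x" for x
  proof (rule norm_le_if_derivative_le[OF w(1) Cd _ lim1 Clim that])
    fix t :: real assume "0 \<le> t"
    then have "v t * cmod (w3 t) \<le> Y t * C" using vY[of t] C[of t] Ypos[of t] by (intro mult_mono) auto
    then show "cmod (- (complex_of_real (v t) * w3 t)) \<le> C * Y t"
      using v(3)[of t] by (simp add: norm_mult mult.commute)
  qed
  have w21: "cmod (w2 x - w1 x + 1) \<le> (L * C) * Y x" if "0 \<le> x" for x
  proof (rule norm_le_if_derivative_le[OF _ Cd _ _ Clim that])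
    show "((\<lambda>x. w2 x - w1 x + 1) has_vector_derivative - (z * w1 t)) (at t)" for t
      by (rule has_vector_derivative_eq_rhs[OF has_vector_derivative_add[OF has_vector_derivative_diff[OF w(2,1)] has_vector_derivative_const]])
        (simp add: algebra_simps)
    show "cmod (- (z * w1 t)) \<le> L * C * Y t" if "0 \<le> t" for t
      using mult_left_mono[OF w1b[OF that] L0] by (simp add: norm_mult L_def mult.assoc)
    have "((\<lambda>x. w2 x - w1 x + 1) \<longlongrightarrow> - 1 - 0 + 1) at_top" by (intro tendsto_intros lim1 lim2)
    then show "((\<lambda>x. w2 x - w1 x + 1) \<longlongrightarrow> 0) at_top" by simp
  qed
  have sum: "cmod (w1 x) + cmod (w2 x) \<le> 1 + (2 + L) * C * y" if x: "0 \<le> x" for x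
  proof -
    have "w2 x = (w2 x - w1 x + 1) + w1 x - 1" by simp
    then have "cmod (w2 x) \<le> cmod (w2 x - w1 x + 1) + cmod (w1 x) + 1"
      by (metis norm_one norm_triangle_ineq norm_triangle_ineq4 add_right_mono order_trans)
    also have "\<dots> \<le> (L * C) * Y x + C * Y x + 1" using w21[OF x] w1b[OF x] by simp
    finally have "cmod (w1 x) + cmod (w2 x) \<le> 1 + (2 + L) * C * Y x" using w1b[OF x] by (simp add: algebra_simps)
    also have "\<dots> \<le> 1 + (2 + L) * C * y" using Yy[OF x] L0 C0 by (intro add_left_mono mult_left_mono) auto
    finally show ?thesis .
  qed
  have "C \<le> 4 * L + 1"
    using C'
  proof
    assume "\<exists>m\<ge>0. C \<le> 2 * L * (cmod (w1 m) + cmod (w2 m))"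
    then obtain m where "0 \<le> m" "C \<le> 2 * L * (cmod (w1 m) + cmod (w2 m))" by blast
    moreover have "2 * L * (cmod (w1 m) + cmod (w2 m)) \<le> 2 * L * (1 + (2 + L) * C * y)"
      using sum[OF \<open>0 \<le> m\<close>] L0 by (intro mult_left_mono) auto
    moreover have "2 * L * (1 + (2 + L) * C * y) = 2 * L + (2 * L * (2 + L) * y) * C" by (simp add: algebra_simps)
    moreover have "(2 * L * (2 + L) * y) * C \<le> 1/2 * C"
      using small C0 unfolding y_def L_def by (intro mult_right_mono) auto
    ultimately show ?thesis by linarith
  qed (use L0 in simp)
  then have "C * y \<le> (4 * L + 1) * y" using Ypos[of 0] unfolding Y0 by (intro mult_right_mono) auto
  then have "cmod (w1 0) \<le> (4 * L + 1) * y" using w1b[of 0] unfolding Y0 by simp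
  then show ?thesis unfolding D_in_eq w1_def L_def y_def .
qed

lemma limiting_D_in_tendsto_zero:
  assumes profile: "\<And>u. 0 < u \<Longrightarrow> u < 1 \<Longrightarrow> is_profile0 u (v u)"
    and mode: "\<And>u. 0 < u \<Longrightarrow> u < 1 \<Longrightarrow> is_adjoint_mode0 (v u) (W u)" and z: "0 \<le> Re z"
  shows "((\<lambda>u. D_in (W u) z) \<longlongrightarrow> 0) (at_right 0)"
proof (rule Lim_null_comparison)
  have id: "((\<lambda>u::real. u) \<longlongrightarrow> 0) (at_right 0)" by (rule tendsto_ident_at)
  have "((\<lambda>u::real. (4 * cmod z + 1) * (u / (1 - u))) \<longlongrightarrow> (4 * cmod z + 1) * (0 / (1 - 0))) (at_right 0)"
    by (intro tendsto_intros id) auto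
  then show "((\<lambda>u::real. (4 * cmod z + 1) * (u / (1 - u))) \<longlongrightarrow> 0) (at_right 0)" by simp
  have "((\<lambda>u::real. 2 * cmod z * (2 + cmod z) * (u / (1 - u))) \<longlongrightarrow> 2 * cmod z * (2 + cmod z) * (0 / (1 - 0))) (at_right 0)"
    by (intro tendsto_intros id) auto
  then have "\<forall>\<^sub>F u in at_right (0::real). 2 * cmod z * (2 + cmod z) * (u / (1 - u)) < 1/2"
    by (rule order_tendstoD(2)) simp
  moreover have "\<forall>\<^sub>F u in at_right (0::real). u < 1/4" by (rule order_tendstoD(2)[OF id]) simp
  ultimately show "\<forall>\<^sub>F u in at_right 0. norm (D_in (W u) z) \<le> (4 * cmod z + 1) * (u / (1 - u))"
    using eventually_at_right_less[of 0]
  proof eventually_elim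
    case (elim u)
    then show ?case
      using profile[of u] mode[of u] z by (intro limiting_D_in_bound[where v="v u"]) auto
  qed
qed

section \<open>The viscous profile\<close>

lemma a_par_pos:
  assumes "\<gamma> \<ge> 1" "0 < vp" "vp < 1"
  shows "0 < a_par \<gamma> vp"
proof -
  have "vp powr \<gamma> < 1" using assms powr_less_mono2[of \<gamma> vp 1] by simp
  then show ?thesis using assms unfolding a_par_def by (intro mult_pos_pos divide_pos_pos) auto
qed

lemma f_coef_mono:
  assumes "\<gamma> \<ge> 1" "0 < vp" "vp < 1" "0 < x" "x \<le> y"
  shows "f_coef \<gamma> vp x \<le> f_coef \<gamma> vp y"
proof -
  have "y powr - \<gamma> \<le> x powr - \<gamma>" using assms by (intro powr_mono2') auto
  then have "a_par \<gamma> vp * (\<gamma> - 1) * y powr - \<gamma> \<le> a_par \<gamma> vp * (\<gamma> - 1) * x powr - \<gamma>"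
    using a_par_pos[OF assms(1-3)] assms(1) by (intro mult_left_mono) auto
  then show ?thesis using assms(5) by (simp add: f_coef_def)
qed

text \<open>The right-hand side of the profile equation divided by \<open>v\<close> vanishes at the end states \<open>vp\<close> and \<open>1\<close> and is
  strictly convex in between, hence negative there.\<close>

lemma profile_slope_negative:
  assumes "\<gamma> \<ge> 1" "0 < vp" "vp < y" "y < 1"
  shows "y - 1 + a_par \<gamma> vp * (y powr - \<gamma> - 1) < 0"
proof (rule ccontr)
  define a where "a = a_par \<gamma> vp"
  define h where "h y = y - 1 + a * (y powr - \<gamma> - 1)" for y
  define h' where "h' y = 1 + a * (- \<gamma> * y powr (- \<gamma> - 1))" for y
  assume "\<not> y - 1 + a_par \<gamma> vp * (y powr - \<gamma> - 1) < 0"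
  then have hy: "0 \<le> h y" by (simp add: h_def a_def)
  have vp1: "vp < 1" using assms by simp
  have a0: "0 < a" unfolding a_def by (rule a_par_pos[OF assms(1,2) vp1])
  have d: "(h has_real_derivative h' t) (at t)" if "0 < t" for t
    unfolding h_def[abs_def] h'_def using that
    by (auto intro!: derivative_eq_intros)
  have "vp powr \<gamma> < 1" using assms vp1 powr_less_mono2[of \<gamma> vp 1] by simp
  then have hvp: "h vp = 0" using assms(2) unfolding h_def a_def a_par_def by (simp add: powr_minus field_simps)
  have h1: "h 1 = 0" by (simp add: h_def)
  obtain s where s: "vp < s" "s < y" "h y - h vp = (y - vp) * h' s"
    using MVT2[OF assms(3), of h h'] d assms(2) by force
  obtain t where t: "y < t" "t < 1" "h 1 - h y = (1 - y) * h' t"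
    using MVT2[OF assms(4), of h h'] d assms(2,3) by force
  have "0 \<le> h' s" using s hy hvp assms(3) by (simp add: zero_le_mult_iff)
  have "h' t \<le> 0" using t hy h1 assms(4) by (smt (verit) zero_less_mult_iff)
  moreover have "t powr (- \<gamma> - 1) < s powr (- \<gamma> - 1)"
    using assms s t by (intro powr_less_mono2_neg) auto
  then have "a * \<gamma> * t powr (- \<gamma> - 1) < a * \<gamma> * s powr (- \<gamma> - 1)"
    using a0 assms(1) by (intro mult_strict_left_mono) auto
  then have "h' s < h' t" by (simp add: h'_def)
  ultimately show False using \<open>0 \<le> h' s\<close> by simp
qed

lemma bounded_on_profile_range:
  fixes g :: "real \<Rightarrow> real"
  assumes "continuous_on {vp..1} g"
  obtains K where "\<And>y. vp \<le> y \<Longrightarrow> y \<le> 1 \<Longrightarrow> \<bar>g y\<bar> \<le> K"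
proof -
  have "bounded (g ` {vp..1})" by (intro compact_imp_bounded compact_continuous_image assms compact_Icc)
  then obtain K where "\<forall>y\<in>{vp..1}. \<bar>g y\<bar> \<le> K" unfolding bounded_iff by auto
  then show thesis by (intro that[of K]) simp
qed

lemma profile_range:
  assumes "is_profile \<gamma> vp v0 v"
  shows "vp \<le> v x" "v x \<le> 1"
proof -
  have anti: "antimono v" and lim: "(v \<longlongrightarrow> 1) at_bot" "(v \<longlongrightarrow> vp) at_top"
    using assms by (auto simp: is_profile_def)
  show "vp \<le> v x"
    by (rule tendsto_upperbound[OF lim(2) eventually_mono[OF eventually_ge_at_top[of x]]])
      (use antimonoD[OF anti] in auto)
  show "v x \<le> 1"
    by (rule tendsto_lowerbound[OF lim(1) eventually_mono[OF eventually_le_at_bot[of x]]])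
      (use antimonoD[OF anti] in auto)
qed

text \<open>The data needed above, with \<open>k = v - f\<close> and \<open>H = v' / v\<close>. Both are functions of \<open>v\<close> alone, which gives the bounds
  by compactness of the range of \<open>v\<close>; the inequality \<open>- k \<le> H\<close> holds because \<open>H + k = a \<gamma> v powr (- \<gamma>)\<close>.\<close>

lemma profile_coefficients:
  fixes \<gamma> vp v0 :: real
  assumes par: "\<gamma> \<ge> 1" "0 < vp" "vp < v0" "v0 < 1" and p: "is_profile \<gamma> vp v0 v"
  obtains k kd vd H K where
    "\<And>x. f_coef \<gamma> vp (v x) = v x - k x" "\<And>x. (v has_real_derivative v x * H x) (at x)"
    "v 0 * H 0 < 0" "\<bar>v 0 * H 0\<bar> \<le> K" "\<And>x. - k x \<le> H x" "\<And>x. (k has_real_derivative kd x) (at x)"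
    "\<And>x. a_par \<gamma> vp \<le> k x" "\<And>x. \<bar>k x\<bar> \<le> K" "\<And>x. \<bar>kd x\<bar> \<le> K" "\<And>x. \<bar>v x * k x - kd x\<bar> \<le> K" "1 \<le> K"
proof -
  define a where "a = a_par \<gamma> vp"
  have a0: "0 < a" unfolding a_def using par by (intro a_par_pos) auto
  define F where "F y = y - 1 + a * (y powr - \<gamma> - 1)" for y
  define \<kappa> where "\<kappa> y = a * (\<gamma> - 1) * y powr - \<gamma> + a + 1 - y" for y
  define \<kappa>' where "\<kappa>' y = (a * (\<gamma> - 1) * (- \<gamma> * y powr (- \<gamma> - 1)) - 1) * (y * F y)" for y
  have r: "vp \<le> v x" "v x \<le> 1" for x using profile_range[OF p] by auto
  have rp: "0 < v x" for x using r(1)[of x] par(2) by linarith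
  have cF: "continuous_on {vp..1} F" and c\<kappa>: "continuous_on {vp..1} \<kappa>" and c\<kappa>': "continuous_on {vp..1} \<kappa>'"
    unfolding F_def \<kappa>_def \<kappa>'_def using par(2) by (auto intro!: continuous_intros)
  obtain K1 where K1: "\<And>y. vp \<le> y \<Longrightarrow> y \<le> 1 \<Longrightarrow> \<bar>y * F y\<bar> \<le> K1"
    using bounded_on_profile_range[OF continuous_on_mult[OF continuous_on_id cF]] by auto
  obtain K2 where K2: "\<And>y. vp \<le> y \<Longrightarrow> y \<le> 1 \<Longrightarrow> \<bar>\<kappa> y\<bar> \<le> K2" using bounded_on_profile_range[OF c\<kappa>] by auto
  obtain K3 where K3: "\<And>y. vp \<le> y \<Longrightarrow> y \<le> 1 \<Longrightarrow> \<bar>\<kappa>' y\<bar> \<le> K3" using bounded_on_profile_range[OF c\<kappa>'] by auto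
  obtain K4 where K4: "\<And>y. vp \<le> y \<Longrightarrow> y \<le> 1 \<Longrightarrow> \<bar>y * \<kappa> y - \<kappa>' y\<bar> \<le> K4"
    using bounded_on_profile_range[OF continuous_on_diff[OF continuous_on_mult[OF continuous_on_id c\<kappa>] c\<kappa>']] by auto
  define K where "K = Max {1, K1, K2, K3, K4}"
  have K: "1 \<le> K" "K1 \<le> K" "K2 \<le> K" "K3 \<le> K" "K4 \<le> K" by (auto simp: K_def)
  have vd: "(v has_real_derivative v x * F (v x)) (at x)" for x
    using p unfolding is_profile_def F_def a_def by auto
  show thesis
  proof (rule that[of "\<lambda>x. \<kappa> (v x)" "\<lambda>x. F (v x)" K "\<lambda>x. \<kappa>' (v x)"])
    have v00: "v 0 = v0" using p by (simp add: is_profile_def)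
    show "f_coef \<gamma> vp (v x) = v x - \<kappa> (v x)" for x by (simp add: f_coef_def \<kappa>_def a_def)
    show "(v has_real_derivative v x * F (v x)) (at x)" for x by (rule vd)
    have "F v0 < 0" unfolding F_def a_def by (rule profile_slope_negative[OF par])
    then show "v 0 * F (v 0) < 0" unfolding v00 using par by (intro mult_pos_neg) auto
    show "\<bar>v 0 * F (v 0)\<bar> \<le> K" using K1[OF r] K(2) order_trans by blast
    show "- \<kappa> (v x) \<le> F (v x)" for x
    proof -
      have "F (v x) + \<kappa> (v x) = a * \<gamma> * v x powr - \<gamma>" by (simp add: F_def \<kappa>_def algebra_simps)
      also have "\<dots> \<ge> 0" using a0 par(1) by simp
      finally show ?thesis by linarith
    qed
    show "((\<lambda>x. \<kappa> (v x)) has_real_derivative \<kappa>' (v x)) (at x)" for x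
    proof -
      have "(\<kappa> has_real_derivative a * (\<gamma> - 1) * (- \<gamma> * v x powr (- \<gamma> - 1)) - 1) (at (v x))"
        unfolding \<kappa>_def[abs_def] using rp[of x] by (auto intro!: derivative_eq_intros)
      from DERIV_chain2[OF this vd] show ?thesis by (simp add: \<kappa>'_def)
    qed
    show "a_par \<gamma> vp \<le> \<kappa> (v x)" for x
    proof -
      have "0 \<le> a * (\<gamma> - 1) * v x powr - \<gamma>" using a0 par(1) by simp
      then show ?thesis using r(2)[of x] by (simp add: \<kappa>_def a_def)
    qed
    show "\<bar>\<kappa> (v x)\<bar> \<le> K" "\<bar>\<kappa>' (v x)\<bar> \<le> K" "\<bar>v x * \<kappa> (v x) - \<kappa>' (v x)\<bar> \<le> K" for x
      using K2[OF r] K3[OF r] K4[OF r] K order_trans by blast+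
  qed (rule K(1))
qed

section \<open>The four determinants\<close>

text \<open>For the limiting profile the end state at \<open>-\<infinity>\<close> has the characteristic polynomial
  \<open>(\<mu> + z) (z - \<mu>\<^sup>2 + \<mu>)\<close>, whose unstable root has real part at least \<open>1\<close>.\<close>

lemma limiting_growth_rate:
  assumes eig: "is_eigenpair (A_mat f_coef0 1 z) mu V" and "0 < Re mu" "0 \<le> Re z"
  shows "1/2 < Re mu"
proof -
  have "mu \<noteq> 0" using assms(2) by auto
  note ev = growing_eigenpair_components[OF eig this]
  have "mu ^ 3 = 1 * (z\<^sup>2 + 2 * z * mu) + (1 - z) * mu\<^sup>2"
    by (rule growing_characteristic[OF ev(1,2) _ ev(4)]) (use ev(3) in \<open>simp add: f_coef0_def\<close>)
  then have "(mu + z) * (z - mu\<^sup>2 + mu) = 0"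
    by (simp add: power2_eq_square power3_eq_cube algebra_simps)
  moreover have "Re (mu + z) \<noteq> 0" using assms by simp
  then have "mu + z \<noteq> 0" by (metis zero_complex.sel(1))
  ultimately have "z - mu\<^sup>2 + mu = 0" by simp
  then have "(z - mu\<^sup>2 + mu) + (mu\<^sup>2 - mu) = mu\<^sup>2 - mu" by simp
  then have "z = mu\<^sup>2 - mu" by simp
  then have "Re z = (Re mu)\<^sup>2 - (Im mu)\<^sup>2 - Re mu" by (simp add: power2_eq_square)
  then have "0 \<le> (Re mu)\<^sup>2 - Re mu" using assms(3) zero_le_power2[of "Im mu"] by linarith
  then have "0 \<le> Re mu * (Re mu - 1)" by (simp add: power2_eq_square algebra_simps)
  then have "1 \<le> Re mu" using assms(2) by (simp add: zero_le_mult_iff)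
  then show ?thesis by simp
qed

theorem lemma3p5:
  fixes \<gamma> vp v0 :: real
    and v :: "real \<Rightarrow> real"
    and mut :: "complex \<Rightarrow> complex" and Vt :: "complex \<Rightarrow> complex^3"
    and Wt :: "real \<Rightarrow> complex \<Rightarrow> complex^3"
    and mu :: "complex \<Rightarrow> complex" and V :: "complex \<Rightarrow> complex^3"
    and W :: "real \<Rightarrow> complex \<Rightarrow> complex^3"
    and vlim :: "real \<Rightarrow> real \<Rightarrow> real"
    and Wtlim :: "real \<Rightarrow> real \<Rightarrow> complex \<Rightarrow> complex^3"
    and mulim :: "complex \<Rightarrow> complex" and Vlim :: "complex \<Rightarrow> complex^3"
    and Wlim :: "real \<Rightarrow> complex \<Rightarrow> complex^3"
  assumes "\<gamma> \<ge> 1" and "0 < vp" and "vp < v0" and "v0 < 1"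
    and "is_profile \<gamma> vp v0 v"
    and "is_adjoint_mode (f_coef \<gamma> vp) vp v mut Vt Wt"
    and "is_growing_mode (f_coef \<gamma> vp) v mu V W"
    and "\<And>u. 0 < u \<Longrightarrow> u < 1 \<Longrightarrow> is_profile0 u (vlim u)"
    and "\<And>u. 0 < u \<Longrightarrow> u < 1 \<Longrightarrow> is_adjoint_mode0 (vlim u) (Wtlim u)"
    and "is_growing_mode f_coef0 (vlim v0) mulim Vlim Wlim"
  shows
    "(D_in Wt 0 \<noteq> 0 \<and> even_count (D_in Wt) (unstable_roots (D_in Wt))) \<and>
     (D_in (Wtlim v0) 0 = 0 \<and>
      (\<forall>z. Re z \<ge> 0 \<longrightarrow> ((\<lambda>u. D_in (Wtlim u) z) \<longlongrightarrow> 0) (at_right 0))) \<and>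
     (deriv (D_in (Wtlim v0)) 0 \<noteq> 0 \<and> deriv (D_out v W) 0 \<noteq> 0 \<and>
      deriv (D_out (vlim v0) Wlim) 0 \<noteq> 0 \<and>
      even_count (D_in (Wtlim v0)) (unstable_roots (D_in (Wtlim v0)) - {0}) \<and>
      even_count (D_out v W) (unstable_roots (D_out v W) - {0}) \<and>
      even_count (D_out (vlim v0) Wlim) (unstable_roots (D_out (vlim v0) Wlim) - {0}))"
proof -
  \<comment> \<open>For the viscous profile \<open>k\<close> is bounded below and the weight exponent \<open>\<theta> = 0\<close> suffices; for the limiting profile
    \<open>k = 1 - v\<close> tends to zero at \<open>-\<infinity>\<close>, and \<open>\<theta> = 1/2\<close> is below the growth rate of the mode.\<close>
  note par = assms(1-4)
  have v0: "0 < v0" "vp < 1" using par by auto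
  obtain k kd H K where
    fk: "\<And>x. f_coef \<gamma> vp (v x) = v x - k x" and vd: "\<And>x. (v has_real_derivative v x * H x) (at x)"
    and b: "v 0 * H 0 < 0" "\<bar>v 0 * H 0\<bar> \<le> K" and H: "\<And>x. - k x \<le> H x"
    and kd: "\<And>x. (k has_real_derivative kd x) (at x)" and ka: "\<And>x. a_par \<gamma> vp \<le> k x"
    and K: "\<And>x. \<bar>k x\<bar> \<le> K" "\<And>x. \<bar>kd x\<bar> \<le> K" "\<And>x. \<bar>v x * k x - kd x\<bar> \<le> K" "1 \<le> K"
    using profile_coefficients[OF par assms(5)] by metis
  have a0: "0 < a_par \<gamma> vp" by (rule a_par_pos[OF par(1,2) v0(2)])
  note r = profile_range[OF assms(5)]
  have vpos: "0 < v x" for x using r(1)[of x] par(2) by linarith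
  have vlimit: "(v \<longlongrightarrow> vp) at_top" using assms(5) by (simp add: is_profile_def)
  have fmono: "f_coef \<gamma> vp vp \<le> f_coef \<gamma> vp (v x)" for x by (rule f_coef_mono[OF par(1,2) v0(2) par(2) r(1)])
  have kK: "k x \<le> K" for x using K(1)[of x] by simp
  note inn = D_in_parity[OF assms(6) par(2) r fmono vlimit vd fk H kd kK K(3) a0 ka]
  have rate: "0 < Re (mu z)" if "z \<in> unstable_halfplane" for z
    using assms(7) that unfolding is_growing_mode_def by blast
  have ka0: "a_par \<gamma> vp \<le> k x + 0" for x using ka[of x] by simp
  note out = D_out_parity[OF assms(7) vpos r(2) par(2) r(1) vd b fk kd K(1,2,4) order_refl zero_le_one rate a0 ka0]
  define u where "u = vlim v0"
  have p0: "is_profile0 v0 u" unfolding u_def by (rule assms(8)[OF v0(1) par(4)])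
  note lp = limiting_profile_props[OF p0 v0(1) par(4)]
  note inn0 = limiting_D_in_parity[OF assms(9)[OF v0(1) par(4), folded u_def] lp(1,3,4,5)]
  have rate0: "1/2 < Re (mulim z)" if "z \<in> unstable_halfplane" for z
  proof (rule limiting_growth_rate)
    show "is_eigenpair (A_mat f_coef0 1 z) (mulim z) (Vlim z)" "0 < Re (mulim z)"
      using assms(10) that unfolding is_growing_mode_def by blast+
    show "0 \<le> Re z" using that by (simp add: unstable_halfplane_def)
  qed
  have kd0: "((\<lambda>x. 1 - u x) has_real_derivative - (u x * (u x - 1))) (at x)" for x
    by (rule DERIV_cong[OF DERIV_diff[OF DERIV_const lp(1)]]) simp
  have ub: "\<bar>u x * (u x - 1)\<bar> \<le> 1" for x
  proof -
    have "\<bar>u x\<bar> * \<bar>u x - 1\<bar> \<le> 1 * 1" using lp(3)[of x] lp(4)[of x] by (intro mult_mono) auto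
    then show ?thesis by (simp add: abs_mult)
  qed
  have out0: "deriv (D_out u Wlim) 0 \<noteq> 0" "even_count (D_out u Wlim) (unstable_roots (D_out u Wlim) - {0})"
  proof -
    have uv0: "v0 \<le> u x" if "x \<le> 0" for x using lp(6)[OF that] lp(2) by simp
    have b0: "u 0 * (u 0 - 1) < 0" using lp(3)[of 0] lp(4)[of 0] by (intro mult_pos_neg) auto
    have f0: "f_coef0 (u x) = u x - (1 - u x)" for x by (simp add: f_coef0_def)
    have k1: "\<bar>1 - u x\<bar> \<le> 1" and kd1: "\<bar>- (u x * (u x - 1))\<bar> \<le> 1" and kc: "1/2 \<le> (1 - u x) + 1/2" for x
      using lp(3)[of x] lp(4)[of x] ub[of x] by auto
    have h: "0 \<le> (1/2::real)" "(1/2::real) \<le> 1" "0 < (1/2::real)" by auto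
    note o = D_out_parity[OF assms(10)[folded u_def] lp(3) less_imp_le[OF lp(4)] v0(1) uv0 lp(1) b0 ub f0 kd0 k1 kd1 order_refl h(1,2) rate0 h(3) kc]
    show "deriv (D_out u Wlim) 0 \<noteq> 0" "even_count (D_out u Wlim) (unstable_roots (D_out u Wlim) - {0})"
      using o by auto
  qed
  have lim: "((\<lambda>u. D_in (Wtlim u) z) \<longlongrightarrow> 0) (at_right 0)" if "0 \<le> Re z" for z
    by (rule limiting_D_in_tendsto_zero[OF assms(8,9) that])
  show ?thesis using inn out inn0 out0 lim unfolding u_def by blast
qed

end
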